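(* For $(i,j)\in\mathcal C=\{(i,j)\in\mathbb Z^2:i\ge0\text{ or }j\ge0\}$, let $C_{i,j}$ be the length generating function (in the variable $t$) of walks with steps $(\pm1,\pm1)$ (all four sign choices) going from $(-2,0)$ to $(i,j)$ and confined to $\mathcal C$. Let $T$ be the unique series in $t$ with constant term $1$ satisfying $T=1+256\,t^2\frac{T^3}{(T+3)^3}$, and let $Z=\sqrt T$. For $j\ge0$, the series $C_{-1,j}$ and $C_{j,-1}$ belong to $t\,\mathbb Q(T)$, and are thus algebraic. More generally, for $i\ge1$ and $j\ge0$ having the same parity, the series $C_{-i,j}$ and $C_{j,-i}$ are D-finite, of the form $$\frac13Q_{i-2,j}+t^{\min(i,j)}\,\mathrm{Rat}(Z)$$ for some rational function $\mathrm{Rat}$ (with coefficients in $\mathbb Q$, depending on the series considered). They are transcendental as soon as $i\ge2$. Finally, for $i\ge0$ and $j\ge0$ having the same parity, the series $C_{i,j}$ is of the form $$-\frac13Q_{i,j}+t^{\min(i,j)}\,\mathrm{Rat}(Z)$$ for some rational function $\mathrm{Rat}$. It is D-finite and transcendental.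
   Context: A walk is confined to a set if all its vertices lie in it. The length generating function of a set of walks is $\sum_nc(n)t^n$, where $c(n)$ is the number of walks of length $n$. For $i,j\ge0$, $Q_{i,j}$ is the length generating function of walks with steps $(\pm1,\pm1)$ from $(0,0)$ to $(i,j)$ confined to $\{(i,j):i\ge0,\ j\ge0\}$; for $i,j$ of the same parity, $$Q_{i,j}=\sum_{n}\frac{(i+1)(j+1)}{\left(1+\frac{n+i}2\right)\left(1+\frac{n+j}2\right)}\binom n{\frac{n+i}2}\binom n{\frac{n+j}2}t^n,$$ the sum being over $n\ge0$ with the same parity as $i$ and $j$; by convention $Q_{-1,j}=0$. A power series in $t$ is D-finite if it satisfies a nontrivial linear differential equation with coefficients in $\mathbb Q(t)$; algebraic/transcendental refers to $\mathbb Q(t)$. *)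

theory Defs
  imports "HOL-Computational_Algebra.Computational_Algebra"
begin

section \<open>Walks and their length generating functions\<close>

definition diagonal_step :: "int \<times> int \<Rightarrow> int \<times> int \<Rightarrow> bool" where
  "diagonal_step p q \<longleftrightarrow> (fst q - fst p, snd q - snd p) \<in> {-1, 1} \<times> {-1, 1}"

text \<open>A walk of length \<open>n\<close> is given by the list of its \<open>n + 1\<close> vertices.\<close>

definition walks :: "(int \<times> int) set \<Rightarrow> int \<times> int \<Rightarrow> int \<times> int \<Rightarrow> nat \<Rightarrow> (int \<times> int) list set" where
  "walks R a b n =
     {w. length w = Suc n \<and> hd w = a \<and> last w = b \<and> set w \<subseteq> R \<and> successively diagonal_step w}"

lemma finite_walks: "finite (walks R a b n)"
proof (induction n arbitrary: a)
  case 0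
  have "walks R a b 0 \<subseteq> {[a]}"
    by (auto simp: walks_def length_Suc_conv)
  then show ?case by (rule finite_subset) simp
next
  case (Suc n)
  let ?S = "(\<lambda>d. (fst a + fst d, snd a + snd d)) ` ({-1, 1} \<times> {-1, 1})"
  have "walks R a b (Suc n) \<subseteq> (\<Union>c\<in>?S. (#) a ` walks R c b n)"
  proof
    fix w assume w: "w \<in> walks R a b (Suc n)"
    then obtain c v where wv: "w = a # c # v"
      by (auto simp: walks_def length_Suc_conv)
    have "diagonal_step a c"
      using w by (auto simp: walks_def wv)
    then have "c \<in> ?S"
      by (auto simp: diagonal_step_def image_iff intro!: prod_eqI)
    moreover have "c # v \<in> walks R c b n"
      using w by (auto simp: walks_def wv)
    ultimately show "w \<in> (\<Union>c\<in>?S. (#) a ` walks R c b n)"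
      unfolding wv by blast
  qed
  moreover have "finite (\<Union>c\<in>?S. (#) a ` walks R c b n)"
    using Suc.IH by (intro finite_UN_I finite_imageI) auto
  ultimately show ?case by (rule finite_subset)
qed

text \<open>
  All series are regarded as elements of the field of formal Laurent series over the rationals,
  with \<open>fls_X\<close> as the variable \<open>t\<close>, so that rational functions of them make sense.
\<close>

definition length_gf :: "(nat \<Rightarrow> 'a set) \<Rightarrow> rat fls" where
  "length_gf W = fps_to_fls (Abs_fps (\<lambda>n. of_nat (card (W n))))"

definition quadrant :: "(int \<times> int) set" where
  "quadrant = {(i, j). i \<ge> 0 \<and> j \<ge> 0}"

definition three_quadrants :: "(int \<times> int) set" where
  "three_quadrants = {(i, j). i \<ge> 0 \<or> j \<ge> 0}"

text \<open>
  An endpoint outside the region leaves no walk; in particular \<open>Q (-1) j = 0\<close>.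
\<close>

definition Q :: "int \<Rightarrow> int \<Rightarrow> rat fls" where
  "Q i j = length_gf (walks quadrant (0, 0) (i, j))"

definition C :: "int \<Rightarrow> int \<Rightarrow> rat fls" where
  "C i j = length_gf (walks three_quadrants (-2, 0) (i, j))"

section \<open>Rational, algebraic and D-finite series\<close>

text \<open>\<open>rational_in f\<close> is the field of all rational functions of \<open>f\<close> with rational coefficients.\<close>

definition rational_in :: "rat fls \<Rightarrow> rat fls set" where
  "rational_in f =
     {poly (map_poly fls_const p) f / poly (map_poly fls_const q) f | p q.
        poly (map_poly fls_const q) f \<noteq> 0}"

definition algebraic_series :: "rat fls \<Rightarrow> bool" where
  "algebraic_series f \<longleftrightarrow>
     (\<exists>p. p \<noteq> 0 \<and> (\<forall>k. coeff p k \<in> rational_in fls_X) \<and> poly p f = 0)"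

abbreviation transcendental_series :: "rat fls \<Rightarrow> bool" where
  "transcendental_series f \<equiv> \<not> algebraic_series f"

definition D_finite :: "rat fls \<Rightarrow> bool" where
  "D_finite f \<longleftrightarrow>
     (\<exists>d a. (\<forall>k\<le>d. a k \<in> rational_in fls_X) \<and> (\<exists>k\<le>d. a k \<noteq> 0) \<and>
            (\<Sum>k\<le>d. a k * (fls_deriv ^^ k) f) = 0)"

section \<open>The series T and Z\<close>

text \<open>The denominator \<open>(S + 3)^3\<close> below has constant term 64, hence is a unit.\<close>

definition is_T :: "rat fps \<Rightarrow> bool" where
  "is_T S \<longleftrightarrow> fps_nth S 0 = 1 \<and> S = 1 + 256 * fps_X ^ 2 * (S ^ 3 / (S + 3) ^ 3)"

lemma ex1_T: "\<exists>!S. is_T S"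
proof -
  define D :: "rat fps" where "D = 256 * (1 + fps_X) ^ 3"
  define G :: "rat fps" where "G = fps_X * (fps_X + 4) ^ 3 * inverse D"
  have num: "fps_nth (numeral k :: rat fps) 0 = numeral k" for k
    by (simp add: fps_numeral_fps_const)
  have numc: "(numeral k :: rat fps) oo u = numeral k" for k u
    by (simp add: fps_numeral_fps_const)
  have D0: "fps_nth D 0 = 256"
    by (simp add: D_def num fps_power_zeroth)
  have G0: "fps_nth G 0 = 0"
    by (simp add: G_def)
  have "G = fps_X * ((fps_X + 4) ^ 3 * inverse D)"
    by (simp add: G_def mult.assoc)
  then have "fps_nth G 1 = fps_nth ((fps_X + 4) ^ 3 * inverse D) 0"
    by (simp only: fps_X_mult_nth) simp
  then have G1: "fps_nth G 1 \<noteq> 0"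
    by (simp add: D0 num fps_power_zeroth)
  have Gcomp: "G oo u = u * (u + 4) ^ 3 * inverse (256 * (1 + u) ^ 3)"
    if "fps_nth u 0 = 0" for u
    using that D0
    by (simp add: G_def D_def fps_compose_mult_distrib fps_inverse_compose fps_compose_add_distrib
        fps_compose_power[symmetric] numc)
  have key: "is_T (1 + u) \<longleftrightarrow> G oo u = fps_X ^ 2" if u: "fps_nth u 0 = 0" for u
  proof -
    have nz: "(u + 4) ^ 3 \<noteq> 0" "fps_nth ((u + 4) ^ 3) 0 \<noteq> 0"
      using u by (auto simp: fps_power_zeroth num dest: arg_cong[where f = "\<lambda>f. fps_nth f 0"])
    have nz': "fps_nth (256 * (1 + u) ^ 3) 0 \<noteq> 0"
      using u by (simp add: fps_power_zeroth num)
    have c1: "(u + 4) ^ 3 * inverse ((u + 4) ^ 3) = 1"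
      using nz by (simp add: inverse_mult_eq_1')
    have c2: "(256 * (1 + u) ^ 3) * inverse (256 * (1 + u) ^ 3) = 1"
      using nz' by (rule inverse_mult_eq_1')
    have "is_T (1 + u) \<longleftrightarrow> u = 256 * fps_X ^ 2 * ((1 + u) ^ 3 * inverse ((u + 4) ^ 3))"
      using u nz(2) by (simp add: is_T_def fps_divide_unit add_ac)
    also have "\<dots> \<longleftrightarrow> u * (u + 4) ^ 3 = 256 * fps_X ^ 2 * (1 + u) ^ 3"
    proof
      assume *: "u = 256 * fps_X ^ 2 * ((1 + u) ^ 3 * inverse ((u + 4) ^ 3))"
      have "u * (u + 4) ^ 3 =
          256 * fps_X ^ 2 * (1 + u) ^ 3 * ((u + 4) ^ 3 * inverse ((u + 4) ^ 3))"
        using arg_cong[OF *, of "\<lambda>f. f * (u + 4) ^ 3"] by (simp only: mult_ac)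
      then show "u * (u + 4) ^ 3 = 256 * fps_X ^ 2 * (1 + u) ^ 3"
        by (simp only: c1 mult_1_right)
    next
      assume *: "u * (u + 4) ^ 3 = 256 * fps_X ^ 2 * (1 + u) ^ 3"
      have "u * ((u + 4) ^ 3 * inverse ((u + 4) ^ 3)) =
          256 * fps_X ^ 2 * ((1 + u) ^ 3 * inverse ((u + 4) ^ 3))"
        using arg_cong[OF *, of "\<lambda>f. f * inverse ((u + 4) ^ 3)"] by (simp only: mult_ac)
      then show "u = 256 * fps_X ^ 2 * ((1 + u) ^ 3 * inverse ((u + 4) ^ 3))"
        by (simp only: c1 mult_1_right)
    qed
    also have "\<dots> \<longleftrightarrow> u * (u + 4) ^ 3 * inverse (256 * (1 + u) ^ 3) = fps_X ^ 2"
    proof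
      assume *: "u * (u + 4) ^ 3 = 256 * fps_X ^ 2 * (1 + u) ^ 3"
      have "u * (u + 4) ^ 3 * inverse (256 * (1 + u) ^ 3) =
          fps_X ^ 2 * ((256 * (1 + u) ^ 3) * inverse (256 * (1 + u) ^ 3))"
        using arg_cong[OF *, of "\<lambda>f. f * inverse (256 * (1 + u) ^ 3)"] by (simp only: mult_ac)
      then show "u * (u + 4) ^ 3 * inverse (256 * (1 + u) ^ 3) = fps_X ^ 2"
        by (simp only: c2 mult_1_right)
    next
      assume *: "u * (u + 4) ^ 3 * inverse (256 * (1 + u) ^ 3) = fps_X ^ 2"
      have "u * (u + 4) ^ 3 * ((256 * (1 + u) ^ 3) * inverse (256 * (1 + u) ^ 3)) =
          256 * fps_X ^ 2 * (1 + u) ^ 3"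
        using arg_cong[OF *, of "\<lambda>f. f * (256 * (1 + u) ^ 3)"] by (simp only: mult_ac)
      then show "u * (u + 4) ^ 3 = 256 * fps_X ^ 2 * (1 + u) ^ 3"
        by (simp only: c2 mult_1_right)
    qed
    also have "\<dots> \<longleftrightarrow> G oo u = fps_X ^ 2"
      by (simp add: Gcomp u)
    finally show ?thesis .
  qed
  define u where "u = fps_inv G oo fps_X ^ 2"
  have u0: "fps_nth u 0 = 0"
    by (simp add: u_def fps_inv_def)
  have "G oo u = (G oo fps_inv G) oo fps_X ^ 2"
    unfolding u_def by (rule fps_compose_assoc) (simp_all add: fps_inv_def)
  then have "G oo u = fps_X ^ 2"
    by (simp add: fps_inv_right[OF G0 G1])
  then have "is_T (1 + u)"
    by (simp add: key u0)
  moreover have "S = 1 + u" if S: "is_T S" for S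
  proof -
    define v where "v = S - 1"
    have v0: "fps_nth v 0 = 0" and Sv: "S = 1 + v"
      using S by (simp_all add: v_def is_T_def)
    have "v = (fps_inv G oo G) oo v"
      by (simp add: fps_inv[OF G0 G1] v0)
    also have "\<dots> = fps_inv G oo (G oo v)"
      by (rule fps_compose_assoc[symmetric]) (simp_all add: G0 v0)
    also have "G oo v = fps_X ^ 2"
      using S key[OF v0] by (simp add: Sv)
    finally show ?thesis by (simp add: Sv u_def)
  qed
  ultimately show ?thesis by blast
qed

definition T :: "rat fps" where
  "T = (THE S. is_T S)"

lemma is_T_T: "is_T T"
  unfolding T_def by (rule theI'[OF ex1_T])

text \<open>Of the two square roots of \<open>T\<close>, the one with constant term 1 is taken.\<close>

definition Z :: "rat fps" where
  "Z = (THE S. fps_nth S 0 = 1 \<and> S ^ 2 = T)"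

lemma Z_unique: "\<exists>!S. fps_nth S 0 = 1 \<and> S ^ 2 = T"
proof -
  have T0: "fps_nth T 0 = 1"
    using is_T_T by (simp add: is_T_def)
  let ?R = "fps_radical (\<lambda>_ x. x) (Suc (Suc 0)) T"
  have "?R ^ Suc (Suc 0) = T"
    using iffD1[OF power_radical[where r = "\<lambda>_ x. x" and k = "Suc 0" and a = T]] T0 by simp
  then have "fps_nth ?R 0 = 1 \<and> ?R ^ 2 = T"
    using T0 by (simp add: numeral_2_eq_2)
  moreover have "S = S'"
    if "fps_nth S 0 = 1 \<and> S ^ 2 = T" "fps_nth S' 0 = 1 \<and> S' ^ 2 = T" for S S' :: "rat fps"
  proof -
    have "S ^ 2 = S' ^ 2"
      using that by simp
    then have "S = S' \<or> S = - S'"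
      by (simp add: power2_eq_iff)
    moreover have "S \<noteq> - S'"
      using that by (auto dest: arg_cong[where f = "\<lambda>f. fps_nth f 0"])
    ultimately show ?thesis by blast
  qed
  ultimately show ?thesis by blast
qed

end

theory Submission
  imports Defs
begin

text \<open>
  The reflection principle continues the quadrant walks to a function on the three-quadrant cone that satisfies the same
  step recurrence (\<open>reflected\<close>). It equals \<open>- Q i j\<close> in the quadrant and \<open>Q (-i-2) j\<close> on its left. The point of the
  proof is that three times the three-quadrant series minus this function, \<open>residue_part\<close>, has values in \<open>\<rat>(t, Z)\<close>.

  Reflection in the diagonal splits \<open>residue_part\<close> into a symmetric and an antisymmetric part, each of which lives in one
  half of the cone. In suitable coordinates this half is a quadrant with Gessel steps, and the generating functions satisfy kernel
  equations. The main tool is \<open>kernel_invariant\<close>: if the kernel divides \<open>f(x) - g(y)\<close>, then \<open>f\<close> and \<open>g\<close> are equal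
  constants. The kernel has a rational pair of invariants, and the boundary series of the two parts give further pairs;
  polynomial combinations without poles yield \<open>cubic_equations\<close> and \<open>quadratic_equations\<close>, with unknown
  constants. Evaluating at the critical points makes the cubic polynomials have double roots, which
  determines the constants as rational functions of \<open>Z\<close> (\<open>boundary_equations\<close>). All coefficients then follow
  successively from linear equations (\<open>parts_in_FZ\<close>).

  On the line \<open>i = -1\<close> the smaller field \<open>\<rat>(t, T)\<close> suffices (\<open>parts_on_line_in\<close>): the part that changes sign together
  with \<open>Z\<close> can be absorbed in a harmonic function vanishing on this line. Since \<open>T\<close> and \<open>Z\<close> are even in \<open>t\<close> and walks
  to a given point have lengths of one parity, the dependence on \<open>t\<close> itself reduces to a power of \<open>t\<close>
  (\<open>parity_part\<close>).

  The coefficients of \<open>Q i j\<close> are products of two ballot numbers and satisfy a hypergeometric recurrence,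
  that is, a linear differential equation of order four. Together with the powers of \<open>Z\<close>, the derivatives of \<open>Q i j\<close>
  span a finite-dimensional space over \<open>\<rat>(t)\<close>, which makes the sums D-finite. On the other hand, the coefficients
  have order \<open>4 ^ n / n\<^sup>3\<close>, so a second derivative has a logarithmic singularity at \<open>t = 1 / 4\<close>; such a series
  satisfies no polynomial equation (\<open>log_singularity_no_relation\<close>). Hence \<open>Q i j\<close> is transcendental, and so is its sum
  with an algebraic series.
\<close>

section \<open>Counting walks by their last step\<close>

lemma walks_0: "walks R a b 0 = (if a = b \<and> b \<in> R then {[a]} else {})"
  by (auto simp: walks_def length_Suc_conv)

lemma walks_Suc:
  assumes "b \<in> R"
  shows "walks R a b (Suc n) = (\<lambda>w. w @ [b]) ` (\<Union>c\<in>{c. diagonal_step c b}. walks R a c n)"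
proof (intro equalityI subsetI)
  fix w assume w: "w \<in> walks R a b (Suc n)"
  then have ne: "w \<noteq> []" "length w = Suc (Suc n)" "last w = b"
    by (auto simp: walks_def)
  define v where "v = butlast w"
  have wv: "w = v @ [b]"
    using ne by (metis append_butlast_last_id v_def)
  with ne have v: "v \<noteq> []" by auto
  have "v \<in> walks R a (last v) n" "diagonal_step (last v) b"
    using w v by (auto simp: walks_def wv successively_append_iff hd_append)
  then show "w \<in> (\<lambda>w. w @ [b]) ` (\<Union>c\<in>{c. diagonal_step c b}. walks R a c n)"
    unfolding wv by blast
next
  fix w assume "w \<in> (\<lambda>w. w @ [b]) ` (\<Union>c\<in>{c. diagonal_step c b}. walks R a c n)"
  then obtain c v where v: "w = v @ [b]" "diagonal_step c b" "v \<in> walks R a c n"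
    by blast
  then have "v \<noteq> []" by (auto simp: walks_def)
  with v assms show "w \<in> walks R a b (Suc n)"
    by (auto simp: walks_def successively_append_iff hd_append)
qed

lemma diagonal_step_to:
  "{c. diagonal_step c (i, j)} = {(i-1, j-1), (i-1, j+1), (i+1, j-1), (i+1, j+1)}"
  by (auto simp: diagonal_step_def)

lemma card_walks_Suc:
  assumes "(i, j) \<in> R"
  shows "card (walks R a (i, j) (Suc n)) =
    card (walks R a (i-1, j-1) n) + card (walks R a (i-1, j+1) n) +
    card (walks R a (i+1, j-1) n) + card (walks R a (i+1, j+1) n)"
proof -
  have "card (walks R a (i, j) (Suc n)) = card (\<Union>c\<in>{c. diagonal_step c (i, j)}. walks R a c n)"
    unfolding walks_Suc[OF assms] by (rule card_image) (auto simp: inj_on_def)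
  also have "\<dots> = (\<Sum>c\<in>{c. diagonal_step c (i, j)}. card (walks R a c n))"
    by (rule card_UN_disjoint) (auto simp: diagonal_step_to finite_walks, auto simp: walks_def)
  finally show ?thesis by (simp add: diagonal_step_to)
qed

lemma walks_outside: "b \<notin> R \<Longrightarrow> walks R a b n = {}"
  by (auto simp: walks_def) (metis last_in_set list.size(3) nat.distinct(1) subsetD)

definition walk_series :: "(int \<times> int) set \<Rightarrow> int \<times> int \<Rightarrow> int \<Rightarrow> int \<Rightarrow> rat fps" where
  "walk_series R a i j = Abs_fps (\<lambda>n. of_nat (card (walks R a (i, j) n)))"

lemma walk_series_outside: "(i, j) \<notin> R \<Longrightarrow> walk_series R a i j = 0"
  by (simp add: walk_series_def walks_outside fps_eq_iff)

lemma walk_series_rec: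
  assumes "(i, j) \<in> R"
  shows "walk_series R a i j = (if a = (i, j) then 1 else 0) +
    fps_X * (walk_series R a (i-1) (j-1) + walk_series R a (i-1) (j+1) +
             walk_series R a (i+1) (j-1) + walk_series R a (i+1) (j+1))"
proof (rule fps_ext)
  fix n
  show "walk_series R a i j $ n = ((if a = (i, j) then 1 else 0) +
    fps_X * (walk_series R a (i-1) (j-1) + walk_series R a (i-1) (j+1) +
             walk_series R a (i+1) (j-1) + walk_series R a (i+1) (j+1))) $ n"
  proof (cases n)
    case 0
    then show ?thesis using assms by (auto simp: walk_series_def walks_0)
  next
    case (Suc m)
    then show ?thesis using card_walks_Suc[OF assms, of a m]
      by (simp add: walk_series_def)
  qed
qed

text \<open>Each step changes both coordinates by one, so the length of a walk has the parity of
  the change of either coordinate.\<close>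

lemma walk_series_parity:
  assumes "walk_series R (a1, a2) i j $ n \<noteq> 0"
  shows "even (int n) = even (i - a1) \<and> even (i - a1) = even (j - a2)"
  using assms
proof (induction n arbitrary: i j)
  case 0
  then show ?case by (auto simp: walk_series_def walks_0 split: if_splits)
next
  case (Suc n)
  have R: "(i, j) \<in> R"
    using Suc.prems walk_series_outside by fastforce
  have "walk_series R (a1, a2) (i-1) (j-1) $ n + walk_series R (a1, a2) (i-1) (j+1) $ n +
        walk_series R (a1, a2) (i+1) (j-1) $ n + walk_series R (a1, a2) (i+1) (j+1) $ n \<noteq> 0"
    using Suc.prems by (subst (asm) walk_series_rec[OF R]) (auto split: if_splits)
  then consider "walk_series R (a1, a2) (i-1) (j-1) $ n \<noteq> 0" | "walk_series R (a1, a2) (i-1) (j+1) $ n \<noteq> 0"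
    | "walk_series R (a1, a2) (i+1) (j-1) $ n \<noteq> 0" | "walk_series R (a1, a2) (i+1) (j+1) $ n \<noteq> 0"
    by fastforce
  then show ?case by cases (drule Suc.IH; auto)+
qed

lemma C_eq: "C i j = fps_to_fls (walk_series three_quadrants (-2, 0) i j)"
  by (simp add: C_def length_gf_def walk_series_def)

lemma Q_eq: "Q i j = fps_to_fls (walk_series quadrant (0, 0) i j)"
  by (simp add: Q_def length_gf_def walk_series_def)

section \<open>Walks in the quadrant\<close>

text \<open>The number of nonnegative one-dimensional walks with steps \<open>\<pm>1\<close> from \<open>0\<close> to \<open>i\<close>.
  A walk in the quadrant is a pair of such walks.\<close>

fun ballot :: "nat \<Rightarrow> nat \<Rightarrow> rat" where
  "ballot 0 i = (if i = 0 then 1 else 0)"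
| "ballot (Suc n) i = (if i = 0 then 0 else ballot n (i - 1)) + ballot n (i + 1)"

lemma walk_series_quadrant_nth:
  "walk_series quadrant (0, 0) (int i) (int j) $ n = ballot n i * ballot n j"
proof (induction n arbitrary: i j)
  case 0
  then show ?case by (auto simp: walk_series_def walks_0 quadrant_def)
next
  case (Suc n)
  let ?w = "walk_series quadrant (0, 0)"
  have out: "?w x y $ n = (if x < 0 \<or> y < 0 then 0 else ballot n (nat x) * ballot n (nat y))" for x y
    using Suc.IH[of "nat x" "nat y"] walk_series_outside[of x y quadrant "(0, 0)"]
    by (auto simp: quadrant_def)
  have q: "(int i, int j) \<in> quadrant"
    by (simp add: quadrant_def)
  have n: "nat (1 + int k) = Suc k" "nat (int k - 1) = k - 1" for k by auto
  show ?case
    by (subst walk_series_rec[OF q]) (auto simp: out n algebra_simps)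
qed

declare fps_mult_nth_0 [simp del] fps_mult_nth_1 [simp del] fps_mult_nth_1' [simp del]

section \<open>Power series in \<open>x\<close> and \<open>y\<close> modulo the kernel\<close>

definition map_fps :: "('a::zero \<Rightarrow> 'b::zero) \<Rightarrow> 'a fps \<Rightarrow> 'b fps" where
  "map_fps h f = Abs_fps (\<lambda>n. h (f $ n))"

lemma map_fps_nth [simp]: "map_fps h f $ n = h (f $ n)"
  by (simp add: map_fps_def)

locale coeff_hom =
  fixes h :: "'a::comm_ring_1 \<Rightarrow> 'b::comm_ring_1"
  assumes hom_add: "h (a + b) = h a + h b"
    and hom_mult: "h (a * b) = h a * h b"
    and hom_1: "h 1 = 1"
begin

lemma hom_0: "h 0 = 0"
  using hom_add[of 0 0] by simp

lemma hom_uminus: "h (- a) = - h a"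
  using hom_add[of a "- a"] by (simp add: hom_0 add_eq_0_iff)

lemma hom_diff: "h (a - b) = h a - h b"
  using hom_add[of a "- b"] by (simp add: hom_uminus)

lemma hom_sum: "h (\<Sum>x\<in>S. g x) = (\<Sum>x\<in>S. h (g x))"
  by (induction S rule: infinite_finite_induct) (auto simp: hom_0 hom_add)

lemma hom_power: "h (a ^ n) = h a ^ n"
  by (induction n) (auto simp: hom_1 hom_mult)

lemma hom_numeral: "h (numeral k) = numeral k"
  by (induction k) (simp_all only: numeral.simps hom_1 hom_add)

lemma map_hom: "coeff_hom (map_fps h)"
proof
  show "map_fps h (f + g) = map_fps h f + map_fps h g" for f g
    by (simp add: fps_eq_iff hom_add)
  show "map_fps h (f * g) = map_fps h f * map_fps h g" for f g
    by (simp add: fps_eq_iff fps_mult_nth hom_sum hom_mult)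
  show "map_fps h 1 = 1"
    by (simp add: fps_eq_iff hom_0 hom_1)
qed

lemma map_const: "map_fps h (fps_const c) = fps_const (h c)"
  by (simp add: fps_eq_iff hom_0)

lemma map_X: "map_fps h fps_X = fps_X"
  by (simp add: fps_eq_iff hom_0 hom_1 fps_X_def)

lemmas homs = hom_0 hom_1 hom_add hom_mult hom_diff hom_uminus hom_power hom_numeral

end

text \<open>
  Series in \<open>x\<close>, in \<open>y\<close>, or in both, always have coefficients in \<open>\<rat>[[t]]\<close>. In the ring of
  series in both, \<open>y\<close> is the outer and \<open>x\<close> the inner variable.
\<close>

type_synonym series1 = "rat fps fps"
type_synonym series2 = "rat fps fps fps"

text \<open>The three embeddings below are kept opaque, so that the simplifier does not merge
  constants of the different layers.\<close>

definition cst :: "rat fps \<Rightarrow> series1" where "cst = fps_const"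
definition in_x :: "series1 \<Rightarrow> series2" where "in_x = fps_const"
definition in_y :: "series1 \<Rightarrow> series2" where "in_y = map_fps cst"

interpretation cst: coeff_hom cst
  by standard (simp_all add: cst_def)

interpretation in_x: coeff_hom in_x
  by standard (simp_all add: in_x_def)

interpretation in_y: coeff_hom in_y
  unfolding in_y_def by (rule cst.map_hom)

lemma cst_nth: "cst c $ n = (if n = 0 then c else 0)"
  by (simp add: cst_def)

lemma cst_nth_0 [simp]: "cst c $ 0 = c"
  by (simp add: cst_def)

lemma cst_mult_nth [simp]: "(cst c * f) $ n = c * f $ n"
  by (simp add: cst_def)

lemma in_x_nth: "in_x f $ n = (if n = 0 then f else 0)"
  by (simp add: in_x_def)

lemma in_x_mult_nth [simp]: "(in_x f * h) $ n = f * h $ n"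
  by (simp add: in_x_def)

lemma in_y_nth [simp]: "in_y f $ n = cst (f $ n)"
  by (simp add: in_y_def)

abbreviation vt :: "series1" where "vt \<equiv> cst fps_X"
abbreviation tt :: "series2" where "tt \<equiv> in_x vt"
abbreviation xx :: "series2" where "xx \<equiv> in_x fps_X"
abbreviation yy :: "series2" where "yy \<equiv> fps_X"

lemma in_y_X [simp]: "in_y fps_X = yy"
  unfolding in_y_def by (rule cst.map_X)

lemma in_y_cst [simp]: "in_y (cst c) = in_x (cst c)"
  unfolding in_y_def in_x_def using cst.map_const[of c] by (simp add: cst_def)

lemmas embed = in_x.homs in_y.homs

definition kernel :: series2 where
  "kernel = xx * yy - tt * (1 + xx) * (1 + xx * yy\<^sup>2)"

lemma kernel_mult_nth:
  "(kernel * h) $ j $ k = (if j = 0 \<or> k = 0 then 0 else h $ (j-1) $ (k-1)) -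
     fps_X * (h $ j $ k + (if k = 0 then 0 else h $ j $ (k-1)) +
       (if k = 0 \<or> j < 2 then 0 else h $ (j-2) $ (k-1)) +
       (if k < 2 \<or> j < 2 then 0 else h $ (j-2) $ (k-2)))"
proof -
  have "(x * y - t * (1 + x) * (1 + x * y\<^sup>2)) * h =
      x * (y * h) - t * h - t * (x * h) - t * (x * (y * (y * h))) - t * (x * (x * (y * (y * h))))"
    for x y t h :: "'a::comm_ring_1"
    by (simp add: algebra_simps power2_eq_square)
  then have "kernel * h = xx * (yy * h) - tt * h - tt * (xx * h) - tt * (xx * (yy * (yy * h)))
      - tt * (xx * (xx * (yy * (yy * h))))"
    unfolding kernel_def by blast
  then have "(kernel * h) $ j $ k = (xx * (yy * h) - tt * h - tt * (xx * h) - tt * (xx * (yy * (yy * h)))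
      - tt * (xx * (xx * (yy * (yy * h))))) $ j $ k"
    by (rule arg_cong)
  also have "\<dots> = (if j = 0 \<or> k = 0 then 0 else h $ (j-1) $ (k-1)) -
     fps_X * (h $ j $ k + (if k = 0 then 0 else h $ j $ (k-1)) +
       (if k = 0 \<or> j < 2 then 0 else h $ (j-2) $ (k-1)) +
       (if k < 2 \<or> j < 2 then 0 else h $ (j-2) $ (k-2)))"
    by (cases k; cases j; cases "k - 1"; cases "j - 1")
      (simp_all add: numeral_2_eq_2 ring_distribs)
  finally show ?thesis .
qed

text \<open>Setting \<open>x = 0\<close> or \<open>y = 0\<close> leaves a nonzero multiple of a unit of the kernel, so both
  variables may be cancelled modulo the kernel.\<close>

lemma kernel_cancel_x:
  assumes "kernel dvd xx * F"
  shows "kernel dvd F"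
proof -
  obtain h where h: "xx * F = kernel * h"
    using assms by (elim dvdE)
  have "h $ j $ 0 = 0" for j
    using arg_cong[OF h, of "\<lambda>f. f $ j $ 0"] by (simp add: kernel_mult_nth)
  then have "h = xx * Abs_fps (\<lambda>j. fps_shift 1 (h $ j))"
    by (simp add: fps_eq_iff)
  then have "xx * F = xx * (kernel * Abs_fps (\<lambda>j. fps_shift 1 (h $ j)))"
    using h by (metis mult.left_commute)
  moreover have "xx \<noteq> 0"
    by (simp add: in_x_def)
  ultimately show ?thesis by (simp add: dvd_def)
qed

lemma kernel_cancel_y:
  assumes "kernel dvd yy * F"
  shows "kernel dvd F"
proof -
  obtain h where h: "yy * F = kernel * h"
    using assms by (elim dvdE)
  have "h $ 0 $ k = 0" for k
  proof (induction k)
    case 0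
    then show ?case
      using arg_cong[OF h, of "\<lambda>f. f $ 0 $ 0"] by (simp add: kernel_mult_nth del: fps_mult_nth_0 fps_mult_nth_1)
  next
    case (Suc k)
    then show ?case
      using arg_cong[OF h, of "\<lambda>f. f $ 0 $ Suc k"]
      by (simp add: kernel_mult_nth del: fps_mult_nth_0 fps_mult_nth_1)
  qed
  then have "h = yy * fps_shift 1 h"
    by (simp add: fps_eq_iff)
  then have "yy * F = yy * (kernel * fps_shift 1 h)"
    using h by (metis mult.left_commute)
  then show ?thesis by (simp add: dvd_def)
qed

text \<open>
  The basic lemma on invariants. In \<open>f(x) - g(y)\<close> no monomial contains both variables, so the
  cofactor \<open>h\<close> satisfies \<open>h\<^sub>k\<^sub>j = t \<cdot> (\<dots>)\<close>, a sum of other coefficients of \<open>h\<close>. Hence every power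
  of \<open>t\<close> divides \<open>h\<close>.
\<close>

lemma kernel_invariant:
  assumes "kernel dvd in_x f - in_y g"
  obtains c where "f = cst c" "g = cst c"
proof -
  obtain h where h: "in_x f - in_y g = kernel * h"
    using assms by (elim dvdE)
  have rec: "h $ j $ k = fps_X * (h $ Suc j $ Suc k + h $ Suc j $ k +
       (if j = 0 then 0 else h $ (j-1) $ k) +
       (if k = 0 \<or> j = 0 then 0 else h $ (j-1) $ (k-1)))" for j k
    using arg_cong[OF h, of "\<lambda>f. f $ Suc j $ Suc k"]
    by (auto simp: kernel_mult_nth in_x_nth cst_nth)
  have "h $ j $ k $ n = 0" for j k n
  proof (induction n arbitrary: j k)
    case 0
    then show ?case by (subst rec) simp
  next
    case (Suc n)
    then show ?case by (subst rec) simp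
  qed
  then have "h = 0"
    by (simp add: fps_eq_iff)
  with h have eq: "in_x f = in_y g"
    by simp
  have "f = cst (f $ 0)"
  proof (rule fps_ext)
    fix n
    show "f $ n = cst (f $ 0) $ n"
      using arg_cong[OF eq, of "\<lambda>f. f $ 0 $ n"] arg_cong[OF eq, of "\<lambda>f. f $ 0 $ 0"]
      by (simp add: in_x_nth cst_nth)
  qed
  moreover have "g = cst (f $ 0)"
  proof (rule fps_ext)
    fix n
    show "g $ n = cst (f $ 0) $ n"
      using arg_cong[OF eq, of "\<lambda>f. f $ n $ 0"] arg_cong[OF eq, of "\<lambda>f. f $ 0 $ 0"]
      by (simp add: in_x_nth cst_nth split: if_splits)
  qed
  ultimately show ?thesis by (rule that)
qed

text \<open>The inverse of a power series whose constant coefficient is a unit of \<open>\<rat>[[t]]\<close>.\<close>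

definition inv1 :: "series1 \<Rightarrow> series1" where
  "inv1 f = fps_right_inverse f (inverse (f $ 0))"

lemma inv1: "f $ 0 $ 0 \<noteq> 0 \<Longrightarrow> f * inv1 f = 1"
  unfolding inv1_def by (rule fps_right_inverse) (simp add: inverse_mult_eq_1')

subsection \<open>A rational pair of invariants\<close>

definition u1 :: series1 where "u1 = inv1 (1 + fps_X)"

lemma u1: "(1 + fps_X) * u1 = 1"
  unfolding u1_def by (rule inv1) simp

definition iota :: series1 where
  "iota = vt\<^sup>2 * (1 + fps_X)\<^sup>2 + fps_X\<^sup>2 * u1\<^sup>2"

definition kappa :: series1 where
  "kappa = 4 * vt\<^sup>2 * fps_X\<^sup>2 + vt * fps_X * (1 + fps_X\<^sup>2) - vt\<^sup>2 * (1 + fps_X\<^sup>2)\<^sup>2"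

text \<open>This pair of invariants comes from the steps alone. It expresses that the group of the kernel is finite.\<close>

lemma kernel_dvd_iota_kappa: "kernel dvd yy\<^sup>2 * in_x iota - xx * in_y kappa"
proof -
  have u: "(1 + xx) * in_x u1 = 1"
    using arg_cong[OF u1, of in_x] by (simp only: embed)
  have i: "in_x iota = tt\<^sup>2 * (1 + xx)\<^sup>2 + xx\<^sup>2 * (in_x u1)\<^sup>2"
    by (simp only: iota_def embed)
  have k: "in_y kappa = 4 * tt\<^sup>2 * yy\<^sup>2 + tt * yy * (1 + yy\<^sup>2) - tt\<^sup>2 * (1 + yy\<^sup>2)\<^sup>2"
    by (simp only: kappa_def embed in_y_X in_y_cst)
  let ?m = "1 + xx" and ?u = "in_x u1"
  have "(x * y - t * m * (1 + x * y\<^sup>2)) * (x * y - t * m * (x + y\<^sup>2)) =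
      y\<^sup>2 * (t\<^sup>2 * m ^ 4 + x\<^sup>2) - x * m\<^sup>2 * (4 * t\<^sup>2 * y\<^sup>2 + t * y * (1 + y\<^sup>2) - t\<^sup>2 * (1 + y\<^sup>2)\<^sup>2)"
    if "m = 1 + x" for m x y t :: "'a::comm_ring_1"
    unfolding that by (simp add: algebra_simps power2_eq_square power4_eq_xxxx)
  from this[of ?m xx yy tt]
  have "kernel * (xx * yy - tt * ?m * (xx + yy\<^sup>2)) =
      yy\<^sup>2 * (tt\<^sup>2 * ?m ^ 4 + xx\<^sup>2) - xx * ?m\<^sup>2 *
        (4 * tt\<^sup>2 * yy\<^sup>2 + tt * yy * (1 + yy\<^sup>2) - tt\<^sup>2 * (1 + yy\<^sup>2)\<^sup>2)" (is "_ = ?r")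
    unfolding kernel_def by blast
  then have r: "kernel dvd ?r"
    by (rule dvdI[OF sym])
  have "u\<^sup>2 * (y\<^sup>2 * (t\<^sup>2 * m ^ 4 + x\<^sup>2) - x * m\<^sup>2 * k) =
      y\<^sup>2 * (t\<^sup>2 * m\<^sup>2 * (m * u)\<^sup>2 + x\<^sup>2 * u\<^sup>2) - x * (m * u)\<^sup>2 * k"
    for u m x y t k :: "'a::comm_ring_1"
    by (simp add: algebra_simps power2_eq_square power4_eq_xxxx)
  from this[of ?u yy tt ?m xx "4 * tt\<^sup>2 * yy\<^sup>2 + tt * yy * (1 + yy\<^sup>2) - tt\<^sup>2 * (1 + yy\<^sup>2)\<^sup>2"]
  have "?u\<^sup>2 * ?r = yy\<^sup>2 * in_x iota - xx * in_y kappa"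
    unfolding u i k by (simp only: power_one mult_1_right)
  moreover have "kernel dvd ?u\<^sup>2 * ?r"
    using r by (rule dvd_mult)
  ultimately show ?thesis by (simp only:)
qed

lemma kernel_dvd_square_factors:
  "kernel dvd yy\<^sup>2 * (tt\<^sup>2 * (1 + xx) ^ 4 - xx\<^sup>2) +
     tt\<^sup>2 * (1 + xx)\<^sup>2 * (1 - yy\<^sup>2) * (1 - xx\<^sup>2 * yy\<^sup>2)"
proof -
  have "y\<^sup>2 * (t\<^sup>2 * (1 + x) ^ 4 - x\<^sup>2) +
     t\<^sup>2 * (1 + x)\<^sup>2 * (1 - y\<^sup>2) * (1 - x\<^sup>2 * y\<^sup>2) =
     (x * y - t * (1 + x) * (1 + x * y\<^sup>2)) * - (x * y + t * (1 + x) * (1 + x * y\<^sup>2))"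
    for x y t :: "'a::comm_ring_1"
    by (simp add: algebra_simps power2_eq_square power4_eq_xxxx)
  from this[of yy tt xx] show ?thesis
    unfolding kernel_def by (metis dvd_triv_left)
qed

section \<open>Subtracting reflected quadrant walks\<close>

abbreviation quarter :: "int \<Rightarrow> int \<Rightarrow> rat fps" where
  "quarter \<equiv> walk_series quadrant (0, 0)"

abbreviation three :: "int \<Rightarrow> int \<Rightarrow> rat fps" where
  "three \<equiv> walk_series three_quadrants (-2, 0)"

text \<open>Walks in the quadrant, continued to the three-quadrant cone by the reflection principle: for \<open>j \<ge> 0\<close> the
  function is antisymmetric about the line \<open>i = -1\<close>, and for \<open>i \<ge> 0\<close> about the line \<open>j = -1\<close>. At most one of the
  three terms is nonzero.\<close>

definition reflected :: "int \<Rightarrow> int \<Rightarrow> rat fps" where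
  "reflected i j = quarter (-i-2) j + quarter i (-j-2) - quarter i j"

lemma quarter_outside: "i < 0 \<or> j < 0 \<Longrightarrow> quarter i j = 0"
  by (rule walk_series_outside) (auto simp: quadrant_def)

lemma quarter_rec:
  assumes "i \<ge> 0" "j \<ge> 0"
  shows "quarter i j = (if i = 0 \<and> j = 0 then 1 else 0) + fps_X * (quarter (i-1) (j-1) +
    quarter (i-1) (j+1) + quarter (i+1) (j-1) + quarter (i+1) (j+1))"
  using walk_series_rec[of i j quadrant "(0, 0)"] assms by (auto simp: quadrant_def)

lemma quarter_commute: "quarter i j = quarter j i"
proof (cases "i < 0 \<or> j < 0")
  case True
  then show ?thesis by (auto simp: quarter_outside)
next
  case False
  then have "quarter i j $ n = quarter j i $ n" for n
    using walk_series_quadrant_nth[of "nat i" "nat j" n] walk_series_quadrant_nth[of "nat j" "nat i" n]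
    by simp
  then show ?thesis by (simp add: fps_eq_iff)
qed

lemma reflected_commute: "reflected i j = reflected j i"
  by (simp add: reflected_def quarter_commute[of _ i] quarter_commute[of _ "- i - 2"] add.commute)

lemma reflected_outside: "i < 0 \<Longrightarrow> j < 0 \<Longrightarrow> reflected i j = 0"
  by (simp add: reflected_def quarter_outside)

lemma reflected_rec_upper:
  assumes "j \<ge> 0"
  shows "reflected i j = (if i = 0 \<and> j = 0 then -1 else if i = -2 \<and> j = 0 then 1 else 0) +
    fps_X * (reflected (i-1) (j-1) + reflected (i-1) (j+1) + reflected (i+1) (j-1) + reflected (i+1) (j+1))"
proof -
  consider "i \<ge> 0" | "i = -1" | "i \<le> -2" by linarith
  then show ?thesis
  proof cases
    case 1
    then show ?thesis
      using quarter_rec[OF 1 assms] assms by (auto simp: reflected_def quarter_outside algebra_simps)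
  next
    case 2
    then show ?thesis
      using assms by (auto simp: reflected_def quarter_outside algebra_simps)
  next
    case 3
    have e: "- 1 - i = - i - 1"
      by simp
    have "quarter i k = 0" "quarter (i - 1) k = 0" "quarter (i + 1) k = 0" for k
      using 3 by (auto intro!: quarter_outside)
    moreover have "quarter (- i - 2) j = (if i = -2 \<and> j = 0 then 1 else 0) + fps_X * (quarter (- i - 3) (j-1) +
      quarter (- i - 3) (j+1) + quarter (- i - 1) (j-1) + quarter (- i - 1) (j+1))"
      using quarter_rec[of "- i - 2" j] 3 assms by (auto simp: algebra_simps e)
    ultimately show ?thesis
      using 3 by (simp add: reflected_def algebra_simps e)
  qed
qed

text \<open>A function that is antisymmetric about a line satisfies the step recurrence across this line. The
  source at the origin reappears at its two mirror images.\<close>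

lemma reflected_rec:
  assumes "(i, j) \<in> three_quadrants"
  shows "reflected i j = (if i = 0 \<and> j = 0 then -1 else if i = -2 \<and> j = 0 \<or> i = 0 \<and> j = -2 then 1 else 0) +
    fps_X * (reflected (i-1) (j-1) + reflected (i-1) (j+1) + reflected (i+1) (j-1) + reflected (i+1) (j+1))"
proof (cases "j \<ge> 0")
  case True
  then show ?thesis using reflected_rec_upper[OF True, of i] by auto
next
  case False
  with assms have "i \<ge> 0" by (auto simp: three_quadrants_def)
  then show ?thesis
    using reflected_rec_upper[of i j] False
    unfolding reflected_commute[of i j] reflected_commute[of "i-1" "j-1"] reflected_commute[of "i-1" "j+1"]
      reflected_commute[of "i+1" "j-1"] reflected_commute[of "i+1" "j+1"]
    by (auto simp: add_ac)
qed

text \<open>The transcendental parts of the three-quadrant and of the reflected quadrant walks cancel for this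
  ratio of the weights; what is left is algebraic.\<close>

definition residue_part :: "int \<Rightarrow> int \<Rightarrow> rat fps" where
  "residue_part i j = 3 * three i j - reflected i j"

lemma three_outside: "i < 0 \<Longrightarrow> j < 0 \<Longrightarrow> three i j = 0"
  by (rule walk_series_outside) (auto simp: three_quadrants_def)

lemma residue_part_outside: "i < 0 \<Longrightarrow> j < 0 \<Longrightarrow> residue_part i j = 0"
  by (simp add: residue_part_def reflected_outside three_outside)

lemma residue_part_rec:
  assumes "i \<ge> 0 \<or> j \<ge> 0"
  shows "residue_part i j =
    (if i = 0 \<and> j = 0 then 1 else if i = -2 \<and> j = 0 then 2 else if i = 0 \<and> j = -2 then -1 else 0) +
    fps_X * (residue_part (i-1) (j-1) + residue_part (i-1) (j+1) +
      residue_part (i+1) (j-1) + residue_part (i+1) (j+1))"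
proof -
  have ij: "(i, j) \<in> three_quadrants"
    using assms by (simp add: three_quadrants_def)
  show ?thesis
    using reflected_rec[OF ij] walk_series_rec[OF ij, of "(-2, 0)"]
    by (auto simp: residue_part_def algebra_simps)
qed

subsection \<open>Symmetric and antisymmetric part\<close>

text \<open>The two sides of the diagonal are exchanged by reflection. On one side, the coordinates \<open>(k, j)\<close> with
  \<open>i = j - 2 k\<close> turn the cone into a quadrant and the diagonal steps into the steps \<open>N\<close>, \<open>S\<close>, \<open>NE\<close>, \<open>SW\<close> of
  Gessel. The reflected quadrant walks are symmetric and do not enter the antisymmetric part.\<close>

definition anti_part :: "nat \<Rightarrow> nat \<Rightarrow> rat fps" where
  "anti_part k j = three (int j - 2 * int k) (int j) - three (int j) (int j - 2 * int k)"

definition sym_part :: "nat \<Rightarrow> nat \<Rightarrow> rat fps" where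
  "sym_part k j = residue_part (int j - 2 * int k) (int j) + residue_part (int j) (int j - 2 * int k)"

lemma anti_part_0: "anti_part 0 j = 0"
  by (simp add: anti_part_def)

lemma residue_part_left:
  "2 * residue_part (int j - 2 * int k) (int j) = sym_part k j + 3 * anti_part k j"
  "2 * residue_part (int j) (int j - 2 * int k) = sym_part k j - 3 * anti_part k j"
  by (simp_all add: sym_part_def anti_part_def residue_part_def reflected_commute[of "int j"])

lemma three_rec:
  assumes "i \<ge> 0 \<or> j \<ge> 0"
  shows "three i j = (if i = -2 \<and> j = 0 then 1 else 0) +
    fps_X * (three (i-1) (j-1) + three (i-1) (j+1) + three (i+1) (j-1) + three (i+1) (j+1))"
  using walk_series_rec[of i j three_quadrants "(-2, 0)"] assms by (auto simp: three_quadrants_def)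

lemma anti_part_rec:
  "anti_part (Suc k) j = (if k = 0 \<and> j = 0 then 1 else 0) + fps_X * (anti_part (Suc k) (Suc j) +
     anti_part (Suc (Suc k)) (Suc j) + (if j = 0 then 0 else anti_part (Suc k) (j-1) + anti_part k (j-1)))"
proof (cases j)
  case 0
  have "three (- 1 - 2 * int k) (-1) = 0" "three (- 3 - 2 * int k) (-1) = 0"
    "three (-1) (- 1 - 2 * int k) = 0" "three (-1) (- 3 - 2 * int k) = 0"
    by (auto intro!: three_outside)
  then show ?thesis
    using 0 three_rec[of "- 2 - 2 * int k" 0] three_rec[of 0 "- 2 - 2 * int k"]
    by (simp add: anti_part_def algebra_simps)
next
  case (Suc m)
  then show ?thesis
    using three_rec[of "int j - 2 * int (Suc k)" "int j"] three_rec[of "int j" "int j - 2 * int (Suc k)"]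
    by (simp add: anti_part_def algebra_simps)
qed

lemma sym_part_rec:
  "sym_part (Suc k) j = (if k = 0 \<and> j = 0 then 1 else 0) + fps_X * (sym_part (Suc k) (Suc j) +
     sym_part (Suc (Suc k)) (Suc j) + (if j = 0 then 0 else sym_part (Suc k) (j-1) + sym_part k (j-1)))"
proof (cases j)
  case 0
  have "residue_part (- 1 - 2 * int k) (-1) = 0" "residue_part (- 3 - 2 * int k) (-1) = 0"
    "residue_part (-1) (- 1 - 2 * int k) = 0" "residue_part (-1) (- 3 - 2 * int k) = 0"
    by (auto intro!: residue_part_outside)
  then show ?thesis
    using 0 residue_part_rec[of "- 2 - 2 * int k" 0] residue_part_rec[of 0 "- 2 - 2 * int k"]
    by (simp add: sym_part_def algebra_simps)
next
  case (Suc m)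
  then show ?thesis
    using residue_part_rec[of "int j - 2 * int (Suc k)" "int j"]
      residue_part_rec[of "int j" "int j - 2 * int (Suc k)"]
    by (simp add: sym_part_def algebra_simps)
qed

lemma sym_part_diagonal_rec:
  "sym_part 0 j = (if j = 0 then 2 else 0) +
     fps_X * (sym_part 0 (Suc j) + (if j = 0 then 0 else sym_part 0 (j-1)) + 2 * sym_part 1 (Suc j))"
proof (cases j)
  case 0
  have "residue_part (-1) (-1) = 0"
    by (auto intro!: residue_part_outside)
  then show ?thesis
    using 0 residue_part_rec[of 0 0]
    by (simp add: sym_part_def algebra_simps)
next
  case (Suc m)
  then show ?thesis
    using residue_part_rec[of "int j" "int j"]
    by (simp add: sym_part_def algebra_simps)
qed

section \<open>The kernel equations\<close>

text \<open>The step recurrence, read on generating functions: the rows \<open>k \<ge> 1\<close>, multiplied by the kernel, involve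
  only values on the boundary of the quadrant.\<close>

lemma kernel_equation:
  assumes rec: "\<And>k j. P (Suc k) j = (if k = 0 \<and> j = 0 then 1 else 0) + fps_X * (P (Suc k) (Suc j) +
     P (Suc (Suc k)) (Suc j) + (if j = 0 then 0 else P (Suc k) (j-1) + P k (j-1)))"
  shows "kernel * Abs_fps (\<lambda>j. Abs_fps (\<lambda>k. P (Suc k) j)) =
    xx * yy + tt * xx * yy\<^sup>2 * in_y (Abs_fps (P 0)) - tt * (1 + xx) * in_x (Abs_fps (\<lambda>k. P (Suc k) 0))
      - tt * in_y (Abs_fps (\<lambda>j. if j = 0 then 0 else P 1 j))" (is "kernel * ?G = ?r")
proof (intro fps_ext)
  fix j k n
  have e: "xx * yy + tt * xx * yy\<^sup>2 * H - tt * (1 + xx) * X - tt * M =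
     xx * (yy * 1) + tt * (xx * (yy * (yy * H))) - tt * X - tt * (xx * X) - tt * M" for H X M
    by (simp add: algebra_simps power2_eq_square)
  have "(kernel * ?G) $ j $ k = ?r $ j $ k"
  proof (cases j)
    case 0
    then show ?thesis
      unfolding kernel_mult_nth e
      by (cases k) (simp_all add: ring_distribs in_x_nth cst_nth cst.homs)
  next
    case (Suc m)
    then show ?thesis
      unfolding kernel_mult_nth e using rec[of "k - 1" m]
      by (cases k; cases m; cases "k - 1")
        (simp_all add: ring_distribs numeral_2_eq_2 in_x_nth cst_nth cst.homs)
  qed
  then show "(kernel * ?G) $ j $ k $ n = ?r $ j $ k $ n"
    by simp
qed

section \<open>Polynomial equations for the boundary series\<close>

lemma numeral_mult_nth [simp]: "(numeral k * f :: 'a::comm_ring_1 fps) $ n = numeral k * f $ n"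
  by (simp add: fps_numeral_fps_const)

subsection \<open>The antisymmetric part\<close>

definition "anti_row = Abs_fps (\<lambda>k. anti_part (Suc k) 0)"
definition "anti_col = Abs_fps (\<lambda>j. if j = 0 then 0 else anti_part 1 j)"

definition "gam = anti_part 1 0"

definition "ee = 1 + 2 * fps_X\<^sup>2 * gam"
definition "hh = fps_X ^ 4 * gam\<^sup>2 + fps_X\<^sup>2 * gam - fps_X\<^sup>2 * (2 + 2 * fps_X * anti_part 1 1)"

definition ax :: series1 where
  "ax = fps_X * u1 - vt\<^sup>2 * (1 + fps_X) * anti_row"

definition bx :: series1 where
  "bx = 1 + vt * fps_X * anti_col"

definition VV :: series1 where "VV = ax + vt\<^sup>2 * cst gam"
definition BB :: series1 where "BB = vt * bx + vt\<^sup>2 * cst gam * fps_X"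
definition omega :: series1 where "omega = fps_shift 1 VV"

lemma u_xx: "(1 + xx) * in_x u1 = 1"
  using arg_cong[OF u1, of in_x] by (simp only: embed)

text \<open>Multiplied by \<open>t y\<close>, the right-hand side of the kernel equation has the single mixed term \<open>t x y\<^sup>2\<close>, apart
  from \<open>y\<close> times a function of \<open>x\<close>. Adding \<open>kernel / (1 + x)\<close> removes it, at the price of the separated
  terms \<open>x y / (1 + x)\<close> and \<open>t\<close>.\<close>

lemma kernel_dvd_VV_BB: "kernel dvd yy * in_x VV - in_y BB"
proof -
  let ?G = "Abs_fps (\<lambda>j. Abs_fps (\<lambda>k. anti_part (Suc k) j))"
  have z: "in_y (Abs_fps (anti_part 0)) = 0"
    by (simp add: fps_eq_iff anti_part_0 cst.homs)
  have k: "kernel * ?G = xx * yy - tt * (1 + xx) * in_x anti_row - tt * in_y anti_col"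
    using kernel_equation[of anti_part, OF anti_part_rec] z
    by (simp add: anti_row_def anti_col_def)
  have "(x * y - t * m * (1 + x * y\<^sup>2)) * (u + t * y * m * u * G) =
      y * (x * u - t\<^sup>2 * m * N + t\<^sup>2 * c) - (t * (1 + t * y * M) + t\<^sup>2 * c * y)"
    if K: "(x * y - t * m * (1 + x * y\<^sup>2)) * G = x * y - t * m * N - t * M" and mu: "m * u = 1"
    for x y t m u G N M c :: "'a::comm_ring_1"
  proof -
    have "(x * y - t * m * (1 + x * y\<^sup>2)) * (u + t * y * m * u * G) =
       x * y * u - t * (m * u) * (1 + x * y\<^sup>2) + t * y * (m * u) * ((x * y - t * m * (1 + x * y\<^sup>2)) * G)"
      by (simp add: algebra_simps)
    also have "\<dots> = y * (x * u - t\<^sup>2 * m * N + t\<^sup>2 * c) - (t * (1 + t * y * M) + t\<^sup>2 * c * y)"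
      unfolding K mu by (simp add: algebra_simps power2_eq_square)
    finally show ?thesis .
  qed
  from this[OF k[unfolded kernel_def] u_xx, of "in_x (cst gam)"]
  have "kernel * (in_x u1 + tt * yy * (1 + xx) * in_x u1 * ?G) = yy * in_x VV - in_y BB"
    unfolding kernel_def VV_def ax_def BB_def bx_def
    by (simp only: embed in_y_X in_y_cst)
  then show ?thesis by (rule dvdI[OF sym])
qed

lemma VV_omega: "VV = fps_X * omega"
proof -
  have "VV $ 0 = 0"
    by (simp add: VV_def ax_def anti_row_def gam_def ring_distribs mult.assoc flip: cst.homs)
  then show ?thesis
    by (simp add: omega_def fps_eq_iff)
qed

definition eta :: series1 where
  "eta = (let M1 = cst (anti_part 1 1); M2 = fps_shift 2 anti_col; R = vt\<^sup>2 * (M1 + fps_X * M2) in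
    vt - vt\<^sup>2 * fps_X + 2 * vt ^ 3 * M2 + 2 * vt ^ 4 * cst gam * (M1 + fps_X * M2) + fps_X * R\<^sup>2 - cst ee * R)"

text \<open>The constants \<open>ee\<close> and \<open>hh\<close> are those for which the coefficients of \<open>y\<close> and \<open>y\<^sup>2\<close> vanish.\<close>

lemma BB_square: "kappa + BB\<^sup>2 - cst ee * fps_X * BB + cst hh * fps_X\<^sup>2 = fps_X ^ 3 * eta"
proof -
  define M1 where "M1 = cst (anti_part 1 1)"
  define M2 where "M2 = fps_shift 2 anti_col"
  have M: "anti_col = fps_X * (M1 + fps_X * M2)"
  proof (rule fps_ext)
    fix n show "anti_col $ n = (fps_X * (M1 + fps_X * M2)) $ n"
      by (cases n; cases "n - 1") (simp_all add: anti_col_def M1_def M2_def cst_nth)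
  qed
  have e: "cst ee = 1 + 2 * vt\<^sup>2 * cst gam"
    by (simp only: ee_def cst.homs)
  have h: "cst hh = vt ^ 4 * (cst gam)\<^sup>2 + vt\<^sup>2 * cst gam - vt\<^sup>2 * (2 + 2 * vt * M1)"
    by (simp only: hh_def cst.homs M1_def)
  have "4 * t\<^sup>2 * y\<^sup>2 + t * y * (1 + y\<^sup>2) - t\<^sup>2 * (1 + y\<^sup>2)\<^sup>2 + (t * (1 + t * y * (y * (M + y * M'))) + t\<^sup>2 * g * y)\<^sup>2
      - (1 + 2 * t\<^sup>2 * g) * y * (t * (1 + t * y * (y * (M + y * M'))) + t\<^sup>2 * g * y)
      + (t ^ 4 * g\<^sup>2 + t\<^sup>2 * g - t\<^sup>2 * (2 + 2 * t * M)) * y\<^sup>2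
     = y ^ 3 * (t - t\<^sup>2 * y + 2 * t ^ 3 * M' + 2 * t ^ 4 * g * (M + y * M') + y * (t\<^sup>2 * (M + y * M'))\<^sup>2
      - (1 + 2 * t\<^sup>2 * g) * (t\<^sup>2 * (M + y * M')))" for t y g M M' :: "'a::comm_ring_1"
    by (simp add: algebra_simps power2_eq_square power3_eq_cube power4_eq_xxxx)
  note this[of vt fps_X M1 M2 "cst gam"]
  moreover have eta: "eta = vt - vt\<^sup>2 * fps_X + 2 * vt ^ 3 * M2 + 2 * vt ^ 4 * cst gam * (M1 + fps_X * M2)
      + fps_X * (vt\<^sup>2 * (M1 + fps_X * M2))\<^sup>2 - cst ee * (vt\<^sup>2 * (M1 + fps_X * M2))"
    by (simp only: eta_def Let_def M1_def M2_def)
  ultimately show ?thesis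
    unfolding kappa_def BB_def bx_def eta e h M by (simp only:)
qed

text \<open>The boundary series give a second pair of invariants. A polynomial combination of the two pairs in which
  the negative powers of \<open>x\<close> and \<open>y\<close> cancel is constant by the lemma on invariants.\<close>

theorem cubic_equations:
  obtains c where
    "omega * (iota + fps_X * (VV\<^sup>2 - cst ee * VV + cst hh)) = cst c"
    "(kappa + BB\<^sup>2 - cst ee * fps_X * BB + cst hh * fps_X\<^sup>2) * BB = cst c * fps_X ^ 3"
proof -
  define f where "f = omega * (iota + fps_X * (VV\<^sup>2 - cst ee * VV + cst hh))"
  obtain d1 where d1: "yy * in_x VV - in_y BB = kernel * d1"
    using kernel_dvd_VV_BB by (elim dvdE)
  obtain d2 where d2: "yy\<^sup>2 * in_x iota - xx * in_y kappa = kernel * d2"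
    using kernel_dvd_iota_kappa by (elim dvdE)
  have fV: "xx * in_x f = in_x VV * (in_x iota + xx * ((in_x VV)\<^sup>2 - in_x (cst ee) * in_x VV + in_x (cst hh)))"
    unfolding f_def by (subst (2) VV_omega) (simp only: embed mult_ac)
  have gB: "yy ^ 3 * in_y eta = in_y kappa + (in_y BB)\<^sup>2 - in_x (cst ee) * yy * in_y BB + in_x (cst hh) * yy\<^sup>2"
    using arg_cong[OF BB_square, of in_y, symmetric] by (simp only: embed in_y_X in_y_cst)
  have "y ^ 3 * (V * (i + x * (V\<^sup>2 - e * V + h))) - x * (k + B\<^sup>2 - e * y * B + h * y\<^sup>2) * B =
      (y * V) * (y\<^sup>2 * i - x * k) + x * (y * V - B) * (k + (y * V)\<^sup>2 + y * V * B + B\<^sup>2 - e * y * (y * V + B) + h * y\<^sup>2)"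
    for x y V B i k e h :: "'a::comm_ring_1"
    by (simp add: algebra_simps power2_eq_square power3_eq_cube)
  from this[of yy "in_x VV" "in_x iota" xx "in_x (cst ee)" "in_x (cst hh)" "in_y kappa" "in_y BB"]
  have "yy ^ 3 * (xx * in_x f) - xx * (yy ^ 3 * in_y eta) * in_y BB =
      kernel * ((yy * in_x VV) * d2 + xx * d1 * (in_y kappa + (yy * in_x VV)\<^sup>2 + yy * in_x VV * in_y BB + (in_y BB)\<^sup>2
        - in_x (cst ee) * yy * (yy * in_x VV + in_y BB) + in_x (cst hh) * yy\<^sup>2))"
    unfolding fV gB d1 d2 by (simp only: ring_distribs mult_ac)
  then have "kernel dvd yy ^ 3 * (xx * in_x f) - xx * (yy ^ 3 * in_y eta) * in_y BB"
    by (rule dvdI)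
  moreover have "y ^ 3 * (x * f) - x * (y ^ 3 * e) * b = x * (y * (y * (y * (f - e * b))))"
    for x y f e b :: "'a::comm_ring_1"
    by (simp add: algebra_simps power3_eq_cube)
  from this[of yy xx "in_x f" "in_y eta" "in_y BB"]
  have "yy ^ 3 * (xx * in_x f) - xx * (yy ^ 3 * in_y eta) * in_y BB =
    xx * (yy * (yy * (yy * (in_x f - in_y (eta * BB)))))"
    by (simp only: embed)
  ultimately have "kernel dvd xx * (yy * (yy * (yy * (in_x f - in_y (eta * BB)))))"
    by (simp only:)
  then have "kernel dvd in_x f - in_y (eta * BB)"
    by (rule kernel_cancel_y[OF kernel_cancel_y[OF kernel_cancel_y[OF kernel_cancel_x]]])
  then obtain c where c: "f = cst c" "eta * BB = cst c"
    by (rule kernel_invariant)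
  show ?thesis
  proof (rule that)
    show "omega * (iota + fps_X * (VV\<^sup>2 - cst ee * VV + cst hh)) = cst c"
      using c(1) by (simp only: f_def)
    show "(kappa + BB\<^sup>2 - cst ee * fps_X * BB + cst hh * fps_X\<^sup>2) * BB = cst c * fps_X ^ 3"
      unfolding BB_square c(2)[symmetric] by (simp only: mult_ac)
  qed
qed

subsection \<open>The symmetric part\<close>

definition "sym_row = Abs_fps (\<lambda>k. sym_part (Suc k) 0)"
definition "sym_diagonal = Abs_fps (sym_part 0)"

definition NN :: series1 where "NN = 2 * (1 + fps_X) * sym_row + cst (sym_part 0 0)"
definition nn :: series1 where "nn = 2 - vt\<^sup>2 * (1 + fps_X) * NN"
definition pp :: series1 where "pp = 2 + vt * fps_X * sym_diagonal"

lemma kernel_dvd_nn_pp: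
  "kernel dvd xx * yy * in_x nn - tt * (1 + xx) * (1 - xx\<^sup>2 * yy\<^sup>2) * in_y pp"
proof -
  define G where "G = Abs_fps (\<lambda>j. Abs_fps (\<lambda>k. sym_part (Suc k) j))"
  define M where "M = Abs_fps (\<lambda>j. if j = 0 then 0 else sym_part 1 j)"
  have k: "kernel * G = xx * yy + tt * xx * yy\<^sup>2 * in_y sym_diagonal
      - tt * (1 + xx) * in_x sym_row - tt * in_y M"
    using kernel_equation[of sym_part, OF sym_part_rec]
    by (simp add: sym_row_def sym_diagonal_def M_def G_def)
  have m: "2 * (vt * M) = (fps_X - vt * (1 + fps_X\<^sup>2)) * sym_diagonal - 2 * fps_X + vt * cst (sym_part 0 0)"
  proof (rule fps_ext)
    fix n
    have e: "(fps_X - vt * (1 + fps_X\<^sup>2)) * sym_diagonal = fps_X * sym_diagonal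
        - vt * sym_diagonal - vt * (fps_X * (fps_X * sym_diagonal))"
      by (simp add: algebra_simps power2_eq_square)
    show "(2 * (vt * M)) $ n =
      ((fps_X - vt * (1 + fps_X\<^sup>2)) * sym_diagonal - 2 * fps_X + vt * cst (sym_part 0 0)) $ n"
      unfolding e using sym_part_diagonal_rec[of "n - 1"]
      by (cases n; cases "n - 1") (simp_all add: M_def sym_diagonal_def cst_nth fps_numeral_nth algebra_simps)
  qed
  have m': "2 * (tt * in_y M) = (yy - tt * (1 + yy\<^sup>2)) * in_y sym_diagonal - 2 * yy + tt * in_x (cst (sym_part 0 0))"
    using arg_cong[OF m, of in_y] by (simp only: embed in_y_X in_y_cst)
  have "(x * y - t * (1 + x) * (1 + x * y\<^sup>2)) * (t * y * (1 + x) * (2 * (x * g) + H) + 2) =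
      x * y * (2 - t\<^sup>2 * (1 + x) * (2 * (1 + x) * N + h)) - t * (1 + x) * (1 - x\<^sup>2 * y\<^sup>2) * (2 + t * y * H)"
    if K: "(x * y - t * (1 + x) * (1 + x * y\<^sup>2)) * g = x * y + t * x * y\<^sup>2 * H - t * (1 + x) * N - M"
      and M: "2 * M = (y - t * (1 + y\<^sup>2)) * H - 2 * y + t * h"
    for x y t g H N M h :: "'a::comm_ring_1"
  proof -
    have "(x * y - t * (1 + x) * (1 + x * y\<^sup>2)) * (t * y * (1 + x) * (2 * (x * g) + H) + 2) =
        t * y * (1 + x) * x * (2 * ((x * y - t * (1 + x) * (1 + x * y\<^sup>2)) * g))
        + (x * y - t * (1 + x) * (1 + x * y\<^sup>2)) * (t * y * (1 + x) * H + 2)"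
      by (simp add: algebra_simps)
    also have "2 * ((x * y - t * (1 + x) * (1 + x * y\<^sup>2)) * g) =
        2 * (x * y + t * x * y\<^sup>2 * H - t * (1 + x) * N) - 2 * M"
      unfolding K by (simp add: algebra_simps)
    finally show ?thesis
      unfolding M by (simp add: algebra_simps power2_eq_square)
  qed
  from this[OF k[unfolded kernel_def] m']
  have "kernel * (tt * yy * (1 + xx) * (2 * (xx * G) + in_y sym_diagonal) + 2) =
      xx * yy * in_x nn - tt * (1 + xx) * (1 - xx\<^sup>2 * yy\<^sup>2) * in_y pp"
    unfolding kernel_def nn_def NN_def pp_def by (simp only: embed in_y_X in_y_cst)
  then show ?thesis by (rule dvdI[OF sym])
qed

lemma inv_nn: "nn * inv1 nn = 1"
proof (rule inv1)
  have e: "nn = 2 - vt * (vt * ((1 + fps_X) * NN))"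
    by (simp add: nn_def power2_eq_square mult.assoc)
  show "nn $ 0 $ 0 \<noteq> 0"
    unfolding e by simp
qed

lemma inv_pp: "pp * inv1 pp = 1"
  by (rule inv1) (simp add: pp_def mult.assoc)

definition zeta :: series1 where
  "zeta = - 2 * (vt\<^sup>2 * (1 + fps_X) ^ 3 - fps_X\<^sup>2 * u1) * inv1 nn"

definition xi :: series1 where
  "xi = 2 * vt * (1 - fps_X\<^sup>2) * inv1 pp"

text \<open>The square of \<open>t (1 + x)\<^sup>2\<close> minus \<open>x\<^sup>2\<close> and the product \<open>(1 - y\<^sup>2) (1 - x\<^sup>2 y\<^sup>2)\<close> agree modulo the kernel up
  to separated factors; dividing by the kernel equation of the symmetric part cancels the mixed factor
  \<open>1 - x\<^sup>2 y\<^sup>2\<close> and leaves a third pair of invariants.\<close>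

lemma kernel_dvd_zeta_xi: "kernel dvd yy * in_x zeta - xx * in_y xi"
proof -
  have "y * (t * m * (1 - y\<^sup>2) * x * n + y * E * p) =
      t * m * (1 - y\<^sup>2) * (x * y * n - t * m * (1 - x\<^sup>2 * y\<^sup>2) * p)
        + p * (y\<^sup>2 * E + t\<^sup>2 * m\<^sup>2 * (1 - y\<^sup>2) * (1 - x\<^sup>2 * y\<^sup>2))"
    for y t m x n E p :: "'a::comm_ring_1"
    by (simp add: algebra_simps power2_eq_square)
  note id = this[of yy tt "1 + xx" xx "in_x nn" "tt\<^sup>2 * (1 + xx) ^ 4 - xx\<^sup>2" "in_y pp"]
  have "kernel dvd yy * (tt * (1 + xx) * (1 - yy\<^sup>2) * xx * in_x nn + yy * (tt\<^sup>2 * (1 + xx) ^ 4 - xx\<^sup>2) * in_y pp)"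
    unfolding id by (intro dvd_add dvd_mult kernel_dvd_nn_pp kernel_dvd_square_factors)
  then have "kernel dvd tt * (1 + xx) * (1 - yy\<^sup>2) * xx * in_x nn + yy * (tt\<^sup>2 * (1 + xx) ^ 4 - xx\<^sup>2) * in_y pp"
    by (rule kernel_cancel_y)
  then have d: "kernel dvd (tt * (1 + xx) * (1 - yy\<^sup>2) * xx * in_x nn + yy * (tt\<^sup>2 * (1 + xx) ^ 4 - xx\<^sup>2) * in_y pp)
      * (- 2 * in_x u1 * in_x (inv1 nn) * in_y (inv1 pp))"
    by (rule dvd_mult2)
  have "(t * m * (1 - y\<^sup>2) * x * n + y * (t\<^sup>2 * m ^ 4 - x\<^sup>2) * p) * (- 2 * u * n' * p') =
     y * (- 2 * (t\<^sup>2 * m ^ 3 - x\<^sup>2 * u) * n') - x * (2 * t * (1 - y\<^sup>2) * p')"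
    if "n * n' = 1" "p * p' = 1" "m * u = 1" for t m y x n p u n' p' :: "'a::comm_ring_1"
  proof -
    have "(t * m * (1 - y\<^sup>2) * x * n + y * (t\<^sup>2 * m ^ 4 - x\<^sup>2) * p) * (- 2 * u * n' * p') =
      y * (- 2 * (t\<^sup>2 * m ^ 3 * (m * u) - x\<^sup>2 * u) * n') * (p * p') - x * (2 * t * (1 - y\<^sup>2) * p') * (m * u) * (n * n')"
      by (simp add: algebra_simps power3_eq_cube power4_eq_xxxx)
    then show ?thesis by (simp add: that)
  qed
  note this[OF _ _ u_xx, of "in_x nn" "in_x (inv1 nn)" "in_y pp" "in_y (inv1 pp)" tt yy xx]
  moreover have "in_x nn * in_x (inv1 nn) = 1" "in_y pp * in_y (inv1 pp) = 1"
    using arg_cong[OF inv_nn, of in_x] arg_cong[OF inv_pp, of in_y] by (simp_all only: embed)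
  ultimately have "(tt * (1 + xx) * (1 - yy\<^sup>2) * xx * in_x nn + yy * (tt\<^sup>2 * (1 + xx) ^ 4 - xx\<^sup>2) * in_y pp)
      * (- 2 * in_x u1 * in_x (inv1 nn) * in_y (inv1 pp)) = yy * in_x zeta - xx * in_y xi"
    unfolding zeta_def xi_def by (simp only: embed in_y_X in_y_cst)
  with d show ?thesis by (simp only:)
qed

lemma xi_0: "xi $ 0 = fps_X"
proof -
  have "pp $ 0 = 2"
    by (simp add: pp_def mult.assoc)
  then have "2 * inv1 pp $ 0 = 1"
    using arg_cong[OF inv_pp, of "\<lambda>f. f $ 0"] by (simp add: fps_mult_nth_0)
  moreover have e: "xi = vt * (2 * ((1 - fps_X * fps_X) * inv1 pp))"
    by (simp add: xi_def power2_eq_square)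
  ultimately show ?thesis
    unfolding e by (simp add: fps_mult_nth_0)
qed

lemma BB_0: "BB $ 0 = fps_X"
  by (simp add: BB_def bx_def mult.assoc power2_eq_square)

text \<open>The lemma on invariants again, applied to the pairs \<open>(zeta, xi)\<close> and \<open>(VV, BB)\<close>: a linear correction makes the
  product regular at \<open>x = 0\<close> and \<open>y = 0\<close>.\<close>

theorem quadratic_equations:
  obtains m d where
    "(zeta - fps_X * VV - cst m * fps_X) * omega = cst d"
    "(xi - BB - cst m * fps_X) * BB = cst d * fps_X\<^sup>2"
proof -
  define m where "m = xi $ 1 - BB $ 1"
  define th where "th = fps_shift 2 (xi - BB - cst m * fps_X)"
  have th: "xi - BB - cst m * fps_X = fps_X\<^sup>2 * th"
  proof (rule fps_ext)
    fix n show "(xi - BB - cst m * fps_X) $ n = (fps_X\<^sup>2 * th) $ n"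
      by (cases n; cases "n - 1") (simp_all add: th_def power2_eq_square mult.assoc xi_0 BB_0 m_def)
  qed
  define f where "f = (zeta - fps_X * VV - cst m * fps_X) * omega"
  obtain d1 where d1: "yy * in_x VV - in_y BB = kernel * d1"
    using kernel_dvd_VV_BB by (elim dvdE)
  obtain d5 where d5: "yy * in_x zeta - xx * in_y xi = kernel * d5"
    using kernel_dvd_zeta_xi by (elim dvdE)
  have fV: "xx * in_x f = (in_x zeta - xx * in_x VV - in_x (cst m) * xx) * in_x VV"
    unfolding f_def by (subst (3) VV_omega) (simp only: embed mult_ac)
  have gB: "yy\<^sup>2 * in_y th = in_y xi - in_y BB - in_x (cst m) * yy"
    using arg_cong[OF th, of in_y, symmetric] by (simp only: embed in_y_X in_y_cst)
  have "y\<^sup>2 * ((z - x * V - m * x) * V) - x * (s - B - m * y) * B =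
      (y * V) * (y * z - x * s) + x * (y * V - B) * (s - m * y - (y * V + B))"
    for x y V B z s m :: "'a::comm_ring_1"
    by (simp add: algebra_simps power2_eq_square)
  from this[of yy "in_x zeta" xx "in_x VV" "in_x (cst m)" "in_y xi" "in_y BB"]
  have "yy\<^sup>2 * (xx * in_x f) - xx * (yy\<^sup>2 * in_y th) * in_y BB =
      kernel * ((yy * in_x VV) * d5 + xx * d1 * (in_y xi - in_x (cst m) * yy - (yy * in_x VV + in_y BB)))"
    unfolding fV gB d1 d5 by (simp only: ring_distribs mult_ac)
  then have "kernel dvd yy\<^sup>2 * (xx * in_x f) - xx * (yy\<^sup>2 * in_y th) * in_y BB"
    by (rule dvdI)
  moreover have "y\<^sup>2 * (x * f) - x * (y\<^sup>2 * e) * b = x * (y * (y * (f - e * b)))"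
    for x y f e b :: "'a::comm_ring_1"
    by (simp add: algebra_simps power2_eq_square)
  from this[of yy xx "in_x f" "in_y th" "in_y BB"]
  have "yy\<^sup>2 * (xx * in_x f) - xx * (yy\<^sup>2 * in_y th) * in_y BB =
    xx * (yy * (yy * (in_x f - in_y (th * BB))))"
    by (simp only: embed)
  ultimately have "kernel dvd xx * (yy * (yy * (in_x f - in_y (th * BB))))"
    by (simp only:)
  then have "kernel dvd in_x f - in_y (th * BB)"
    by (rule kernel_cancel_y[OF kernel_cancel_y[OF kernel_cancel_x]])
  then obtain d where d: "f = cst d" "th * BB = cst d"
    by (rule kernel_invariant)
  show ?thesis
  proof (rule that)
    show "(zeta - fps_X * VV - cst m * fps_X) * omega = cst d"
      using d(1) by (simp only: f_def)
    show "(xi - BB - cst m * fps_X) * BB = cst d * fps_X\<^sup>2"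
      unfolding th d(2)[symmetric] by (simp only: mult_ac)
  qed
qed

lemma eq0: "a = b \<Longrightarrow> a - b = (0 :: 'a::ring_1)"
  by simp

lemma two_cancel: "2 * a = 2 * b \<Longrightarrow> a = (b :: rat fps)"
  by simp

section \<open>Critical points determine the constants\<close>

subsection \<open>Evaluation at a small series\<close>

definition ev :: "'a::comm_ring_1 fps \<Rightarrow> 'a fps fps \<Rightarrow> 'a fps" where
  "ev a f = Abs_fps (\<lambda>n. (\<Sum>k\<le>n. f $ k * a ^ k) $ n)"

lemma ev_nth:
  assumes "a $ 0 = 0" "n \<le> N"
  shows "ev a f $ n = (\<Sum>k\<le>N. f $ k * a ^ k) $ n"
proof -
  have "(f $ k * a ^ k) $ n = 0" if "n < k" for k
    using that startsby_zero_power_prefix[OF assms(1), of k] by (simp add: fps_mult_nth)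
  then have "(\<Sum>k\<le>N. (f $ k * a ^ k) $ n) = (\<Sum>k\<le>n. (f $ k * a ^ k) $ n)"
    using assms(2) by (intro sum.mono_neutral_right) auto
  then show ?thesis by (simp add: ev_def fps_sum_nth)
qed

lemma ev_nth_0: "ev a f $ 0 = f $ 0 $ 0"
  by (simp add: ev_def)

context
  fixes a :: "'a::comm_ring_1 fps"
  assumes a0: "a $ 0 = 0"
begin

lemma ev_mult: "ev a (f * g) = ev a f * ev a g"
proof (rule fps_ext)
  fix n
  define p where "p = (\<lambda>i. f $ i * a ^ i)"
  define q where "q = (\<lambda>i. g $ i * a ^ i)"
  have small: "(p i * q j) $ n = 0" if "n < i + j" for i j
  proof -
    have "p i * q j = (f $ i * g $ j) * a ^ (i + j)"
      by (simp add: p_def q_def power_add)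
    then show ?thesis
      using that startsby_zero_power_prefix[OF a0, of "i + j"] by (simp add: fps_mult_nth)
  qed
  have "ev a (f * g) $ n = (\<Sum>k\<le>n. \<Sum>i\<le>k. p i * q (k - i)) $ n"
    by (simp add: ev_def fps_mult_nth[of f g] p_def q_def sum_distrib_left sum_distrib_right atLeast0AtMost mult_ac
        flip: power_add)
  also have "\<dots> = (\<Sum>(i, j)\<in>{(i, j). i + j \<le> n}. p i * q j) $ n"
    by (simp add: sum.triangle_reindex_eq)
  also have "\<dots> = (\<Sum>(i, j)\<in>{..n} \<times> {..n}. (p i * q j) $ n)"
    unfolding fps_sum_nth by (rule sum.mono_neutral_cong_left) (auto, meson not_le small)
  also have "\<dots> = ((\<Sum>i\<le>n. p i) * (\<Sum>j\<le>n. q j)) $ n"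
    by (simp add: sum_product fps_sum_nth sum.cartesian_product case_prod_unfold)
  also have "\<dots> = (ev a f * ev a g) $ n"
    unfolding fps_mult_nth by (rule sum.cong) (auto simp: ev_nth[OF a0, of _ n] p_def q_def)
  finally show "ev a (f * g) $ n = (ev a f * ev a g) $ n" .
qed

lemma ev_hom: "coeff_hom (ev a)"
proof
  show "ev a (f + g) = ev a f + ev a g" for f g
    by (simp add: fps_eq_iff ev_def ring_distribs sum.distrib)
  show "ev a 1 = 1"
    by (simp add: fps_eq_iff ev_def sum.delta' fps_sum_nth if_distrib if_distribR cong: if_cong)
qed (rule ev_mult)

lemma ev_const: "ev a (fps_const c) = c"
  by (simp add: fps_eq_iff ev_def fps_sum_nth if_distrib if_distribR cong: if_cong)

lemma ev_X: "ev a fps_X = a"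
proof (rule fps_ext)
  fix n
  show "ev a fps_X $ n = a $ n"
    by (cases n) (simp_all add: ev_def a0 fps_X_def fps_sum_nth if_distrib if_distribR cong: if_cong)
qed

lemma ev_of_const_coeffs: "ev a (map_fps fps_const f) = f oo a"
  by (simp add: fps_eq_iff ev_def fps_compose_nth fps_sum_nth atLeast0AtMost)

lemmas ev_homs = coeff_hom.homs[OF ev_hom] ev_const ev_X

end

lemma ev_cst: "ev a (cst c) = c" if "a $ 0 = 0"
  using ev_const[OF that] by (simp add: cst_def)

lemmas evs = ev_homs ev_cst

text \<open>The solution is the compositional inverse of \<open>x / P(x)\<close>, evaluated at \<open>t\<close>.\<close>

lemma exists_small_series:
  fixes P :: "'a::field fps"
  assumes "P $ 0 \<noteq> 0"
  obtains a where "a $ 0 = 0" "a \<noteq> 0" "a = fps_X * (P oo a)"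
proof -
  define G where "G = fps_X * inverse P"
  have G: "G $ 0 = 0" "G $ 1 \<noteq> 0"
    using assms by (simp_all add: G_def)
  define a where "a = fps_inv G"
  have a0: "a $ 0 = 0"
    by (simp add: a_def fps_inv_def)
  have "G oo a = fps_X"
    unfolding a_def by (rule fps_inv_right[OF G])
  then have *: "a * inverse (P oo a) = fps_X"
    using assms a0 by (simp add: G_def fps_compose_mult_distrib fps_inverse_compose)
  have "(P oo a) $ 0 \<noteq> 0"
    using assms a0 by simp
  then have i: "inverse (P oo a) * (P oo a) = 1"
    by (rule inverse_mult_eq_1)
  have "a = a * (inverse (P oo a) * (P oo a))"
    unfolding i by simp
  also have "\<dots> = fps_X * (P oo a)"
    by (simp only: mult.assoc[symmetric] *)
  finally have "a = fps_X * (P oo a)" .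
  moreover from * have "a \<noteq> 0"
    by auto
  ultimately show ?thesis using a0 by (intro that)
qed

lemma critical_x_exists:
  fixes sg :: "rat fps"
  assumes "sg * sg = 1" "sg $ 0 \<noteq> 0"
  obtains a where "a $ 0 = 0" "a \<noteq> 0" "fps_X * (1 + a)\<^sup>2 = sg * a"
proof (rule exists_small_series[of "sg * (1 + fps_X)\<^sup>2"])
  have "sg = 1 \<or> sg = -1"
    using assms(1) by (simp add: square_eq_1_iff)
  then have sg: "sg = fps_const (sg $ 0)"
    by (auto simp: fps_const_neg[symmetric] simp del: fps_const_neg)
  show "(sg * (1 + fps_X)\<^sup>2) $ 0 \<noteq> 0"
    using assms(2) by (simp add: fps_mult_nth_0 fps_power_zeroth)
  fix a :: "rat fps"
  assume a: "a $ 0 = 0" "a \<noteq> 0" "a = fps_X * ((sg * (1 + fps_X)\<^sup>2) oo a)"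
  have c: "sg oo a = sg"
    by (metis sg fps_const_compose)
  have "(sg * (1 + fps_X)\<^sup>2) oo a = sg * (1 + a)\<^sup>2"
    using a(1) c by (simp add: fps_compose_mult_distrib fps_compose_add_distrib fps_compose_power[symmetric])
  then have "sg * a = (sg * sg) * (fps_X * (1 + a)\<^sup>2)"
    using a(3) by (metis mult.assoc mult.left_commute)
  then have "fps_X * (1 + a)\<^sup>2 = sg * a"
    by (simp add: assms(1))
  then show thesis using that a by blast
qed

lemma critical_y_exists:
  obtains a :: "rat fps" where "a $ 0 = 0" "a \<noteq> 0" "2 * fps_X * (1 + a\<^sup>2) = a"
proof (rule exists_small_series[of "2 * (1 + fps_X\<^sup>2)"])
  fix a :: "rat fps"
  assume a: "a $ 0 = 0" "a \<noteq> 0" "a = fps_X * ((2 * (1 + fps_X\<^sup>2)) oo a)"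
  have "(2 * (1 + fps_X\<^sup>2)) oo a = 2 * (1 + a\<^sup>2)"
    using a(1) by (simp add: fps_compose_mult_distrib fps_compose_add_distrib fps_numeral_fps_const
        fps_compose_power[symmetric])
  then have "2 * fps_X * (1 + a\<^sup>2) = a"
    using a(3) by (simp add: mult_ac)
  then show thesis using that a by blast
qed (simp add: fps_mult_nth_0 fps_power_zeroth)

subsection \<open>Double roots\<close>

definition kap :: "rat fps" where "kap = 4 * fps_X\<^sup>2 + fps_const (1/4)"

lemma four_kap: "4 * kap = 16 * fps_X\<^sup>2 + 1"
  by (simp add: kap_def ring_distribs fps_numeral_fps_const)

lemma deriv_u1: "fps_deriv u1 = - u1\<^sup>2"
proof -
  have "u1 + (1 + fps_X) * fps_deriv u1 = 0"
    using arg_cong[OF u1, of fps_deriv] by (simp add: add.commute)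
  then have 1: "u1 * (u1 + (1 + fps_X) * fps_deriv u1) = 0"
    by (simp only: mult_zero_right)
  have "u1 * (u1 + (1 + fps_X) * fps_deriv u1) = u1\<^sup>2 + ((1 + fps_X) * u1) * fps_deriv u1"
    by (simp add: algebra_simps power2_eq_square)
  then show ?thesis
    unfolding u1 1 by (simp add: eq_neg_iff_add_eq_0 add.commute)
qed

lemma deriv_cst [simp]: "fps_deriv (cst c) = 0"
  by (simp add: cst_def)

lemma deriv_VV_0: "fps_deriv VV $ 0 $ 0 = 1"
proof -
  have "u1 $ 0 = 1"
    using arg_cong[OF u1, of "\<lambda>f. f $ 0"] by (simp add: fps_mult_nth_0)
  moreover have e: "VV = fps_X * u1 - vt * (vt * ((1 + fps_X) * anti_row)) + vt * (vt * cst gam)"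
    by (simp add: VV_def ax_def power2_eq_square mult.assoc)
  ultimately have "VV $ 1 $ 0 = 1"
    unfolding e by (simp add: cst_nth)
  then show ?thesis by simp
qed

text \<open>The points \<open>a\<close> with \<open>t (1 + a)\<^sup>2 = \<plusminus> a\<close> are the critical points of \<open>iota / x\<close>. There the derivative of the
  cubic equation with respect to \<open>x\<close> loses its explicit part, so the value of \<open>VV\<close> is a double root of a cubic
  polynomial. These points are also the zeros of the numerator of \<open>zeta\<close>.\<close>

lemma critical_x:
  fixes a :: "rat fps"
  assumes c: "omega * (iota + fps_X * (VV\<^sup>2 - cst ee * VV + cst hh)) = cst c"
    and sg: "sg * sg = 1" and a: "a $ 0 = 0" "a \<noteq> 0" "fps_X * (1 + a)\<^sup>2 = sg * a"
  defines "v \<equiv> ev a VV" and "k \<equiv> 2 * fps_X * sg"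
  shows "v ^ 3 - ee * v\<^sup>2 + (hh + k) * v = c" "3 * v\<^sup>2 - 2 * ee * v + hh + k = 0"
    "v $ 0 = 0" "ev a zeta = 0"
proof -
  note evs = evs[OF a(1)]
  define u where "u = ev a u1"
  have u: "(1 + a) * u = 1"
    using arg_cong[OF u1, of "ev a"] by (simp only: evs u_def)
  have au: "a * u\<^sup>2 = fps_X * sg"
  proof -
    have "a * u\<^sup>2 = sg * (sg * a) * u\<^sup>2"
      using sg by (simp add: mult.assoc[symmetric])
    also have "\<dots> = fps_X * sg * ((1 + a) * u)\<^sup>2"
      unfolding a(3)[symmetric] by (simp add: power_mult_distrib mult_ac)
    finally show ?thesis unfolding u by simp
  qed
  have X1: "fps_X * (1 + a) = sg * a * u"
  proof -
    have "fps_X * (1 + a) = fps_X * (1 + a) * ((1 + a) * u)"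
      unfolding u by simp
    also have "\<dots> = fps_X * (1 + a)\<^sup>2 * u"
      by (simp add: power2_eq_square mult_ac)
    finally show ?thesis unfolding a(3) .
  qed
  have iota: "ev a iota = k * a"
  proof -
    have "ev a iota = fps_X * (fps_X * (1 + a)\<^sup>2) + a * (a * u\<^sup>2)"
      by (simp add: iota_def evs u_def power2_eq_square mult_ac)
    then show ?thesis
      unfolding a(3) au k_def by (simp add: mult_ac)
  qed
  have iota': "ev a (fps_deriv iota) = k"
  proof -
    have "fps_deriv iota = 2 * vt\<^sup>2 * (1 + fps_X) + 2 * fps_X * u1\<^sup>2 - 2 * fps_X\<^sup>2 * u1 ^ 3"
      by (simp add: iota_def deriv_u1 fps_deriv_power power2_eq_square power3_eq_cube algebra_simps)
    then have "ev a (fps_deriv iota) = 2 * fps_X * (fps_X * (1 + a)) + 2 * (a * u\<^sup>2) - 2 * (a * u\<^sup>2) * a * u"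
      by (simp add: evs u_def power2_eq_square power3_eq_cube mult_ac)
    also have "\<dots> = k"
      unfolding X1 au k_def by (simp add: algebra_simps)
    finally show ?thesis .
  qed
  have E: "VV * (iota + fps_X * (VV\<^sup>2 - cst ee * VV + cst hh)) = cst c * fps_X"
  proof -
    have "VV * (iota + fps_X * (VV\<^sup>2 - cst ee * VV + cst hh)) =
        fps_X * (omega * (iota + fps_X * (VV\<^sup>2 - cst ee * VV + cst hh)))"
      by (simp only: VV_omega[symmetric] mult.assoc[symmetric])
    then show ?thesis
      unfolding c by (simp only: mult.commute)
  qed
  define w where "w = ev a (fps_deriv VV)"
  have "v * (k * a + a * (v\<^sup>2 - ee * v + hh)) = c * a"
    using arg_cong[OF E, of "ev a"] by (simp only: evs iota v_def)
  then have "a * (v * (k + (v\<^sup>2 - ee * v + hh))) = a * c"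
    by (simp add: algebra_simps)
  with a(2) have c': "v * (k + (v\<^sup>2 - ee * v + hh)) = c"
    by simp
  then show "v ^ 3 - ee * v\<^sup>2 + (hh + k) * v = c"
    by (simp add: algebra_simps power2_eq_square power3_eq_cube)
  have "fps_deriv VV * (iota + fps_X * (VV\<^sup>2 - cst ee * VV + cst hh)) +
      VV * (fps_deriv iota + (VV\<^sup>2 - cst ee * VV + cst hh) + fps_X * (2 * VV - cst ee) * fps_deriv VV) = cst c"
    using arg_cong[OF E, of fps_deriv] by (simp add: algebra_simps fps_deriv_power power2_eq_square)
  from arg_cong[OF this, of "ev a"]
  have "w * (k * a + a * (v\<^sup>2 - ee * v + hh)) + v * (k + (v\<^sup>2 - ee * v + hh) + a * (2 * v - ee) * w) = c"
    by (simp only: evs iota iota' v_def w_def)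
  then have "w * (a * (k + (v\<^sup>2 - ee * v + hh) + v * (2 * v - ee))) = c - v * (k + (v\<^sup>2 - ee * v + hh))"
    by (simp add: algebra_simps)
  then have "w * (a * (k + (v\<^sup>2 - ee * v + hh) + v * (2 * v - ee))) = 0"
    unfolding c' by simp
  moreover have "w \<noteq> 0"
    using deriv_VV_0 ev_nth_0[of a "fps_deriv VV"] by (auto simp: w_def)
  ultimately have "k + (v\<^sup>2 - ee * v + hh) + v * (2 * v - ee) = 0"
    using a(2) by simp
  then show "3 * v\<^sup>2 - 2 * ee * v + hh + k = 0"
    by (simp add: algebra_simps power2_eq_square)
  show "v $ 0 = 0"
    unfolding v_def ev_nth_0 by (simp add: VV_omega)
  show "ev a zeta = 0"
  proof -
    have "fps_X\<^sup>2 * (1 + a) ^ 3 = (fps_X * (1 + a)\<^sup>2) * (fps_X * (1 + a))"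
      by (simp add: power2_eq_square power3_eq_cube mult_ac)
    also have "\<dots> = (sg * sg) * (a\<^sup>2 * u)"
      unfolding a(3) X1 by (simp add: power2_eq_square mult_ac)
    finally have "fps_X\<^sup>2 * (1 + a) ^ 3 - a\<^sup>2 * u = 0"
      by (simp add: sg)
    then show ?thesis
      by (simp add: zeta_def evs u_def)
  qed
qed

text \<open>Likewise at the critical point of \<open>kappa / y\<^sup>2\<close>, with \<open>BB / y\<close> in place of \<open>VV\<close>.\<close>

lemma critical_y:
  fixes a :: "rat fps"
  assumes c: "(kappa + BB\<^sup>2 - cst ee * fps_X * BB + cst hh * fps_X\<^sup>2) * BB = cst c * fps_X ^ 3"
    and a: "a $ 0 = 0" "a \<noteq> 0" "2 * fps_X * (1 + a\<^sup>2) = a"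
  obtains v where "v ^ 3 - ee * v\<^sup>2 + (hh + kap) * v = c" "3 * v\<^sup>2 - 2 * ee * v + hh + kap = 0" "v $ 0 = 1/2"
proof -
  note evs = evs[OF a(1)]
  define f where "f = fps_const (1/2 :: rat)"
  have f: "2 * f = 1"
    by (simp add: f_def fps_numeral_fps_const)
  have X: "fps_X = a * (f - fps_X * a)"
  proof -
    have "2 * (a * (f - fps_X * a)) = a * (2 * f) - 2 * fps_X * a\<^sup>2"
      by (simp add: algebra_simps power2_eq_square)
    also have "\<dots> = 2 * fps_X * (1 + a\<^sup>2) - 2 * fps_X * a\<^sup>2"
      unfolding f a(3) by simp
    finally have "2 * (a * (f - fps_X * a)) = 2 * fps_X"
      by (simp add: algebra_simps)
    then show ?thesis by simp
  qed
  define v where "v = (f - fps_X * a) * ev a bx + fps_X\<^sup>2 * gam"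
  define b where "b = ev a (fps_deriv BB)"
  have B: "ev a BB = a * v"
  proof -
    have "ev a BB = fps_X * ev a bx + fps_X\<^sup>2 * gam * a"
      by (simp add: BB_def evs)
    also have "fps_X * ev a bx = a * (f - fps_X * a) * ev a bx"
      using X by simp
    finally show ?thesis by (simp add: v_def algebra_simps)
  qed
  have k: "ev a kappa = kap * a\<^sup>2"
  proof -
    have "4 * ev a kappa = 16 * fps_X\<^sup>2 * a\<^sup>2 + 2 * (2 * fps_X * (1 + a\<^sup>2)) * a - (2 * fps_X * (1 + a\<^sup>2))\<^sup>2"
      by (simp add: kappa_def evs algebra_simps power2_eq_square)
    also have "\<dots> = 4 * (kap * a\<^sup>2)"
      unfolding a(3) using four_kap by algebra
    finally show ?thesis by simp
  qed
  have k': "ev a (fps_deriv kappa) = 2 * kap * a"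
  proof -
    have "fps_deriv kappa = 8 * vt\<^sup>2 * fps_X + vt * (1 + 3 * fps_X\<^sup>2) - 4 * vt\<^sup>2 * (1 + fps_X\<^sup>2) * fps_X"
      by (simp add: kappa_def fps_deriv_power algebra_simps power2_eq_square)
    then have "2 * ev a (fps_deriv kappa) =
      2 * (8 * fps_X\<^sup>2 * a + fps_X * (1 + 3 * a\<^sup>2) - 4 * fps_X\<^sup>2 * (1 + a\<^sup>2) * a)"
      by (simp only: evs)
    also have "\<dots> = 16 * fps_X\<^sup>2 * a + 3 * (2 * fps_X * (1 + a\<^sup>2)) - 4 * fps_X - 4 * fps_X * (2 * fps_X * (1 + a\<^sup>2)) * a"
      by (simp add: algebra_simps power2_eq_square)
    also have "\<dots> = 16 * fps_X\<^sup>2 * a + 3 * a - 2 * (2 * fps_X * (1 + a\<^sup>2))"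
      unfolding a(3) using a(3)[THEN eq0] by algebra
    also have "\<dots> = 2 * (2 * kap * a)"
      unfolding a(3) using four_kap by algebra
    finally show ?thesis by (rule two_cancel)
  qed
  have "(kap * a\<^sup>2 + (a * v)\<^sup>2 - ee * a * (a * v) + hh * a\<^sup>2) * (a * v) = c * a ^ 3"
    using arg_cong[OF c, of "ev a"] by (simp only: evs B k)
  then have "a ^ 3 * ((kap + v\<^sup>2 - ee * v + hh) * v) = a ^ 3 * c"
    by (simp add: algebra_simps power2_eq_square power3_eq_cube)
  with a(2) have c': "(kap + v\<^sup>2 - ee * v + hh) * v = c"
    by simp
  have "(fps_deriv kappa + 2 * BB * fps_deriv BB - cst ee * BB - cst ee * fps_X * fps_deriv BB + 2 * cst hh * fps_X) * BB
     + (kappa + BB\<^sup>2 - cst ee * fps_X * BB + cst hh * fps_X\<^sup>2) * fps_deriv BB = 3 * cst c * fps_X\<^sup>2"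
    using arg_cong[OF c, of fps_deriv] by (simp add: fps_deriv_power algebra_simps power2_eq_square)
  from arg_cong[OF this, of "ev a"]
  have "(2 * kap * a + 2 * (a * v) * b - ee * (a * v) - ee * a * b + 2 * hh * a) * (a * v)
     + (kap * a\<^sup>2 + (a * v)\<^sup>2 - ee * a * (a * v) + hh * a\<^sup>2) * b = 3 * c * a\<^sup>2"
    by (simp only: evs B k k' b_def)
  then have "a\<^sup>2 * ((2 * kap + 2 * v * b - ee * v - ee * b + 2 * hh) * v
     + (kap + v\<^sup>2 - ee * v + hh) * b - 3 * ((kap + v\<^sup>2 - ee * v + hh) * v)) = 0"
    unfolding c'[symmetric] by (simp add: algebra_simps power2_eq_square)
  moreover have "(2 * kap + 2 * v * b - ee * v - ee * b + 2 * hh) * v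
     + (kap + v\<^sup>2 - ee * v + hh) * b - 3 * ((kap + v\<^sup>2 - ee * v + hh) * v)
     = (b - v) * (3 * v\<^sup>2 - 2 * ee * v + hh + kap)"
    by (simp add: algebra_simps power2_eq_square)
  ultimately have "a\<^sup>2 * ((b - v) * (3 * v\<^sup>2 - 2 * ee * v + hh + kap)) = 0"
    by (simp only:)
  with a(2) have "(b - v) * (3 * v\<^sup>2 - 2 * ee * v + hh + kap) = 0"
    by simp
  moreover have v0: "v $ 0 = 1/2"
    by (simp add: v_def f_def fps_mult_nth_0 ev_nth_0 bx_def mult.assoc power2_eq_square)
  moreover have "b $ 0 = 0"
  proof -
    have e: "BB = vt * bx + vt * (vt * (cst gam * fps_X))"
      by (simp add: BB_def power2_eq_square mult.assoc)
    have "BB $ 1 $ 0 = 0"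
      unfolding e by simp
    then show ?thesis
      unfolding b_def ev_nth_0 by simp
  qed
  ultimately have "3 * v\<^sup>2 - 2 * ee * v + hh + kap = 0"
    by auto
  moreover have "v ^ 3 - ee * v\<^sup>2 + (hh + kap) * v = c"
    using c' by (simp add: algebra_simps power2_eq_square power3_eq_cube)
  ultimately show ?thesis using v0 that by blast
qed

subsection \<open>The constants in terms of \<open>Z\<close>\<close>

lemma T_0: "T $ 0 = 1"
  using is_T_T by (simp add: is_T_def)

lemma T_eq: "(T - 1) * (T + 3) ^ 3 = 256 * fps_X\<^sup>2 * T ^ 3"
proof -
  have n: "((T + 3) ^ 3) $ 0 \<noteq> 0"
    by (simp add: fps_power_zeroth T_0)
  have "T = 1 + 256 * fps_X\<^sup>2 * (T ^ 3 / (T + 3) ^ 3)"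
    using is_T_T by (simp add: is_T_def)
  then have "T - 1 = 256 * fps_X\<^sup>2 * (T ^ 3 * inverse ((T + 3) ^ 3))"
    using n by (simp add: fps_divide_unit algebra_simps)
  then have "(T - 1) * (T + 3) ^ 3 = 256 * fps_X\<^sup>2 * T ^ 3 * (inverse ((T + 3) ^ 3) * (T + 3) ^ 3)"
    by (simp only: mult_ac)
  then show ?thesis
    unfolding inverse_mult_eq_1[OF n] by simp
qed

lemma Z_0: "Z $ 0 = 1" and Z_square: "Z\<^sup>2 = T"
  using theI'[OF Z_unique] unfolding Z_def[symmetric] by auto

lemma sv_unique:
  fixes s v s' v' q :: "rat fps"
  assumes A: "2 * v\<^sup>2 + 10 * s * v - s\<^sup>2 = 2 * v'\<^sup>2 + 10 * s' * v' - s'\<^sup>2"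
    and B: "s * (s + 4 * v) ^ 3 = s' * (s' + 4 * v') ^ 3"
    and s0: "s $ 0 = 0" "s' $ 0 = 0" and v0: "v $ 0 = 1/2" "v' $ 0 = 1/2"
  shows "s = s'" "v = v'"
proof -
  define p p' where "p = s + 4 * v" and "p' = s' + 4 * v'"
  define P2 R2 where "P2 = 10 * v - s - s'" and "R2 = 2 * (v + v') + 10 * s'"
  define P R where "P = p ^ 3 + s' * (p\<^sup>2 + p * p' + p'\<^sup>2)" and "R = 4 * s' * (p\<^sup>2 + p * p' + p'\<^sup>2)"
  have 1: "(s - s') * P2 + (v - v') * R2 = 0"
    using A[THEN eq0] unfolding P2_def R2_def by algebra
  have 2: "(s - s') * P + (v - v') * R = 0"
    using B[THEN eq0] unfolding P_def R_def p_def p'_def by algebra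
  have "p $ 0 = 2"
    using s0 v0 by (simp add: p_def)
  then have z: "R $ 0 = 0" "R2 $ 0 = 2" "P $ 0 = 8"
    using s0 v0 by (simp_all add: R_def R2_def P_def fps_mult_nth_0 fps_power_zeroth)
  have "(s - s') * (P * R2 - P2 * R) = 0"
    using 1 2 by algebra
  moreover have "(P * R2 - P2 * R) $ 0 \<noteq> 0"
    using z by (simp add: fps_mult_nth_0)
  ultimately show s: "s = s'" by auto
  have "R2 \<noteq> 0"
    using z by auto
  then show "v = v'"
    using 1 s by simp
qed

text \<open>Three critical points give three cubic polynomials with a double root, which differ only in the linear
  coefficient by known amounts; moreover, the two values at the critical points in \<open>x\<close> are the roots of the polynomial in the
  quadratic equation, because \<open>zeta\<close> vanishes there. Eliminating leaves algebraic equations over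
  \<open>\<rat>(t)\<close> with only one solution with the right constant coefficients, and it is rational in \<open>Z\<close>.\<close>

theorem boundary_equations:
  obtains s v c where
    "2 * Z ^ 3 * s = T - 1" "8 * Z ^ 3 * v = (T + 1)\<^sup>2" "ee = 2 * (s + v)"
    "c = ee * v\<^sup>2 - 2 * v ^ 3" "hh = 2 * ee * v - 3 * v\<^sup>2 - kap"
    "omega * (iota + fps_X * (VV\<^sup>2 - cst ee * VV + cst hh)) = cst c"
    "(kappa + BB\<^sup>2 - cst ee * fps_X * BB + cst hh * fps_X\<^sup>2) * BB = cst c * fps_X ^ 3"
    "(zeta - fps_X * VV + cst s * fps_X) * omega = cst (- s * v)"
    "(xi - BB + cst s * fps_X) * BB = cst (- s * v) * fps_X\<^sup>2"
proof -
  obtain c where c: "omega * (iota + fps_X * (VV\<^sup>2 - cst ee * VV + cst hh)) = cst c"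
    "(kappa + BB\<^sup>2 - cst ee * fps_X * BB + cst hh * fps_X\<^sup>2) * BB = cst c * fps_X ^ 3"
    by (rule cubic_equations)
  obtain m d where md: "(zeta - fps_X * VV - cst m * fps_X) * omega = cst d"
    "(xi - BB - cst m * fps_X) * BB = cst d * fps_X\<^sup>2"
    by (rule quadratic_equations)
  obtain a1 :: "rat fps" where a1: "a1 $ 0 = 0" "a1 \<noteq> 0" "fps_X * (1 + a1)\<^sup>2 = 1 * a1"
    by (rule critical_x_exists[of 1]) auto
  obtain a2 :: "rat fps" where a2: "a2 $ 0 = 0" "a2 \<noteq> 0" "fps_X * (1 + a2)\<^sup>2 = -1 * a2"
    by (rule critical_x_exists[of "-1"]) auto
  obtain a3 :: "rat fps" where a3: "a3 $ 0 = 0" "a3 \<noteq> 0" "2 * fps_X * (1 + a3\<^sup>2) = a3"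
    by (rule critical_y_exists)
  define v1 v2 where "v1 = ev a1 VV" and "v2 = ev a2 VV"
  have s1: "(1 :: rat fps) * 1 = 1" and s2: "(-1 :: rat fps) * -1 = 1"
    by simp_all
  note 1 = critical_x[OF c(1) s1 a1, folded v1_def]
  note 2 = critical_x[OF c(1) s2 a2, folded v2_def]
  obtain v where 3: "v ^ 3 - ee * v\<^sup>2 + (hh + kap) * v = c" "3 * v\<^sup>2 - 2 * ee * v + hh + kap = 0" "v $ 0 = 1/2"
    by (rule critical_y[OF c(2) a3])
  have r: "2 * w ^ 3 - ee * w\<^sup>2 + c = 0"
    if "w ^ 3 - ee * w\<^sup>2 + (hh + k) * w = c" "3 * w\<^sup>2 - 2 * ee * w + hh + k = 0" for w k
    using that[THEN eq0] by algebra
  note r1 = r[OF 1(1,2)] and r2 = r[OF 2(1,2)] and r3 = r[OF 3(1,2)]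
  have "v1 \<noteq> v2"
    using 1(2) 2(2) by auto
  have "v1 \<noteq> v" "v2 \<noteq> v"
    using 1(3) 2(3) 3(3) by auto
  have p: "2 * (x\<^sup>2 + x * y + y\<^sup>2) = ee * (x + y)"
    if "2 * x ^ 3 - ee * x\<^sup>2 + c = 0" "2 * y ^ 3 - ee * y\<^sup>2 + c = 0" "x \<noteq> y" for x y
  proof -
    have "(x - y) * (2 * (x\<^sup>2 + x * y + y\<^sup>2) - ee * (x + y)) = 0"
      using that(1,2) by algebra
    then show ?thesis using that(3) by simp
  qed
  define s where "s = v1 + v2"
  have "(v2 - v) * (ee - 2 * (s + v)) = 0"
    using p[OF r1 r2 \<open>v1 \<noteq> v2\<close>, THEN eq0] p[OF r1 r3 \<open>v1 \<noteq> v\<close>, THEN eq0] unfolding s_def by algebra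
  then have e: "ee = 2 * (s + v)"
    using \<open>v2 \<noteq> v\<close> by simp
  have "2 * (v1 * v2) = 2 * (- s * v)"
    using p[OF r1 r2 \<open>v1 \<noteq> v2\<close>, THEN eq0] unfolding e s_def by algebra
  then have pr: "v1 * v2 = - s * v"
    by (rule two_cancel)
  have A: "2 * (2 * v\<^sup>2 + 10 * s * v - s\<^sup>2) = 16 * fps_X\<^sup>2 + 1"
  proof -
    have "2 * (hh + kap) - (hh + 2 * fps_X * 1) - (hh + 2 * fps_X * -1) = 2 * v\<^sup>2 + 10 * s * v - s\<^sup>2"
      using 1(2) 2(2) 3(2) pr[THEN eq0] e[THEN eq0] unfolding s_def by algebra
    then show ?thesis using four_kap by algebra
  qed
  have B: "s * (s + 4 * v) ^ 3 = 16 * fps_X\<^sup>2"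
  proof -
    have "4 * fps_X = (v1 - v2) * (s + 4 * v)"
      using 1(2) 2(2) e[THEN eq0] unfolding s_def by algebra
    moreover have "(v1 - v2)\<^sup>2 = s * (s + 4 * v)"
      using pr[THEN eq0] unfolding s_def by algebra
    ultimately show ?thesis by algebra
  qed
  define z where "z = inverse (Z ^ 3)"
  have z: "z * Z ^ 3 = 1" "Z ^ 3 * z = 1"
    unfolding z_def by (simp_all add: inverse_mult_eq_1 inverse_mult_eq_1' fps_power_zeroth Z_0)
  have z0: "z $ 0 = 1"
    by (simp add: z_def fps_power_zeroth Z_0)
  define f g where "f = fps_const (1/2 :: rat)" and "g = fps_const (1/8 :: rat)"
  define s' v' where "s' = f * ((T - 1) * z)" and "v' = g * ((T + 1)\<^sup>2 * z)"
  have h: "2 * f = 1" "8 * g = 1"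
    by (simp_all add: f_def g_def fps_numeral_fps_const)
  have s': "2 * Z ^ 3 * s' = T - 1" and v': "8 * Z ^ 3 * v' = (T + 1)\<^sup>2"
    using z(1) h unfolding s'_def v'_def by algebra+
  have T3: "T ^ 3 = (Z ^ 3)\<^sup>2"
    by (simp add: Z_square[symmetric] flip: power_mult)
  have "T \<noteq> 0"
    using T_0 by auto
  then have nz: "16 * T ^ 3 * T ^ 3 \<noteq> 0" "16 * T ^ 3 \<noteq> 0"
    by simp_all
  have 4: "2 * Z ^ 3 * (s' + 4 * v') = T * (T + 3)"
    using s' v' by algebra
  have "16 * T ^ 3 * T ^ 3 * (s' * (s' + 4 * v') ^ 3) = (2 * Z ^ 3 * s') * (2 * Z ^ 3 * (s' + 4 * v')) ^ 3"
    unfolding T3 by algebra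
  also have "\<dots> = T ^ 3 * ((T - 1) * (T + 3) ^ 3)"
    unfolding 4 s' by algebra
  also have "\<dots> = 16 * T ^ 3 * T ^ 3 * (16 * fps_X\<^sup>2)"
    unfolding T_eq by algebra
  finally have B': "s' * (s' + 4 * v') ^ 3 = 16 * fps_X\<^sup>2"
    using mult_left_cancel[OF nz(1)] by blast
  have "32 * T ^ 3 * (2 * v'\<^sup>2 + 10 * s' * v' - s'\<^sup>2) =
      (8 * Z ^ 3 * v')\<^sup>2 + 20 * (2 * Z ^ 3 * s') * (8 * Z ^ 3 * v') - 8 * (2 * Z ^ 3 * s')\<^sup>2"
    unfolding T3 by algebra
  also have "\<dots> = (T - 1) * (T + 3) ^ 3 + 16 * T ^ 3"
    unfolding s' v' by algebra
  also have "\<dots> = 16 * T ^ 3 * (16 * fps_X\<^sup>2 + 1)"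
    unfolding T_eq by algebra
  finally have "16 * T ^ 3 * (2 * (2 * v'\<^sup>2 + 10 * s' * v' - s'\<^sup>2)) = 16 * T ^ 3 * (16 * fps_X\<^sup>2 + 1)"
    by algebra
  then have A': "2 * (2 * v'\<^sup>2 + 10 * s' * v' - s'\<^sup>2) = 16 * fps_X\<^sup>2 + 1"
    using mult_left_cancel[OF nz(2)] by blast
  have "s $ 0 = 0" "s' $ 0 = 0" "v' $ 0 = 1/2"
    using 1(3) 2(3) by (simp_all add: s_def s'_def v'_def f_def g_def T_0 fps_mult_nth_0 z0 fps_power_zeroth)
  moreover have "2 * v\<^sup>2 + 10 * s * v - s\<^sup>2 = 2 * v'\<^sup>2 + 10 * s' * v' - s'\<^sup>2"
    by (rule two_cancel) (simp only: A A')
  ultimately have "s = s'" "v = v'"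
    using sv_unique[of v s v' s'] B B' 3(3) by simp_all
  have *: "m = - s" "d = - s * v"
  proof -
    have 5: "w\<^sup>2 + m * w + d = 0"
      if a: "a $ 0 = 0" "a \<noteq> 0" and z: "ev a zeta = 0" and w: "w = ev a VV" for a w
    proof -
      have "(zeta - fps_X * VV - cst m * fps_X) * VV = cst d * fps_X"
        using arg_cong[OF md(1), of "\<lambda>f. f * fps_X"]
        by (simp only: mult.assoc mult.commute[of omega] VV_omega[symmetric])
      from arg_cong[OF this, of "ev a"] have "(- (a * w) - m * a) * w = d * a"
        by (simp add: evs[OF a(1)] z w)
      then have "- (a * (w\<^sup>2 + m * w + d)) = 0"
        using eq0 by (simp add: algebra_simps power2_eq_square)
      then show ?thesis using a(2) by simp
    qed
    note 6 = 5[OF a1(1,2) 1(4) v1_def] and 7 = 5[OF a2(1,2) 2(4) v2_def]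
    have "(v1 - v2) * (s + m) = 0"
      using 6 7 unfolding s_def by algebra
    then show m: "m = - s"
      using \<open>v1 \<noteq> v2\<close> by (simp add: eq_neg_iff_add_eq_0 add.commute)
    show "d = - s * v"
      using 6 pr[THEN eq0] unfolding m s_def by algebra
  qed
  show ?thesis
  proof (rule that)
    show "2 * Z ^ 3 * s = T - 1" "8 * Z ^ 3 * v = (T + 1)\<^sup>2"
      using s' v' \<open>s = s'\<close> \<open>v = v'\<close> by simp_all
    show "ee = 2 * (s + v)" by (rule e)
    show "c = ee * v\<^sup>2 - 2 * v ^ 3" using r3 by algebra
    show "hh = 2 * ee * v - 3 * v\<^sup>2 - kap" using 3(2) by algebra
    show "omega * (iota + fps_X * (VV\<^sup>2 - cst ee * VV + cst hh)) = cst c" by (rule c(1))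
    show "(kappa + BB\<^sup>2 - cst ee * fps_X * BB + cst hh * fps_X\<^sup>2) * BB = cst c * fps_X ^ 3" by (rule c(2))
    show "(zeta - fps_X * VV + cst s * fps_X) * omega = cst (- s * v)"
      using md(1) unfolding * by (simp add: cst.homs)
    show "(xi - BB + cst s * fps_X) * BB = cst (- s * v) * fps_X\<^sup>2"
      using md(2) unfolding * by (simp add: cst.homs)
  qed
qed

section \<open>Coefficients in a subfield\<close>

locale subfield_set =
  fixes K :: "'a::field set"
  assumes one_in: "1 \<in> K"
    and diff_in: "a \<in> K \<Longrightarrow> b \<in> K \<Longrightarrow> a - b \<in> K"
    and mult_in: "a \<in> K \<Longrightarrow> b \<in> K \<Longrightarrow> a * b \<in> K"
    and inverse_in: "a \<in> K \<Longrightarrow> inverse a \<in> K"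
begin

lemma zero_in: "0 \<in> K"
  using diff_in[OF one_in one_in] by simp

lemma uminus_in: "a \<in> K \<Longrightarrow> - a \<in> K"
  using diff_in[OF zero_in, of a] by simp

lemma add_in: "a \<in> K \<Longrightarrow> b \<in> K \<Longrightarrow> a + b \<in> K"
  using diff_in[of a "- b"] uminus_in by simp

lemma divide_in: "a \<in> K \<Longrightarrow> b \<in> K \<Longrightarrow> a / b \<in> K"
  by (simp add: divide_inverse mult_in inverse_in)

lemma power_in: "a \<in> K \<Longrightarrow> a ^ n \<in> K"
  by (induction n) (auto intro: one_in mult_in)

lemma numeral_in: "numeral k \<in> K"
  by (induction k) (simp_all only: numeral.simps one_in add_in)

lemma sum_in: "(\<And>x. x \<in> A \<Longrightarrow> f x \<in> K) \<Longrightarrow> sum f A \<in> K"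
  by (induction A rule: infinite_finite_induct) (auto intro: zero_in add_in)

lemmas closed = zero_in one_in add_in diff_in uminus_in mult_in inverse_in divide_in power_in numeral_in

lemma cancel_in: "a * b \<in> K \<Longrightarrow> a \<in> K \<Longrightarrow> a \<noteq> 0 \<Longrightarrow> b \<in> K"
  using divide_in[of "a * b" a] by simp

text \<open>Coefficients are shown to lie in the field one after the other; this is the corresponding induction hypothesis.\<close>

definition upto :: "nat \<Rightarrow> 'a fps \<Rightarrow> bool" where
  "upto n F \<longleftrightarrow> (\<forall>i<n. F $ i \<in> K)"

definition over :: "'a fps \<Rightarrow> bool" where
  "over F \<longleftrightarrow> (\<forall>i. F $ i \<in> K)"

lemma overD: "over F \<Longrightarrow> F $ i \<in> K"
  by (simp add: over_def)

lemma over_upto: "over F \<Longrightarrow> upto n F"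
  by (simp add: over_def upto_def)

lemma overI:
  assumes "\<And>n. upto n F \<Longrightarrow> F $ n \<in> K"
  shows "over F"
proof -
  have "F $ n \<in> K" for n
    by (induction n rule: less_induct) (rule assms, simp add: upto_def)
  then show ?thesis by (simp add: over_def)
qed

lemma upto_mult: "upto n F \<Longrightarrow> upto n G \<Longrightarrow> upto n (F * G)"
  unfolding upto_def fps_mult_nth by (auto intro!: sum_in mult_in)

lemma upto_add: "upto n F \<Longrightarrow> upto n G \<Longrightarrow> upto n (F + G)"
  and upto_diff: "upto n F \<Longrightarrow> upto n G \<Longrightarrow> upto n (F - G)"
  by (auto simp: upto_def intro: add_in diff_in)

lemma upto_const: "c \<in> K \<Longrightarrow> upto n (fps_const c)"
  by (auto simp: upto_def intro: zero_in)

lemma upto_X: "upto n fps_X"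
  by (auto simp: upto_def fps_X_def intro: closed)

lemma upto_numeral: "upto n (numeral k)"
  by (simp add: fps_numeral_fps_const upto_const numeral_in)

lemma upto_1: "upto n 1"
  by (auto simp: upto_def intro: closed)

lemma upto_power: "upto n F \<Longrightarrow> upto n (F ^ m)"
  by (induction m) (auto intro: upto_1 upto_mult)

lemma upto_X_mult: "upto n F \<Longrightarrow> upto (Suc n) (fps_X * F)"
  by (auto simp: upto_def intro: zero_in)

lemma upto_uminus: "upto n F \<Longrightarrow> upto n (- F)"
  by (auto simp: upto_def intro: uminus_in)

lemmas upto = upto_mult upto_add upto_diff upto_const upto_X upto_numeral upto_1 upto_power upto_uminus

lemma over_iff_upto: "over F \<longleftrightarrow> (\<forall>n. upto n F)"
  by (auto simp: over_def upto_def)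

lemma over_mult: "over F \<Longrightarrow> over G \<Longrightarrow> over (F * G)"
  and over_add: "over F \<Longrightarrow> over G \<Longrightarrow> over (F + G)"
  and over_diff: "over F \<Longrightarrow> over G \<Longrightarrow> over (F - G)"
  and over_uminus: "over F \<Longrightarrow> over (- F)"
  and over_const: "c \<in> K \<Longrightarrow> over (fps_const c)"
  and over_X: "over fps_X"
  and over_numeral: "over (numeral k)"
  and over_1: "over 1"
  and over_power: "over F \<Longrightarrow> over (F ^ m)"
  by (simp_all add: over_iff_upto upto)

lemmas over = over_mult over_add over_diff over_uminus over_const over_X over_numeral over_1 over_power

lemma upto_quotient:
  assumes "F * G = H" "upto (Suc n) H" "upto (Suc n) G" "upto n F" "G $ 0 \<noteq> 0"
  shows "F $ n \<in> K"
proof -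
  have "H $ n = (\<Sum>i<n. F $ i * G $ (n - i)) + F $ n * G $ 0"
    unfolding assms(1)[symmetric] by (simp add: fps_mult_nth atLeast0AtMost lessThan_Suc_atMost[symmetric])
  moreover have "(\<Sum>i<n. F $ i * G $ (n - i)) \<in> K"
    using assms(3,4) by (auto simp: upto_def intro!: sum_in mult_in)
  moreover have "H $ n \<in> K" "G $ 0 \<in> K"
    using assms(2,3) by (auto simp: upto_def)
  moreover from calculation(1) have "G $ 0 * F $ n = H $ n - (\<Sum>i<n. F $ i * G $ (n - i))"
    by simp
  ultimately have "G $ 0 * F $ n \<in> K"
    by (simp only: diff_in)
  then show ?thesis
    using cancel_in assms(5) \<open>G $ 0 \<in> K\<close> by blast
qed

lemma over_quotient:
  assumes "F * G = H" "over H" "over G" "G $ 0 \<noteq> 0"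
  shows "over F"
  by (rule overI, rule upto_quotient[OF assms(1)]) (use assms in \<open>auto intro: over_upto\<close>)

lemma over_const_mult: "over (fps_const c * F) \<Longrightarrow> c \<in> K \<Longrightarrow> c \<noteq> 0 \<Longrightarrow> over F"
  unfolding over_def by (auto intro: cancel_in)

lemma over_X_mult: "over (fps_X * F) \<Longrightarrow> over F"
  unfolding over_def by (auto dest: spec[of _ "Suc _"])

text \<open>A solution of the step recurrence of the half-plane is determined by its first row and
  its first column, using only divisions by \<open>t\<close>.\<close>

lemma half_plane_in:
  assumes rec: "\<And>k j. P (Suc k) j = S k j + t * (P (Suc k) (Suc j) +
      P (Suc (Suc k)) (Suc j) + (if j = 0 then 0 else P (Suc k) (j-1) + P k (j-1)))"
    and t: "t \<in> K" "t \<noteq> 0" and S: "\<And>k j. S k j \<in> K"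
    and 0: "\<And>j. P 0 j \<in> K" and 1: "\<And>j. P 1 j \<in> K" and row: "\<And>k. P k 0 \<in> K"
  shows "P k j \<in> K"
proof (induction j arbitrary: k rule: less_induct)
  case (less j)
  show ?case
  proof (cases j)
    case 0
    then show ?thesis using row by simp
  next
    case (Suc m)
    have "P (Suc k) j \<in> K" for k
    proof (induction k)
      case 0
      then show ?case using 1 by simp
    next
      case (Suc k)
      have "P (Suc k) m \<in> K" "(if m = 0 then 0 else P (Suc k) (m-1) + P k (m-1)) \<in> K"
        using less[of m] less[of "m - 1"] \<open>j = Suc m\<close> by (auto intro: add_in zero_in)
      moreover have "t * P (Suc (Suc k)) j = P (Suc k) m - S k m - t * P (Suc k) j
          - t * (if m = 0 then 0 else P (Suc k) (m-1) + P k (m-1))"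
        using rec[of k m] \<open>j = Suc m\<close> by (simp add: ring_distribs)
      ultimately have "t * P (Suc (Suc k)) j \<in> K"
        using Suc S t by (auto intro!: diff_in mult_in)
      then show ?case using t cancel_in by blast
    qed
    then show ?thesis using assms(5) by (cases k) auto
  qed
qed

end

subsection \<open>Rational functions of one series, and adjoining \<open>t\<close>\<close>

lemma map_poly_fls_const_pCons:
  "poly (map_poly fls_const (pCons a p)) f = fls_const a + f * poly (map_poly fls_const p) f"
  by (simp add: map_poly_pCons)

abbreviation evalp :: "rat poly \<Rightarrow> rat fls \<Rightarrow> rat fls" where
  "evalp p f \<equiv> poly (map_poly fls_const p) f"

lemma evalp_add: "evalp (p + q) f = evalp p f + evalp q f"
proof (induction p q rule: poly_induct2)
  case (pCons a p b q)
  have "fls_const (a + b) = fls_const a + fls_const b"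
    by (simp add: fls_eq_iff)
  then show ?case
    by (simp only: add_pCons map_poly_fls_const_pCons pCons.IH distrib_left add_ac)
qed simp

lemma evalp_smult: "evalp (smult c p) f = fls_const c * evalp p f"
proof (induction p)
  case (pCons a p)
  have "fls_const (c * a) = fls_const c * fls_const a"
    by simp
  then show ?case
    by (simp only: smult_pCons map_poly_fls_const_pCons pCons.IH distrib_left mult_ac)
qed simp

lemma evalp_mult: "evalp (p * q) f = evalp p f * evalp q f"
  by (induction p) (simp_all add: map_poly_fls_const_pCons evalp_add evalp_smult algebra_simps)

lemma evalp_minus: "evalp (- p) f = - evalp p f"
  using evalp_add[of p "- p" f] by (simp add: eq_neg_iff_add_eq_0 add.commute)

lemma evalp_diff: "evalp (p - q) f = evalp p f - evalp q f"
  using evalp_add[of p "- q" f] by (simp add: evalp_minus)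

lemma rational_inI: "evalp q f \<noteq> 0 \<Longrightarrow> evalp p f / evalp q f \<in> rational_in f"
  unfolding rational_in_def by blast

lemma rational_inE:
  assumes "r \<in> rational_in f"
  obtains p q where "r = evalp p f / evalp q f" "evalp q f \<noteq> 0"
  using assms unfolding rational_in_def by blast

interpretation rational_in: subfield_set "rational_in f" for f
proof
  show "1 \<in> rational_in f"
    using rational_inI[of 1 f 1] by simp
next
  fix a b assume "a \<in> rational_in f" "b \<in> rational_in f"
  then obtain p q p' q' where ab: "a = evalp p f / evalp q f" "evalp q f \<noteq> 0" "b = evalp p' f / evalp q' f" "evalp q' f \<noteq> 0"
    by (elim rational_inE) blast
  have "a - b = evalp (p * q' - p' * q) f / evalp (q * q') f"
    unfolding ab(1,3) evalp_diff evalp_mult using ab(2,4) by (simp add: field_simps)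
  then show "a - b \<in> rational_in f"
    using ab rational_inI[of "q * q'" f] by (simp add: evalp_mult)
  have "a * b = evalp (p * p') f / evalp (q * q') f"
    using ab by (simp add: evalp_mult)
  then show "a * b \<in> rational_in f"
    using ab rational_inI[of "q * q'" f "p * p'"] by (simp add: evalp_mult)
next
  fix a assume "a \<in> rational_in f"
  then obtain p q where a: "a = evalp p f / evalp q f" "evalp q f \<noteq> 0"
    by (elim rational_inE)
  show "inverse a \<in> rational_in f"
  proof (cases "evalp p f = 0")
    case True
    then show ?thesis using rational_inI[of 1 f 0] a by simp
  next
    case False
    then show ?thesis using rational_inI[of p f q] a by simp
  qed
qed

lemma const_rational_in: "fls_const c \<in> rational_in f"
  using rational_inI[of 1 f "[:c:]"] by (simp add: map_poly_pCons)

lemma self_rational_in: "f \<in> rational_in f"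
  using rational_inI[of 1 f "[:0, 1:]"] by (simp add: map_poly_pCons)

definition adjoin :: "rat fls set \<Rightarrow> rat fls \<Rightarrow> rat fls set" where
  "adjoin K t = {a + t * b | a b. a \<in> K \<and> b \<in> K}"

lemma adjoinI: "a \<in> K \<Longrightarrow> b \<in> K \<Longrightarrow> a + t * b \<in> adjoin K t"
  unfolding adjoin_def by blast

lemma subfield_adjoin:
  assumes "subfield_set K" "t * t \<in> K"
  shows "subfield_set (adjoin K t)"
proof -
  interpret subfield_set K by fact
  show ?thesis
  proof
    show "1 \<in> adjoin K t"
      using adjoinI[OF one_in zero_in] by simp
  next
    fix x y assume "x \<in> adjoin K t" "y \<in> adjoin K t"
    then obtain a b c d where xy: "x = a + t * b" "y = c + t * d" and K: "a \<in> K" "b \<in> K" "c \<in> K" "d \<in> K"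
      unfolding adjoin_def by blast
    have "x - y = (a - c) + t * (b - d)" "x * y = (a * c + t * t * (b * d)) + t * (a * d + b * c)"
      by (simp_all add: xy algebra_simps)
    moreover have "a - c \<in> K" "b - d \<in> K" "a * d + b * c \<in> K"
      using K by (simp_all only: closed)
    moreover have "a * c + t * t * (b * d) \<in> K"
      by (rule add_in[OF mult_in[OF K(1,3)] mult_in[OF assms(2) mult_in[OF K(2,4)]]])
    ultimately show "x - y \<in> adjoin K t" "x * y \<in> adjoin K t"
      by (simp_all only: adjoinI)
  next
    fix x assume "x \<in> adjoin K t"
    then obtain a b where x: "x = a + t * b" and K: "a \<in> K" "b \<in> K"
      unfolding adjoin_def by blast
    show "inverse x \<in> adjoin K t"
    proof (cases "a - t * b = 0")
      case True
      then have "inverse x = inverse (2 * a) + t * 0"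
        by (simp add: x)
      then show ?thesis using K adjoinI closed by metis
    next
      case False
      define n where "n = a * a - (t * t) * (b * b)"
      have n: "n = x * (a - t * b)"
        by (simp add: n_def x algebra_simps)
      have "n \<in> K"
        unfolding n_def by (rule diff_in[OF mult_in[OF K(1,1)] mult_in[OF assms(2) mult_in[OF K(2,2)]]])
      have "inverse x = (a - t * b) / n"
        using False by (cases "x = 0") (simp_all add: n field_simps)
      also have "\<dots> = a / n + t * (- b / n)"
        by (simp add: diff_divide_distrib)
      finally have "inverse x = a / n + t * (- b / n)" .
      moreover have "a / n \<in> K" "- b / n \<in> K"
        using K \<open>n \<in> K\<close> by (simp_all only: closed)
      ultimately show ?thesis
        by (simp only: adjoinI)
    qed
  qed
qed

abbreviation QT :: "rat fls set" where "QT \<equiv> rational_in (fps_to_fls T)"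
abbreviation QZ :: "rat fls set" where "QZ \<equiv> rational_in (fps_to_fls Z)"

lemma T_in_QZ: "fps_to_fls T \<in> QZ"
  using rational_in.power_in[OF self_rational_in, of "fps_to_fls Z" 2] Z_square
  by (simp flip: fps_to_fls_power)

lemma T_nz: "T \<noteq> 0"
  using T_0 by auto

lemma X_square_in:
  assumes "subfield_set K" "fps_to_fls T \<in> K"
  shows "fls_X * fls_X \<in> K"
proof -
  interpret subfield_set K by fact
  let ?T = "fps_to_fls T"
  have "?T \<noteq> 0"
    using T_nz by simp
  have "(?T - 1) * (?T + 3) ^ 3 = 256 * (fls_X * fls_X) * ?T ^ 3"
    using arg_cong[OF T_eq, of fps_to_fls]
    by (simp add: fls_times_fps_to_fls fps_to_fls_power power2_eq_square)
  then have "(256 * ?T ^ 3) * (fls_X * fls_X) = (?T - 1) * (?T + 3) ^ 3"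
    by (simp only: mult_ac)
  then have "(256 * ?T ^ 3) * (fls_X * fls_X) \<in> K"
    using assms(2) by (simp only: closed)
  then show ?thesis
    by (rule cancel_in) (use assms(2) \<open>?T \<noteq> 0\<close> in \<open>auto intro!: closed\<close>)
qed

definition FZ :: "rat fls set" where "FZ = adjoin QZ fls_X"
definition FT :: "rat fls set" where "FT = adjoin QT fls_X"

interpretation FZ: subfield_set FZ
  unfolding FZ_def by (rule subfield_adjoin) (auto intro: rational_in.subfield_set_axioms X_square_in T_in_QZ)

interpretation FT: subfield_set FT
  unfolding FT_def by (rule subfield_adjoin) (auto intro: rational_in.subfield_set_axioms X_square_in self_rational_in)

lemma sub_adjoin: "subfield_set K \<Longrightarrow> K \<subseteq> adjoin K t"
  using adjoinI[of _ K 0 t] subfield_set.zero_in[of K] by fastforce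

lemma X_adjoin: "subfield_set K \<Longrightarrow> t \<in> adjoin K t"
  using adjoinI[of 0 K 1 t] subfield_set.zero_in[of K] subfield_set.one_in[of K] by simp

section \<open>Coefficients in \<open>\<rat>(t, Z)\<close>\<close>

context subfield_set
begin

lemma over_cubic_x:
  assumes "W * (I + fps_X * (fps_const q * (fps_X * W)\<^sup>2 - fps_const (q * e) * (fps_X * W) + fps_const h)) = fps_const c"
    and "over I" "I $ 0 \<noteq> 0" "q \<in> K" "e \<in> K" "h \<in> K" "c \<in> K"
  shows "over W"
proof (rule overI)
  fix n assume n: "upto n W"
  have X: "upto (Suc n) (fps_X * W)"
    using n by (rule upto_X_mult)
  show "W $ n \<in> K"
  proof (rule upto_quotient[OF assms(1) _ _ n])
    show "upto (Suc n) (fps_const c)"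
      using assms by (intro upto)
    show "upto (Suc n) (I + fps_X * (fps_const q * (fps_X * W)\<^sup>2 - fps_const (q * e) * (fps_X * W) + fps_const h))"
      by (intro upto_add[OF over_upto[OF assms(2)]] upto_mult[OF upto_X] upto_add upto_diff
          upto_mult[OF upto_const upto_power[OF X]] upto_mult[OF upto_const X] upto_const mult_in assms)
  qed (use assms in simp)
qed

lemma over_cubic_y:
  fixes B :: "'a fps"
  assumes eq: "(- (fps_const t ^ 2) + fps_X * k + B\<^sup>2 - fps_const e * fps_X * B + fps_const h * fps_X\<^sup>2) * B =
      fps_const c * fps_X ^ 3"
    and B0: "B $ 0 = t" and k: "over k" and K: "t \<in> K" "e \<in> K" "h \<in> K" "c \<in> K"
    and t: "2 * t \<noteq> 0"
  shows "over B"
proof -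
  define D where "D = fps_shift 1 B"
  have B: "B = fps_const t + fps_X * D"
    by (simp add: D_def fps_eq_iff B0)
  define R where "R = k - fps_const e * fps_const t + fps_X * (D\<^sup>2 - fps_const e * D + fps_const h)"
  define W where "W = 2 * fps_const t * D + R"
  have "- (fps_const t ^ 2) + fps_X * k + B\<^sup>2 - fps_const e * fps_X * B + fps_const h * fps_X\<^sup>2 = fps_X * W"
    unfolding W_def R_def B by (simp add: algebra_simps power2_eq_square del: fps_const_mult)
  with eq have "fps_X * (W * B) = fps_X * (fps_const c * fps_X\<^sup>2)"
    by (simp add: power2_eq_square power3_eq_cube mult_ac)
  then have WB: "W * B = fps_const c * fps_X\<^sup>2"
    by simp
  have "over D"
  proof (rule overI)
    fix n assume n: "upto n D"
    have upB: "upto (Suc n) B"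
      unfolding B by (intro upto_add upto_const upto_X_mult n K)
    have "upto (Suc n) (fps_X * (D\<^sup>2 - fps_const e * D + fps_const h))"
      by (intro upto_X_mult upto n K)
    then have upR: "upto (Suc n) R"
      unfolding R_def by (intro upto_add upto_diff upto_mult[OF upto_const upto_const] over_upto[OF k] K)
    then have "upto n R"
      by (simp add: upto_def)
    then have "upto n W"
      unfolding W_def by (intro upto n K)
    moreover have "upto (Suc n) (fps_const c * fps_X\<^sup>2)"
      by (intro upto K)
    moreover have "B $ 0 \<noteq> 0"
      using B0 t by auto
    ultimately have "W $ n \<in> K"
      using upto_quotient[OF WB _ upB] by blast
    moreover have "R $ n \<in> K"
      using upR by (simp add: upto_def)
    moreover have "W $ n = (2 * t) * D $ n + R $ n"
      by (simp add: W_def mult.assoc)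
    ultimately have "(2 * t) * D $ n \<in> K"
      by (metis add_diff_cancel_right' diff_in)
    then show "D $ n \<in> K"
      by (rule cancel_in) (use t K in \<open>auto intro: mult_in numeral_in\<close>)
  qed
  then show ?thesis
    unfolding B by (intro over K)
qed

end

interpretation fls_hom: coeff_hom "fps_to_fls :: rat fps \<Rightarrow> rat fls"
  by standard (simp_all add: fls_times_fps_to_fls)

definition lift_coeffs :: "series1 \<Rightarrow> rat fls fps" where
  "lift_coeffs = map_fps fps_to_fls"

interpretation lift: coeff_hom lift_coeffs
  unfolding lift_coeffs_def by (rule fls_hom.map_hom)

lemma lift_nth [simp]: "lift_coeffs f $ n = fps_to_fls (f $ n)"
  by (simp add: lift_coeffs_def)

lemma lift_cst: "lift_coeffs (cst c) = fps_const (fps_to_fls c)"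
  unfolding lift_coeffs_def cst_def by (rule fls_hom.map_const)

lemma lift_X: "lift_coeffs fps_X = fps_X"
  unfolding lift_coeffs_def by (rule fls_hom.map_X)

lemmas lifts = lift.homs lift_cst lift_X fps_X_to_fls

abbreviation ft :: "rat fls fps" where "ft \<equiv> fps_const fls_X"

lemma lift_kappa: "lift_coeffs kappa = - (fps_const fls_X ^ 2) +
    fps_X * (4 * ft\<^sup>2 * fps_X + ft * (1 + fps_X\<^sup>2) - ft\<^sup>2 * (2 * fps_X + fps_X ^ 3))"
proof -
  have "4 * t\<^sup>2 * x\<^sup>2 + t * x * (1 + x\<^sup>2) - t\<^sup>2 * (1 + x\<^sup>2)\<^sup>2 =
    - (t ^ 2) + x * (4 * t\<^sup>2 * x + t * (1 + x\<^sup>2) - t\<^sup>2 * (2 * x + x ^ 3))" for t x :: "'b::comm_ring_1"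
    by (simp add: algebra_simps power2_eq_square power3_eq_cube)
  from this[of ft fps_X] show ?thesis
    by (simp only: kappa_def lifts)
qed

lemma lift_u1: "lift_coeffs u1 * (1 + fps_X) = 1"
  using arg_cong[OF u1, of lift_coeffs] by (simp only: lifts mult.commute)

locale subfield_with_t = subfield_set K for K :: "rat fls set" +
  assumes t_in: "fls_X \<in> K"
    and T_in: "fps_to_fls T \<in> K"
begin

lemma over_u1: "over (lift_coeffs u1)"
  by (rule over_quotient[OF lift_u1]) (auto intro!: over)

lemma over_iota: "over (lift_coeffs iota)"
  unfolding iota_def lifts by (intro over over_u1 t_in)

end

lemma iota_0: "iota $ 0 = fps_X\<^sup>2"
proof -
  have e: "iota = cst (fps_X\<^sup>2) * ((1 + fps_X) * (1 + fps_X)) + fps_X * (fps_X * u1\<^sup>2)"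
    by (simp add: iota_def cst.homs power2_eq_square mult.assoc)
  show ?thesis
    unfolding e by (simp add: fps_mult_nth_0)
qed

lemma s_v_nonzero:
  assumes "2 * Z ^ 3 * s = T - 1" "8 * Z ^ 3 * v = (T + 1)\<^sup>2"
  shows "s \<noteq> 0" "v \<noteq> 0"
proof -
  have "T - 1 \<noteq> 0"
    using T_eq T_nz by auto
  then show "s \<noteq> 0" using assms(1) by auto
  have "(T + 1) $ 0 \<noteq> 0"
    by (simp add: T_0)
  then have "T + 1 \<noteq> 0" by force
  then show "v \<noteq> 0" using assms(2) by auto
qed

subsection \<open>All series of the problem\<close>

definition fl :: "rat fps \<Rightarrow> rat fls" where "fl = fps_to_fls"

lemma fl_homs: "fl 0 = 0" "fl 1 = 1" "fl (f + g) = fl f + fl g" "fl (f - g) = fl f - fl g"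
  "fl (- f) = - fl f" "fl (f * g) = fl f * fl g" "fl (f ^ n) = fl f ^ n" "fl (numeral k) = numeral k"
  "fl fps_X = fls_X" "fl f = fl g \<longleftrightarrow> f = g"
  by (simp_all add: fl_def fls_times_fps_to_fls fps_to_fls_power)

lemma fl_parts_rec:
  "fl (anti_part (Suc k) j) = (if k = 0 \<and> j = 0 then 1 else 0) + fls_X * (fl (anti_part (Suc k) (Suc j)) +
     fl (anti_part (Suc (Suc k)) (Suc j)) + (if j = 0 then 0 else fl (anti_part (Suc k) (j-1)) + fl (anti_part k (j-1))))"
  "fl (sym_part (Suc k) j) = (if k = 0 \<and> j = 0 then 1 else 0) + fls_X * (fl (sym_part (Suc k) (Suc j)) +
     fl (sym_part (Suc (Suc k)) (Suc j)) + (if j = 0 then 0 else fl (sym_part (Suc k) (j-1)) + fl (sym_part k (j-1))))"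
  "fl (sym_part 0 j) = (if j = 0 then 2 else 0) +
     fls_X * (fl (sym_part 0 (Suc j)) + (if j = 0 then 0 else fl (sym_part 0 (j-1))) + 2 * fl (sym_part 1 (Suc j)))"
  by (subst anti_part_rec sym_part_rec sym_part_diagonal_rec, simp only: fl_homs if_distrib[of fl] split: if_split; simp add: fl_homs)+

lemma fl_kap: "4 * fl kap = 16 * fls_X\<^sup>2 + 1"
  using arg_cong[OF four_kap, of fl] by (simp only: fl_homs)

text \<open>With the constants in the field, the cubic equations determine the coefficients of \<open>omega\<close> and of \<open>BB\<close>,
  the quadratic equations those of \<open>zeta\<close> and \<open>xi\<close>, and thereby the first row, the first column and the diagonal. The step
  recurrence does the rest.\<close>

theorem (in subfield_with_t) parts_in:
  assumes ZK: "fl Z \<in> K"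
  shows "fl (anti_part k j) \<in> K" "fl (sym_part k j) \<in> K"
proof -
  note tK = t_in and TK = T_in[folded fl_def]
  obtain s v c where *:
    "2 * Z ^ 3 * s = T - 1" "8 * Z ^ 3 * v = (T + 1)\<^sup>2" "ee = 2 * (s + v)"
    "c = ee * v\<^sup>2 - 2 * v ^ 3" "hh = 2 * ee * v - 3 * v\<^sup>2 - kap"
    "omega * (iota + fps_X * (VV\<^sup>2 - cst ee * VV + cst hh)) = cst c"
    "(kappa + BB\<^sup>2 - cst ee * fps_X * BB + cst hh * fps_X\<^sup>2) * BB = cst c * fps_X ^ 3"
    "(zeta - fps_X * VV + cst s * fps_X) * omega = cst (- s * v)"
    "(xi - BB + cst s * fps_X) * BB = cst (- s * v) * fps_X\<^sup>2"
    by (rule boundary_equations)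
  have Z_nz: "fl Z \<noteq> 0"
    using Z_0 by (auto simp: fl_def)
  have sK: "fl s \<in> K"
  proof (rule cancel_in)
    show "(2 * fl Z ^ 3) * fl s \<in> K"
      using arg_cong[OF *(1), of fl] TK by (simp only: fl_homs closed)
  qed (use ZK Z_nz in \<open>auto intro!: closed\<close>)
  have vK: "fl v \<in> K"
  proof (rule cancel_in)
    show "(8 * fl Z ^ 3) * fl v \<in> K"
      using arg_cong[OF *(2), of fl] TK by (simp only: fl_homs closed)
  qed (use ZK Z_nz in \<open>auto intro!: closed\<close>)
  have eK: "fl ee \<in> K"
    unfolding *(3) fl_homs using sK vK by (simp only: closed)
  have cK: "fl c \<in> K"
    unfolding *(4) fl_homs using eK vK by (simp only: closed)
  have kK: "fl kap \<in> K"
  proof (rule cancel_in)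
    show "4 * fl kap \<in> K"
      unfolding fl_kap using tK by (simp only: closed)
  qed (auto intro!: closed)
  have hK: "fl hh \<in> K"
    unfolding *(5) fl_homs using eK vK kK by (simp only: closed)
  have dK: "fl (- s * v) \<in> K"
    unfolding fl_homs using sK vK by (simp only: closed)

  \<comment> \<open>the series in \<open>x\<close>\<close>
  have om_eq: "lift_coeffs omega * (lift_coeffs iota + fps_X * (fps_const 1 * (fps_X * lift_coeffs omega)\<^sup>2 -
      fps_const (1 * fl ee) * (fps_X * lift_coeffs omega) + fps_const (fl hh))) = fps_const (fl c)"
    using arg_cong[OF *(6)[unfolded VV_omega], of lift_coeffs] by (simp add: lifts fl_def)
  have om: "over (lift_coeffs omega)"
    by (rule over_cubic_x[OF om_eq over_iota]) (simp_all add: iota_0 one_in eK hK cK)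
  have V: "over (lift_coeffs VV)"
    unfolding VV_omega lifts by (intro over om)
  have om0: "lift_coeffs omega $ 0 \<noteq> 0"
  proof -
    have "c = 2 * s * v\<^sup>2"
      unfolding *(4) *(3) by (simp add: algebra_simps power2_eq_square power3_eq_cube)
    then have "fl c \<noteq> 0"
      using s_v_nonzero[OF *(1,2)] by (simp add: fl_def)
    then show ?thesis
      using arg_cong[OF om_eq, of "\<lambda>f. f $ 0"] by (auto simp: fps_mult_nth_0)
  qed
  have "over (lift_coeffs (zeta - fps_X * VV + cst s * fps_X))"
    using arg_cong[OF *(8), of lift_coeffs] unfolding lift.hom_mult lift_cst
    by (rule over_quotient) (use dK om om0 in \<open>auto simp: fl_def intro: over\<close>)
  then have "over (lift_coeffs (zeta - fps_X * VV + cst s * fps_X) + fps_X * lift_coeffs VV - fps_const (fl s) * fps_X)"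
    by (intro over V sK)
  then have ze: "over (lift_coeffs zeta)"
    by (simp add: lifts fl_def)
  have zn: "nn * zeta = - 2 * (vt\<^sup>2 * (1 + fps_X) ^ 3 - fps_X\<^sup>2 * u1)"
    unfolding zeta_def by (simp only: mult.left_commute[of nn] inv_nn mult_1_right)
  have n: "over (lift_coeffs nn)"
  proof (rule over_quotient)
    show "lift_coeffs nn * lift_coeffs zeta = lift_coeffs (- 2 * (vt\<^sup>2 * (1 + fps_X) ^ 3 - fps_X\<^sup>2 * u1))"
      using arg_cong[OF zn, of lift_coeffs] by (simp only: lift.hom_mult)
    show "over (lift_coeffs (- 2 * (vt\<^sup>2 * (1 + fps_X) ^ 3 - fps_X\<^sup>2 * u1)))"
      unfolding lifts by (intro over over_u1 tK)
    have "- 2 * (vt\<^sup>2 * (1 + fps_X) ^ 3 - fps_X\<^sup>2 * u1) = cst (- 2 * fps_X\<^sup>2) * (1 + fps_X) ^ 3 + fps_X * (2 * (fps_X * u1))"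
      by (simp add: cst.homs power2_eq_square algebra_simps)
    then have "(nn * zeta) $ 0 = - 2 * fps_X\<^sup>2"
      unfolding zn by (simp add: fps_power_zeroth)
    then have "zeta $ 0 \<noteq> 0"
      by (auto simp: fps_mult_nth_0)
    then show "lift_coeffs zeta $ 0 \<noteq> 0"
      by simp
  qed (rule ze)
  have N: "over (lift_coeffs NN)"
  proof -
    have e: "vt\<^sup>2 * NN = (2 - nn) * u1"
    proof -
      have "(2 - nn) * u1 = vt\<^sup>2 * NN * ((1 + fps_X) * u1)"
        by (simp add: nn_def)
      then show ?thesis unfolding u1 by simp
    qed
    have "fps_const (fls_X\<^sup>2) * lift_coeffs NN = (2 - lift_coeffs nn) * lift_coeffs u1"
      using arg_cong[OF e, of lift_coeffs] by (simp only: lifts fps_const_power)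
    moreover have "over ((2 - lift_coeffs nn) * lift_coeffs u1)"
      by (intro over n over_u1)
    ultimately show ?thesis
      using over_const_mult[of "fls_X\<^sup>2" "lift_coeffs NN"] tK by (simp add: closed)
  qed

  \<comment> \<open>the series in \<open>y\<close>\<close>
  have B: "over (lift_coeffs BB)"
  proof (rule over_cubic_y)
    show "(- (fps_const fls_X ^ 2) + fps_X * (4 * ft\<^sup>2 * fps_X + ft * (1 + fps_X\<^sup>2) - ft\<^sup>2 * (2 * fps_X + fps_X ^ 3))
       + (lift_coeffs BB)\<^sup>2 - fps_const (fl ee) * fps_X * lift_coeffs BB + fps_const (fl hh) * fps_X\<^sup>2) * lift_coeffs BB =
       fps_const (fl c) * fps_X ^ 3"
      using arg_cong[OF *(7), of lift_coeffs] unfolding fl_def by (simp only: lifts lift_kappa)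
    show "over (4 * ft\<^sup>2 * fps_X + ft * (1 + fps_X\<^sup>2) - ft\<^sup>2 * (2 * fps_X + fps_X ^ 3))"
      by (intro over tK)
  qed (use tK eK hK cK in \<open>simp_all add: BB_0\<close>)
  have B0: "lift_coeffs BB $ 0 \<noteq> 0"
    by (simp add: BB_0)
  have "over (lift_coeffs (xi - BB + cst s * fps_X))"
    using arg_cong[OF *(9), of lift_coeffs] unfolding lift.hom_mult[of _ BB]
    by (rule over_quotient) (use dK B B0 in \<open>auto simp: fl_def lifts simp del: fps_const_mult fps_const_neg intro!: over\<close>)
  then have "over (lift_coeffs (xi - BB + cst s * fps_X) + lift_coeffs BB - fps_const (fl s) * fps_X)"
    by (intro over B sK)
  then have xi: "over (lift_coeffs xi)"
    by (simp add: lifts fl_def)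
  have xp: "pp * xi = 2 * vt * (1 - fps_X\<^sup>2)"
    unfolding xi_def by (simp only: mult.left_commute[of pp] inv_pp mult_1_right)
  have p: "over (lift_coeffs pp)"
  proof (rule over_quotient)
    show "lift_coeffs pp * lift_coeffs xi = lift_coeffs (2 * vt * (1 - fps_X\<^sup>2))"
      using arg_cong[OF xp, of lift_coeffs] by (simp only: lift.hom_mult)
    show "over (lift_coeffs (2 * vt * (1 - fps_X\<^sup>2)))"
      unfolding lifts by (intro over tK)
  qed (simp_all add: xi xi_0)
  have H: "over (lift_coeffs sym_diagonal)"
  proof -
    have "over (fps_const fls_X * (fps_X * lift_coeffs sym_diagonal))"
    proof -
      have "fps_const fls_X * (fps_X * lift_coeffs sym_diagonal) = lift_coeffs pp - 2"
        by (simp add: pp_def lifts mult.assoc)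
      moreover have "over (lift_coeffs pp - 2)"
        by (intro over p)
      ultimately show ?thesis by (simp only:)
    qed
    then have "over (fps_X * lift_coeffs sym_diagonal)"
      by (rule over_const_mult) (simp_all add: tK)
    then show ?thesis
      by (rule over_X_mult)
  qed

  \<comment> \<open>the first row and the first two columns\<close>
  have diag: "fl (sym_part 0 j) \<in> K" for j
    using overD[OF H, of j] by (simp add: sym_diagonal_def fl_def)
  have row: "fl (sym_part (Suc k) 0) \<in> K" for k
  proof -
    have two: "fps_const 2 = (2 :: rat fls fps)"
      by (simp add: numeral_fps_const)
    have "fps_const 2 * lift_coeffs sym_row * (1 + fps_X) = lift_coeffs NN - fps_const (fl (sym_part 0 0))"
      unfolding two by (simp add: NN_def lifts fl_def mult_ac)
    then have "over (fps_const 2 * lift_coeffs sym_row)"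
      by (rule over_quotient) (use N diag in \<open>auto intro!: over\<close>)
    then have "over (lift_coeffs sym_row)"
      by (rule over_const_mult) (simp_all add: closed)
    from overD[OF this, of k] show ?thesis
      by (simp add: sym_row_def fl_def)
  qed
  have col: "fl (sym_part 1 j) \<in> K" for j
  proof (cases j)
    case 0
    then show ?thesis using row[of 0] by simp
  next
    case (Suc m)
    have "(2 * fls_X) * fl (sym_part 1 (Suc m)) = fl (sym_part 0 m) - (if m = 0 then 2 else 0)
      - fls_X * (fl (sym_part 0 (Suc m)) + (if m = 0 then 0 else fl (sym_part 0 (m-1))))"
      by (subst fl_parts_rec(3)[of m]) (simp add: algebra_simps)
    moreover have "fl (sym_part 0 m) - (if m = 0 then 2 else 0)
      - fls_X * (fl (sym_part 0 (Suc m)) + (if m = 0 then 0 else fl (sym_part 0 (m-1)))) \<in> K"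
      using diag tK by (simp add: closed)
    ultimately have "(2 * fls_X) * fl (sym_part 1 (Suc m)) \<in> K"
      by (simp only:)
    then have "fl (sym_part 1 (Suc m)) \<in> K"
      by (rule cancel_in) (use tK in \<open>auto intro!: closed\<close>)
    then show ?thesis by (simp add: Suc)
  qed
  show "fl (sym_part k j) \<in> K"
  proof (rule half_plane_in[of "\<lambda>k j. fl (sym_part k j)", OF fl_parts_rec(2)])
    show "fl (sym_part k 0) \<in> K" for k
      using diag row by (cases k) auto
  qed (use tK diag col in \<open>auto intro: closed\<close>)

  have gK: "fls_X\<^sup>2 * fl gam \<in> K"
  proof (rule cancel_in)
    have "2 * (fls_X\<^sup>2 * fl gam) = fl ee - 1"
      by (simp add: ee_def fl_homs)
    then show "2 * (fls_X\<^sup>2 * fl gam) \<in> K"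
      using eK by (simp only: closed)
  qed (auto intro!: closed)
  have row': "fl (anti_part (Suc k) 0) \<in> K" for k
  proof -
    have "fps_const (fls_X\<^sup>2) * lift_coeffs anti_row * (1 + fps_X) =
        fps_X * lift_coeffs u1 - lift_coeffs VV + fps_const (fls_X\<^sup>2 * fl gam)"
      by (simp add: VV_def ax_def lifts fl_def mult_ac flip: fps_const_mult fps_const_power)
    then have "over (fps_const (fls_X\<^sup>2) * lift_coeffs anti_row)"
      by (rule over_quotient) (use over_u1 V gK in \<open>auto intro!: over simp del: fps_const_mult\<close>)
    then have "over (lift_coeffs anti_row)"
      by (rule over_const_mult) (use tK in \<open>simp_all add: closed\<close>)
    from overD[OF this, of k] show ?thesis
      by (simp add: anti_row_def fl_def)
  qed
  have col': "fl (anti_part 1 j) \<in> K" for j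
  proof (cases j)
    case 0
    then show ?thesis using row'[of 0] by simp
  next
    case (Suc m)
    have "fps_const (fls_X\<^sup>2) * (fps_X * lift_coeffs anti_col) =
        lift_coeffs BB - fps_const fls_X - fps_const (fls_X\<^sup>2 * fl gam) * fps_X"
      by (simp add: BB_def bx_def lifts fl_def algebra_simps power2_eq_square flip: fps_const_mult fps_const_power)
    moreover have "over (lift_coeffs BB - fps_const fls_X - fps_const (fls_X\<^sup>2 * fl gam) * fps_X)"
      by (intro over B tK gK)
    ultimately have "over (fps_const (fls_X\<^sup>2) * (fps_X * lift_coeffs anti_col))"
      by (simp only:)
    then have "over (fps_X * lift_coeffs anti_col)"
      by (rule over_const_mult) (use tK in \<open>simp_all add: closed\<close>)
    then have "over (lift_coeffs anti_col)"
      by (rule over_X_mult)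
    from overD[OF this, of j] show ?thesis
      by (simp add: anti_col_def fl_def Suc)
  qed
  show "fl (anti_part k j) \<in> K"
  proof (rule half_plane_in[of "\<lambda>k j. fl (anti_part k j)", OF fl_parts_rec(1)])
    show "fl (anti_part k 0) \<in> K" for k
      using row' by (cases k) (auto simp: anti_part_0 fl_homs zero_in)
  qed (use tK col' in \<open>auto simp: anti_part_0 fl_homs intro: closed\<close>)
qed

theorem parts_in_FZ: "fl (anti_part k j) \<in> FZ" "fl (sym_part k j) \<in> FZ"
proof -
  have sub: "subfield_set QZ" ..
  interpret Z: subfield_with_t FZ
  proof unfold_locales
    show "fls_X \<in> FZ"
      unfolding FZ_def by (rule X_adjoin[OF sub])
    show "fps_to_fls T \<in> FZ"
      unfolding FZ_def using sub_adjoin[OF sub] T_in_QZ by blast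
  qed
  have "fl Z \<in> FZ"
    unfolding FZ_def fl_def using sub_adjoin[OF sub] self_rational_in by blast
  then show "fl (anti_part k j) \<in> FZ" "fl (sym_part k j) \<in> FZ"
    by (rule Z.parts_in)+
qed

section \<open>Harmonic functions vanishing on the line \<open>i = -1\<close>\<close>

definition tinv :: "rat fls" where "tinv = inverse fls_X"

lemma tinv: "fls_X * tinv = 1" "fls_X * (tinv * a) = a"
  by (simp_all add: tinv_def flip: mult.assoc)

text \<open>The step recurrence of the quadrant, solved for the value at the upper right: every function on the two
  half-axes has exactly one extension which is harmonic for the steps, with eigenvalue \<open>1 / t\<close>.\<close>

function quad :: "(nat \<Rightarrow> rat fls) \<Rightarrow> (nat \<Rightarrow> rat fls) \<Rightarrow> nat \<Rightarrow> nat \<Rightarrow> rat fls" where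
  "quad r c i 0 = r i"
| "quad r c 0 (Suc j) = c (Suc j)"
| "quad r c (Suc i) (Suc j) = tinv * quad r c i j - (if j = 0 then 0 else quad r c (Suc i) (j - 1))
     - (if i = 0 then 0 else quad r c (i - 1) (Suc j)) - (if i = 0 \<or> j = 0 then 0 else quad r c (i - 1) (j - 1))"
  by pat_completeness auto
termination by (relation "measure (\<lambda>(r, c, i, j). i + j)") auto

lemma quad_harmonic:
  "quad r c i j = fls_X * (quad r c (Suc i) (Suc j) + (if j = 0 then 0 else quad r c (Suc i) (j - 1))
     + (if i = 0 then 0 else quad r c (i - 1) (Suc j)) + (if i = 0 \<or> j = 0 then 0 else quad r c (i - 1) (j - 1)))"
  by (simp add: algebra_simps tinv)

lemma quad_column: "r 0 = c 0 \<Longrightarrow> quad r c 0 j = c j"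
  by (cases j) auto

lemma quad_swap:
  assumes "r 0 = e * r 0" "e * e = 1"
  shows "quad r (\<lambda>i. e * r i) i j = e * quad r (\<lambda>i. e * r i) j i"
proof (induction "i + j" arbitrary: i j rule: less_induct)
  case less
  show ?case
  proof (cases "i = 0 \<or> j = 0")
    case True
    then show ?thesis
      using assms by (cases i; cases j) (auto simp: mult.assoc[symmetric])
  next
    case False
    then obtain a b where ab: "i = Suc a" "j = Suc b"
      by (metis not0_implies_Suc)
    have "quad r (\<lambda>i. e * r i) a b = e * quad r (\<lambda>i. e * r i) b a"
      "b \<noteq> 0 \<Longrightarrow> quad r (\<lambda>i. e * r i) (Suc a) (b - 1) = e * quad r (\<lambda>i. e * r i) (b - 1) (Suc a)"
      "a \<noteq> 0 \<Longrightarrow> quad r (\<lambda>i. e * r i) (a - 1) (Suc b) = e * quad r (\<lambda>i. e * r i) (Suc b) (a - 1)"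
      "a \<noteq> 0 \<Longrightarrow> b \<noteq> 0 \<Longrightarrow> quad r (\<lambda>i. e * r i) (a - 1) (b - 1) = e * quad r (\<lambda>i. e * r i) (b - 1) (a - 1)"
      using ab by (auto intro!: less)
    then show ?thesis
      by (auto simp: ab algebra_simps)
  qed
qed

text \<open>
  A half-plane function with prescribed first row \<open>l\<close>, vanishing on \<open>i = -1\<close>: in the quadrant
  it is the harmonic extension with first row \<open>p\<close>, symmetric (\<open>e = 1\<close>) or antisymmetric
  (\<open>e = -1\<close>); on the other side of the line \<open>i = -1\<close> the column \<open>i = -2\<close> is chosen such that
  its sum with the column \<open>i = 0\<close> alternates.
\<close>

definition spread :: "(nat \<Rightarrow> rat fls) \<Rightarrow> nat \<Rightarrow> rat fls" where
  "spread p i = (if even i then p (i div 2) else 0)"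

definition quad_part :: "rat fls \<Rightarrow> (nat \<Rightarrow> rat fls) \<Rightarrow> nat \<Rightarrow> nat \<Rightarrow> rat fls" where
  "quad_part e p = quad (spread p) (\<lambda>i. e * spread p i)"

definition left_part :: "rat fls \<Rightarrow> (nat \<Rightarrow> rat fls) \<Rightarrow> (nat \<Rightarrow> rat fls) \<Rightarrow> nat \<Rightarrow> nat \<Rightarrow> rat fls" where
  "left_part e p l = quad (spread l) (\<lambda>j. - e * spread p j + spread (\<lambda>m. (l 0 + p 0) * (-1) ^ m) j)"

definition vanishing :: "rat fls \<Rightarrow> (nat \<Rightarrow> rat fls) \<Rightarrow> (nat \<Rightarrow> rat fls) \<Rightarrow> int \<Rightarrow> nat \<Rightarrow> rat fls" where
  "vanishing e p l i j = (if i \<ge> 0 then quad_part e p (nat i) j else if i = -1 then 0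
     else left_part e p l (nat (- i - 2)) j)"

context
  fixes e :: "rat fls" and p l :: "nat \<Rightarrow> rat fls"
  assumes e: "e * e = 1" and p0: "e * p 0 = p 0"
begin

abbreviation "UU \<equiv> vanishing e p l"

lemma quad_part_swap: "quad_part e p i j = e * quad_part e p j i"
  unfolding quad_part_def by (rule quad_swap) (simp_all add: spread_def e p0)

lemma quad_part_column: "quad_part e p 0 j = e * spread p j"
  unfolding quad_part_def by (rule quad_column) (simp add: spread_def p0)

lemma left_part_column: "left_part e p l 0 j = - e * spread p j + spread (\<lambda>m. (l 0 + p 0) * (-1) ^ m) j"
  unfolding left_part_def by (rule quad_column) (simp add: spread_def p0)

lemmas quad_part_harmonic = quad_harmonic[of "spread p" "\<lambda>i. e * spread p i", folded quad_part_def]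

lemmas left_part_harmonic =
  quad_harmonic[of "spread l" "\<lambda>j. - e * spread p j + spread (\<lambda>m. (l 0 + p 0) * (-1) ^ m) j", folded left_part_def]

lemma vanishing_line: "UU (-1) j = 0"
  by (simp add: vanishing_def)

lemma vanishing_harmonic:
  "UU i j = fls_X * (UU (i+1) (Suc j) + UU (i-1) (Suc j) + (if j = 0 then 0 else UU (i+1) (j-1) + UU (i-1) (j-1)))"
proof -
  consider "i \<ge> 1" | "i = 0" | "i = -1" | "i = -2" | "i \<le> -3" by linarith
  then show ?thesis
  proof cases
    case 1
    then have n: "nat (1 + i) = Suc (nat i)" "nat (i - 1) = nat i - 1" "nat i \<noteq> 0"
      by auto
    from 1 show ?thesis
      using quad_part_harmonic[of "nat i" j]
      by (simp add: vanishing_def n add_ac del: nat_0_iff)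
  next
    case 2
    then show ?thesis
      using quad_part_harmonic[of 0 j]
      by (simp add: vanishing_def add_ac)
  next
    case 3
    define A where "A = spread (\<lambda>m. (l 0 + p 0) * (-1) ^ m)"
    have L: "left_part e p l 0 n = - e * spread p n + A n" for n
      by (simp only: left_part_column A_def)
    have "A (Suc j) + (if j = 0 then 0 else A (j - 1)) = 0"
    proof (cases "odd j")
      case True
      then obtain m where "j = 2 * m + 1" by (rule oddE)
      then show ?thesis by (simp add: spread_def A_def)
    qed (simp add: spread_def A_def)
    then have "fls_X * (A (Suc j) + (if j = 0 then 0 else A (j - 1))) = 0"
      by simp
    moreover have "j = 0 \<Longrightarrow> spread p (Suc j) = 0"
      by (simp add: spread_def)
    ultimately show ?thesis
      using 3 by (auto simp: vanishing_def quad_part_column L algebra_simps)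
  next
    case 4
    then show ?thesis
      using left_part_harmonic[of 0 j]
      by (simp add: vanishing_def add_ac)
  next
    case 5
    define a where "a = nat (- i - 2)"
    have n: "nat (- 1 - i) = Suc a" "nat (- i - 1) = Suc a" "nat (- i - 3) = a - 1" "a \<noteq> 0"
      using 5 by (auto simp: a_def)
    from 5 show ?thesis
      using left_part_harmonic[of a j]
      by (simp add: vanishing_def n a_def[symmetric] add_ac)
  qed
qed

abbreviation "U \<equiv> (\<lambda>k j. UU (int j - 2 * int k) j)"

lemma U_rec: "U (Suc k) j = fls_X * (U (Suc k) (Suc j) + U (Suc (Suc k)) (Suc j) +
    (if j = 0 then 0 else U (Suc k) (j-1) + U k (j-1)))"
  using vanishing_harmonic[of "int j - 2 * int (Suc k)" j] by (cases j) (simp_all add: algebra_simps)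

lemma U_row: "U (Suc k) 0 = l k"
proof -
  have "nat (2 * int k) = 2 * k" by simp
  then show ?thesis
    by (simp add: vanishing_def left_part_def spread_def)
qed

lemma U_line: "U (Suc k) (2 * k + 1) = 0"
  using vanishing_line by simp

lemma U_diagonal: "U 0 j = quad_part e p j j"
  by (simp add: vanishing_def)

definition wedge :: "nat \<Rightarrow> nat \<Rightarrow> rat fls" where "wedge k j = quad_part e p (j + 2 * k) j"

lemma wedge_0: "wedge 0 j = U 0 j"
  by (simp add: wedge_def vanishing_def)

lemma wedge_row: "wedge k 0 = p k"
  by (simp add: wedge_def quad_part_def spread_def)

lemma wedge_rec: "wedge (Suc k) j = fls_X * (wedge (Suc k) (Suc j) + wedge k (Suc j) +
   (if j = 0 then 0 else wedge (Suc k) (j-1) + wedge (Suc (Suc k)) (j-1)))"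
  using quad_part_harmonic[of "j + 2 * Suc k" j]
  by (cases j) (simp_all add: wedge_def add_ac)

lemma wedge_rec_0: "wedge 0 j = fls_X * (wedge 0 (Suc j) +
   (if j = 0 then 0 else wedge 0 (j-1) + (1 + e) * wedge 1 (j-1)))"
proof (cases j)
  case 0
  then show ?thesis
    using quad_part_harmonic[of 0 0]
    by (simp add: wedge_def)
next
  case (Suc m)
  have "quad_part e p m (Suc (Suc m)) = e * wedge 1 m"
    using quad_part_swap[of m "Suc (Suc m)"] by (simp add: wedge_def)
  then show ?thesis
    using quad_part_harmonic[of j j] Suc
    by (simp add: wedge_def ring_distribs)
qed

lemma U_col: "U 1 (Suc (Suc j)) = e * wedge 1 j" "U 1 1 = 0"
proof -
  show "U 1 (Suc (Suc j)) = e * wedge 1 j"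
    using quad_part_swap[of j "Suc (Suc j)"] by (simp add: vanishing_def wedge_def)
qed (simp add: vanishing_def)

text \<open>The kernel of the wedge between the positive half-axis and the diagonal vanishes at
  \<open>x = a(y)\<close>, a series without constant term; this relates the diagonal to the first row.\<close>

lemma wedge_kernel:
  assumes a: "a $ 0 = 0" "fps_X * a = ft * (a * fps_X\<^sup>2 + a + a\<^sup>2 + fps_X\<^sup>2)"
  defines "H \<equiv> Abs_fps (U 0)" and "W1 \<equiv> Abs_fps (wedge 1)"
  shows "a * (1 + a) * (Abs_fps p oo a) + fps_X\<^sup>2 * H = fps_const e * (a * fps_X\<^sup>2 * W1)"
proof -
  define F where "F = Abs_fps (\<lambda>k. Abs_fps (\<lambda>j. wedge k j))"
  define y where "y = fps_const (fps_X :: rat fls fps)"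
  define t where "t = fps_const (fps_const fls_X :: rat fls fps)"
  have yn: "(y * f) $ n = fps_X * f $ n" "(t * f) $ n = ft * f $ n" "y $ 0 = fps_X" "y $ Suc m = 0" for f n m
    by (simp_all add: y_def t_def)
  have p0': "UU 0 0 = p 0"
    using wedge_0[of 0] wedge_row[of 0] by simp
  have "(fps_X * (y * F) - t * (fps_X * (y * (y * F)) + fps_X * F + fps_X * (fps_X * F) + y * (y * F))) =
    fps_const (fps_const e) * (t * (fps_X * (y * (y * fps_const W1)))) - t * (fps_X * map_fps fps_const (Abs_fps p) + fps_X * (fps_X * map_fps fps_const (Abs_fps p)))
      - t * (y * (y * fps_const H))" (is "?l = ?r")
  proof (intro fps_ext)
    fix k j
    have "?l $ k $ j = ?r $ k $ j"
    proof (cases k)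
      case 0
      then show ?thesis
        by (cases j; cases "j - 1") (simp_all add: yn F_def H_def wedge_0)
    next
      case (Suc m)
      then show ?thesis
        using wedge_rec[of "m - 1" "j - 1"] wedge_rec_0[of "j - 1"] wedge_row
        by (cases m; cases j; cases "j - 1") (simp_all add: yn F_def W1_def H_def wedge_0 p0' algebra_simps)
    qed
    then show "?l $ k $ j = ?r $ k $ j" .
  qed
  from arg_cong[OF this, of "ev a"]
  have "a * (fps_X * ev a F) - ft * (a * (fps_X * (fps_X * ev a F)) + a * ev a F + a * (a * ev a F) + fps_X * (fps_X * ev a F)) =
    fps_const e * (ft * (a * (fps_X * (fps_X * W1)))) - ft * (a * (Abs_fps p oo a) + a * (a * (Abs_fps p oo a)))
      - ft * (fps_X * (fps_X * H))"
    by (simp only: ev_homs[OF a(1)] ev_of_const_coeffs[OF a(1)] y_def t_def)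
  moreover have "a * (fps_X * ev a F) - ft * (a * (fps_X * (fps_X * ev a F)) + a * ev a F + a * (a * ev a F) + fps_X * (fps_X * ev a F))
    = (fps_X * a - ft * (a * fps_X\<^sup>2 + a + a\<^sup>2 + fps_X\<^sup>2)) * ev a F"
    by (simp add: algebra_simps power2_eq_square)
  moreover have "fps_X * a - ft * (a * fps_X\<^sup>2 + a + a\<^sup>2 + fps_X\<^sup>2) = 0"
    by (simp only: a(2) diff_self)
  ultimately have z: "fps_const e * (ft * (a * (fps_X * (fps_X * W1)))) - ft * (a * (Abs_fps p oo a) + a * (a * (Abs_fps p oo a)))
      - ft * (fps_X * (fps_X * H)) = 0"
    by (simp only: mult_zero_left)
  have "t * (E * (a * x\<^sup>2 * W)) - t * (a * (1 + a) * P + x\<^sup>2 * H) =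
      E * (t * (a * (x * (x * W)))) - t * (a * P + a * (a * P)) - t * (x * (x * H))"
    for t E a x W P H :: "rat fls fps"
    by (simp add: algebra_simps power2_eq_square)
  from this[of ft "fps_const e" a fps_X W1 "Abs_fps p oo a" H]
  have "ft * (fps_const e * (a * fps_X\<^sup>2 * W1)) - ft * (a * (1 + a) * (Abs_fps p oo a) + fps_X\<^sup>2 * H) = 0"
    unfolding z .
  then have "ft * (fps_const e * (a * fps_X\<^sup>2 * W1)) = ft * (a * (1 + a) * (Abs_fps p oo a) + fps_X\<^sup>2 * H)"
    by (simp only: right_minus_eq)
  moreover have "ft \<noteq> 0" by simp
  ultimately show ?thesis
    using mult_left_cancel by metis
qed

end

subsection \<open>The kernel root\<close>

text \<open>The wedge kernel vanishes at \<open>x = y\<^sup>2 r(y)\<close>. The coefficients of \<open>r\<close> are Laurent polynomials in \<open>t\<close>. The generating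
  function of the Catalan numbers solves the quadratic equation.\<close>

lemma kernel_root:
  obtains r :: "rat fls fps" where "fps_X\<^sup>2 * r\<^sup>2 + (1 + fps_X\<^sup>2 - fps_const tinv * fps_X) * r + 1 = 0"
proof -
  define q :: "rat fls fps" where "q = 1 + fps_X\<^sup>2 - fps_const tinv * fps_X"
  have q: "q * inverse q = 1"
    by (rule inverse_mult_eq_1') (simp add: q_def fps_power_zeroth)
  obtain b :: "rat fls fps" where b: "b $ 0 = 0" "b \<noteq> 0" "b = fps_X * ((1 + fps_X)\<^sup>2 oo b)"
    by (rule exists_small_series[of "(1 + fps_X)\<^sup>2"]) (simp add: fps_power_zeroth)
  have "(1 + fps_X)\<^sup>2 oo b = (1 + b)\<^sup>2"
    using b(1) by (simp add: fps_compose_add_distrib fps_compose_power[symmetric])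
  with b(3) have b': "b = fps_X * (1 + b)\<^sup>2"
    by simp
  define z where "z = fps_X\<^sup>2 * (inverse q)\<^sup>2"
  have z0: "z $ 0 = 0"
    by (simp add: z_def fps_mult_nth_0 fps_power_zeroth)
  define m where "m = 1 + (b oo z)"
  have m: "m = 1 + z * m\<^sup>2"
    using arg_cong[OF b', of "\<lambda>f. f oo z"] z0
    by (simp add: m_def fps_compose_mult_distrib fps_compose_add_distrib fps_compose_power[symmetric])
  have "fps_X\<^sup>2 * (- (m * inverse q))\<^sup>2 + q * (- (m * inverse q)) + 1 = z * m\<^sup>2 - m * (q * inverse q) + 1"
    by (simp add: z_def algebra_simps power2_eq_square)
  also have "\<dots> = 0"
    using m q by (simp add: algebra_simps)
  finally show ?thesis
    using that unfolding q_def by blast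
qed

section \<open>The line \<open>i = -1\<close>\<close>

lemma U_diagonal_rec:
  "vanishing 1 p l (int j) j = fls_X * (vanishing 1 p l (int (Suc j)) (Suc j)
    + (if j = 0 then 0 else vanishing 1 p l (int (j - 1)) (j - 1)) + 2 * vanishing 1 p l (int j - 1) (Suc j))"
proof -
  have e: "(1 :: rat fls) * 1 = 1" "1 * p 0 = p 0" by simp_all
  note w0 = wedge_0[where e = 1 and p = p and l = l, OF e]
  note wr = wedge_rec_0[where e = 1 and p = p, OF e]
  note col = U_col[where e = 1 and p = p and l = l, OF e]
  show ?thesis
  proof (cases j)
    case 0
    then show ?thesis
      using wr[of 0] w0[of 0] w0[of 1] col(2) by simp
  next
    case (Suc m)
    then show ?thesis
      using wr[of j] w0[of j] w0[of "Suc j"] w0[of m] col(1)[of m] by (simp add: add_ac)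
  qed
qed

lemma (in subfield_set) over_sqrt:
  assumes "F * F = G" "over G" "F $ 0 \<in> K" "2 * F $ 0 \<noteq> 0"
  shows "over F"
proof (rule overI)
  fix n assume n: "upto n F"
  show "F $ n \<in> K"
  proof (cases n)
    case 0
    then show ?thesis using assms by simp
  next
    case (Suc m)
    then have n0: "n \<noteq> 0" and set: "{..n} = insert 0 (insert n {1..<n})"
      by auto
    define S where "S = (\<Sum>i\<in>{1..<n}. F $ i * F $ (n - i))"
    have "G $ n = (2 * F $ 0) * F $ n + S"
      unfolding assms(1)[symmetric] fps_mult_nth atLeast0AtMost S_def set using n0
      by simp
    then have "(2 * F $ 0) * F $ n = G $ n - S"
      by simp
    moreover have "S \<in> K"
      unfolding S_def using n by (auto simp: upto_def intro!: sum_in mult_in)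
    then have "G $ n - S \<in> K"
      using assms(2) by (intro diff_in) (simp_all add: over_def)
    ultimately have "(2 * F $ 0) * F $ n \<in> K"
      by (simp only:)
    then show ?thesis
      by (rule cancel_in) (use assms in \<open>auto intro: closed\<close>)
  qed
qed

lemma (in subfield_set) over_compose:
  assumes "over F" "over a"
  shows "over (F oo a)"
proof -
  have "over (a ^ n)" for n
    by (rule over_power[OF assms(2)])
  then show ?thesis
    unfolding over_def fps_compose_nth using assms(1) by (auto simp: over_def intro!: sum_in mult_in)
qed

lemma compose_hom: "a $ 0 = 0 \<Longrightarrow> coeff_hom (\<lambda>F. F oo (a :: rat fls fps))"
  by standard (simp_all add: fps_compose_add_distrib fps_compose_mult_distrib)

lemma roots_sum_zero:
  fixes a b c s v :: "'a::comm_ring_1"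
  assumes "a + b + c = 2 * (s + v)" "a * b * c = 2 * s * v\<^sup>2"
  defines "qq \<equiv> \<lambda>x. x\<^sup>2 - s * x - s * v"
  shows "a * qq b * qq c + b * qq a * qq c + c * qq a * qq b = 0"
proof -
  have "a * qq b * qq c + b * qq a * qq c + c * qq a * qq b =
    (a * b * c) * (a * b + a * c + b * c) - 2 * s * (a + b + c) * (a * b * c)
    - s * v * ((a + b + c) * (a * b + a * c + b * c) - 3 * (a * b * c)) + 3 * s\<^sup>2 * (a * b * c)
    + 2 * s\<^sup>2 * v * (a * b + a * c + b * c) + s\<^sup>2 * v\<^sup>2 * (a + b + c)"
    by (simp add: qq_def algebra_simps power2_eq_square)
  also have "\<dots> = 0"
    unfolding assms(1,2) by (simp add: algebra_simps power2_eq_square)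
  finally show ?thesis .
qed

lemma third_root:
  fixes a b e k d :: "'a::idom"
  assumes "a ^ 3 - e * a\<^sup>2 + k * a = d" "b ^ 3 - e * b\<^sup>2 + k * b = d" "a \<noteq> b"
  shows "a * (e - a - b) * b = d"
proof -
  have "(a - b) * (a\<^sup>2 + a * b + b\<^sup>2 - e * (a + b) + k) = (a ^ 3 - e * a\<^sup>2 + k * a) - (b ^ 3 - e * b\<^sup>2 + k * b)"
    by (simp add: algebra_simps power2_eq_square power3_eq_cube)
  then have k: "a\<^sup>2 + a * b + b\<^sup>2 - e * (a + b) + k = 0"
    using assms by simp
  have "a ^ 3 - e * a\<^sup>2 + k * a = a * (e - a - b) * b + a * (a\<^sup>2 + a * b + b\<^sup>2 - e * (a + b) + k)"
    by (simp add: algebra_simps power2_eq_square power3_eq_cube)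
  then show ?thesis
    using assms(1) k by simp
qed

text \<open>On the wedge kernel, the invariants of the two half-plane variables still agree.\<close>

lemma wedge_invariants:
  fixes x y t u :: "'a::idom"
  assumes "y * x = t * (x * y\<^sup>2 + x + x\<^sup>2 + y\<^sup>2)" "(1 + x) * u = 1"
  shows "y\<^sup>2 * (t\<^sup>2 * (1 + x)\<^sup>2 + x\<^sup>2 * u\<^sup>2) = x * (4 * t\<^sup>2 * y\<^sup>2 + t * y * (1 + y\<^sup>2) - t\<^sup>2 * (1 + y\<^sup>2)\<^sup>2)"
    "y\<^sup>2 * (t\<^sup>2 * (1 + x) ^ 3 - x\<^sup>2 * u) * u = t\<^sup>2 * (1 - y\<^sup>2) * (y\<^sup>2 - x\<^sup>2)"
proof -
  define m where "m = 1 + x"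
  have "t * m * (x + y\<^sup>2) = t * (x * y\<^sup>2 + x + x\<^sup>2 + y\<^sup>2)"
    by (simp add: m_def algebra_simps power2_eq_square)
  then have 0: "y * x - t * m * (x + y\<^sup>2) = 0"
    by (simp only: assms(1) diff_self)
  have mu: "m * u = 1"
    using assms(2) by (simp add: m_def)
  have "(y * x - t * m * (x + y\<^sup>2)) * (x * y - t * m * (1 + x * y\<^sup>2)) =
      y\<^sup>2 * (t\<^sup>2 * m ^ 4 + x\<^sup>2) - x * m\<^sup>2 * (4 * t\<^sup>2 * y\<^sup>2 + t * y * (1 + y\<^sup>2) - t\<^sup>2 * (1 + y\<^sup>2)\<^sup>2)" (is "_ = ?r")
    unfolding m_def by (simp add: algebra_simps power2_eq_square power4_eq_xxxx)
  then have "?r * u\<^sup>2 = 0"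
    unfolding 0 by simp
  moreover have "?r * u\<^sup>2 = y\<^sup>2 * (t\<^sup>2 * m\<^sup>2 * (m * u)\<^sup>2 + x\<^sup>2 * u\<^sup>2)
      - x * (4 * t\<^sup>2 * y\<^sup>2 + t * y * (1 + y\<^sup>2) - t\<^sup>2 * (1 + y\<^sup>2)\<^sup>2) * (m * u)\<^sup>2"
    by (simp add: algebra_simps power2_eq_square power4_eq_xxxx)
  ultimately show "y\<^sup>2 * (t\<^sup>2 * (1 + x)\<^sup>2 + x\<^sup>2 * u\<^sup>2) = x * (4 * t\<^sup>2 * y\<^sup>2 + t * y * (1 + y\<^sup>2) - t\<^sup>2 * (1 + y\<^sup>2)\<^sup>2)"
    unfolding mu m_def[symmetric] by simp
  have "(y * x - t * m * (x + y\<^sup>2)) * (y * x + t * m * (x + y\<^sup>2)) =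
      t\<^sup>2 * m\<^sup>2 * (1 - y\<^sup>2) * (y\<^sup>2 - x\<^sup>2) - y\<^sup>2 * (t\<^sup>2 * m ^ 4 - x\<^sup>2)" (is "_ = ?r")
    unfolding m_def by (simp add: algebra_simps power2_eq_square power4_eq_xxxx)
  then have "?r * u\<^sup>2 = 0"
    unfolding 0 by simp
  moreover have "?r * u\<^sup>2 = t\<^sup>2 * (1 - y\<^sup>2) * (y\<^sup>2 - x\<^sup>2) * (m * u)\<^sup>2 - y\<^sup>2 * (t\<^sup>2 * m ^ 3 * (m * u) - x\<^sup>2 * u) * u"
    by (simp add: algebra_simps power2_eq_square power3_eq_cube power4_eq_xxxx)
  ultimately show "y\<^sup>2 * (t\<^sup>2 * (1 + x) ^ 3 - x\<^sup>2 * u) * u = t\<^sup>2 * (1 - y\<^sup>2) * (y\<^sup>2 - x\<^sup>2)"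
    unfolding mu m_def[symmetric] by simp
qed

text \<open>The constants \<open>s\<close>, \<open>v\<close>, \<open>e\<close>, \<open>c\<close> are odd in \<open>Z\<close>, while \<open>h\<close> is even.\<close>

lemma half_constants:
  fixes z s v e c h k :: "rat fls"
  assumes K: "subfield_set K" and T: "z\<^sup>2 \<in> K" "z \<noteq> 0" and k: "k \<in> K"
    and s: "2 * z ^ 3 * s = z\<^sup>2 - 1" and v: "8 * z ^ 3 * v = (z\<^sup>2 + 1)\<^sup>2"
    and e: "e = 2 * (s + v)" and c: "c = e * v\<^sup>2 - 2 * v ^ 3" and h: "h = 2 * e * v - 3 * v\<^sup>2 - k"
  shows "s / z \<in> K" "v / z \<in> K" "e / z \<in> K" "c / z \<in> K" "h \<in> K" "s * v \<in> K"
proof -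
  interpret subfield_set K by fact
  have "s / z = (z\<^sup>2 - 1) / (2 * (z\<^sup>2)\<^sup>2)"
    unfolding s[symmetric] using T(2) by (simp add: field_simps power2_eq_square power3_eq_cube)
  then show s': "s / z \<in> K"
    using T(1) by (simp only: closed)
  have "v / z = (z\<^sup>2 + 1)\<^sup>2 / (8 * (z\<^sup>2)\<^sup>2)"
    unfolding v[symmetric] using T(2) by (simp add: field_simps power2_eq_square power3_eq_cube)
  then show v': "v / z \<in> K"
    using T(1) by (simp only: closed)
  have "e / z = 2 * (s / z + v / z)"
    by (simp add: e add_divide_distrib)
  then show e': "e / z \<in> K"
    using s' v' by (simp only: closed)
  have "c / z = z\<^sup>2 * (e / z * (v / z)\<^sup>2 - 2 * (v / z) ^ 3)"
    using T(2) by (simp add: c field_simps power2_eq_square power3_eq_cube)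
  then show "c / z \<in> K"
    using e' v' T(1) by (simp only: closed)
  have "h = z\<^sup>2 * (2 * (e / z) * (v / z) - 3 * (v / z)\<^sup>2) - k"
    using T(2) by (simp add: h field_simps power2_eq_square)
  then show "h \<in> K"
    using e' v' T(1) k by (simp only: closed)
  have "s * v = z\<^sup>2 * (s / z * (v / z))"
    using T(2) by (simp add: field_simps power2_eq_square)
  then show "s * v \<in> K"
    using s' v' T(1) by (simp only: closed)
qed

lemma tinv': "tinv * fls_X = 1" "tinv * (fls_X * a) = a"
  using tinv by (simp_all only: mult.commute[of tinv] mult.assoc[symmetric] mult_1)

lemma fps_const_cancel:
  fixes f g :: "rat fls fps"
  shows "c \<noteq> 0 \<Longrightarrow> fps_const c * f = fps_const c * g \<Longrightarrow> f = g"
  by simp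

lemma diagonal_relation:
  fixes t a y H p q N W :: "'a::comm_ring_1"
  assumes W: "2 * (t * (y\<^sup>2 * W)) = y * H - t * (H - p) - t * (y\<^sup>2 * H)"
    and wk: "a * (1 + a) * q + y\<^sup>2 * H = a * y\<^sup>2 * W"
    and N: "N = 4 * ((1 + a) * q) - 2 * p"
    and a: "y * a = t * (a * y\<^sup>2 + a + a\<^sup>2 + y\<^sup>2)"
  shows "t * (2 * (a\<^sup>2 - y\<^sup>2) * H) = t * (a * N)"
proof -
  have q: "a * (1 + a) * q = a * y\<^sup>2 * W - y\<^sup>2 * H"
    unfolding wk[symmetric] by simp
  have "t * (a * N) = 4 * t * (a * (1 + a) * q) - 2 * t * a * p"
    unfolding N by (simp add: algebra_simps)
  also have "\<dots> = 2 * a * (2 * (t * (y\<^sup>2 * W))) - 4 * t * y\<^sup>2 * H - 2 * t * a * p"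
    unfolding q by (simp add: algebra_simps)
  also have "\<dots> = 2 * (y * a) * H - 2 * a * t * H - 2 * a * t * y\<^sup>2 * H - 4 * t * y\<^sup>2 * H"
    unfolding W by (simp add: algebra_simps)
  also have "\<dots> = t * (2 * (a\<^sup>2 - y\<^sup>2) * H)"
    unfolding a by (simp add: algebra_simps)
  finally show ?thesis ..
qed

lemma diagonal_relation2:
  fixes t a y H N n u Qt R om V :: "'a::comm_ring_1"
  assumes H: "2 * (a\<^sup>2 - y\<^sup>2) * H = a * N" and N: "t\<^sup>2 * N = - (n * u)"
    and n: "n * Qt = - 2 * R * om" and R: "y\<^sup>2 * R * u = t\<^sup>2 * (1 - y\<^sup>2) * (y\<^sup>2 - a\<^sup>2)" and V: "V = a * om"
  shows "2 * t\<^sup>2 * (a\<^sup>2 - y\<^sup>2) * (y\<^sup>2 * Qt * H) = 2 * t\<^sup>2 * (a\<^sup>2 - y\<^sup>2) * - ((1 - y\<^sup>2) * V)"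
proof -
  have "2 * t\<^sup>2 * (a\<^sup>2 - y\<^sup>2) * (y\<^sup>2 * Qt * H) = y\<^sup>2 * Qt * t\<^sup>2 * (2 * (a\<^sup>2 - y\<^sup>2) * H)"
    by (simp only: mult_ac)
  also have "\<dots> = y\<^sup>2 * Qt * a * (t\<^sup>2 * N)"
    unfolding H by (simp only: mult_ac)
  also have "\<dots> = - (y\<^sup>2 * a * u * (n * Qt))"
    unfolding N by (simp add: mult_ac)
  also have "\<dots> = 2 * a * om * (y\<^sup>2 * R * u)"
    unfolding n by (simp add: mult_ac)
  also have "\<dots> = 2 * t\<^sup>2 * (a\<^sup>2 - y\<^sup>2) * - ((1 - y\<^sup>2) * V)"
    unfolding R V by (simp add: algebra_simps)
  finally show ?thesis .
qed

lemma conjugate_difference: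
  fixes p h m t b1 b2 b3 q1 q2 q3 :: "'a::comm_ring_1"
  assumes p: "p * q1 = 2 * t * m * b1" and h: "h * q3 = - (m * t * b3)"
    and sum: "b1 * q2 * q3 + b2 * q1 * q3 + b3 * q1 * q2 = 0"
  shows "q3 * ((p - h) * (q1 * q2)) = q3 * (m * t * (b1 * q2 - b2 * q1))"
proof -
  have "q3 * ((p - h) * (q1 * q2)) = (p * q1) * q2 * q3 - (h * q3) * q1 * q2"
    by (simp add: algebra_simps)
  also have "\<dots> = m * t * (2 * b1 * q2 * q3 + b3 * q1 * q2)"
    unfolding p h by (simp add: algebra_simps)
  also have "2 * b1 * q2 * q3 + b3 * q1 * q2 = (b1 * q2 * q3 + b2 * q1 * q3 + b3 * q1 * q2) + q3 * (b1 * q2 - b2 * q1)"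
    by (simp add: algebra_simps)
  finally show ?thesis
    unfolding sum by (simp add: mult_ac)
qed

context subfield_with_t
begin

text \<open>The coefficients lie in \<open>\<rat>(t, Z)\<close>, where \<open>Z\<close> is quadratic over \<open>\<rat>(t, T)\<close>. Subtract a function that is
  harmonic and vanishes on the line \<open>i = -1\<close>; this leaves the values on the line unchanged. Its boundary values are chosen
  with the help of the three roots of the cubic equation at the kernel root: \<open>BB\<close>, a conjugate, and the image of \<open>VV\<close>.
  In the remaining boundary data, only the difference of \<open>BB\<close> and its conjugate enters, and its coefficients are
  invariant under \<open>Z \<mapsto> - Z\<close>. So the remainder, and with it the values on the line, have coefficients in the smaller field.\<close>

theorem parts_on_line_in:
  "fl (anti_part (Suc k) (2 * k + 1)) \<in> K" "fl (sym_part (Suc k) (2 * k + 1)) \<in> K"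
proof -
  note tK = t_in and TK = T_in[folded fl_def]
  obtain s0 v0 c0 where *:
    "2 * Z ^ 3 * s0 = T - 1" "8 * Z ^ 3 * v0 = (T + 1)\<^sup>2" "ee = 2 * (s0 + v0)"
    "c0 = ee * v0\<^sup>2 - 2 * v0 ^ 3" "hh = 2 * ee * v0 - 3 * v0\<^sup>2 - kap"
    "omega * (iota + fps_X * (VV\<^sup>2 - cst ee * VV + cst hh)) = cst c0"
    "(kappa + BB\<^sup>2 - cst ee * fps_X * BB + cst hh * fps_X\<^sup>2) * BB = cst c0 * fps_X ^ 3"
    "(zeta - fps_X * VV + cst s0 * fps_X) * omega = cst (- s0 * v0)"
    "(xi - BB + cst s0 * fps_X) * BB = cst (- s0 * v0) * fps_X\<^sup>2"
    by (rule boundary_equations)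
  define z s v e c h where "z = fl Z" and "s = fl s0" and "v = fl v0" and "e = fl ee" and "c = fl c0" and "h = fl hh"
  have z: "z \<noteq> 0" "z\<^sup>2 \<in> K"
    using Z_0 TK by (auto simp: z_def fl_def Z_square simp flip: fps_to_fls_power)
  have z2: "z\<^sup>2 = fl T"
    by (simp add: z_def fl_def Z_square flip: fps_to_fls_power)
  have kK: "fl kap \<in> K"
  proof (rule cancel_in)
    show "4 * fl kap \<in> K"
      unfolding fl_kap using tK by (simp only: closed)
  qed (auto intro!: closed)
  have e_eq: "e = 2 * (s + v)" and c_eq: "c = e * v\<^sup>2 - 2 * v ^ 3" and h_eq: "h = 2 * e * v - 3 * v\<^sup>2 - fl kap"
    using arg_cong[OF *(3), of fl] arg_cong[OF *(4), of fl] arg_cong[OF *(5), of fl]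
    by (simp_all only: fl_homs(1-9) e_def s_def v_def c_def h_def)
  have s_eq: "2 * z ^ 3 * s = z\<^sup>2 - 1" and v_eq: "8 * z ^ 3 * v = (z\<^sup>2 + 1)\<^sup>2"
    using arg_cong[OF *(1), of fl] arg_cong[OF *(2), of fl] unfolding z2 by (simp_all only: fl_homs(1-9) s_def v_def z_def)
  note hc = half_constants[OF subfield_set_axioms z(2,1) kK s_eq v_eq e_eq c_eq h_eq]
  have nz: "s \<noteq> 0" "v \<noteq> 0"
    using s_v_nonzero[OF *(1,2)] by (simp_all add: s_def v_def fl_def)
  have c_sv: "c = 2 * s * v\<^sup>2"
    unfolding c_eq e_eq by (simp add: algebra_simps power2_eq_square power3_eq_cube)
  define S P E Hc C where "S = fps_const s" and "P = fps_const (- (s * v))" and "E = fps_const e"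
    and "Hc = fps_const h" and "C = fps_const c"
  have cst_eqs: "fps_const (fps_to_fls ee) = E" "fps_const (fps_to_fls hh) = Hc" "fps_const (fps_to_fls c0) = C"
    "fps_const (fps_to_fls s0) = S" "fps_const (fps_to_fls (- s0 * v0)) = P"
    by (simp_all add: E_def Hc_def C_def S_def P_def e_def h_def c_def s_def v_def fl_def fls_times_fps_to_fls)

  \<comment> \<open>the series in \<open>x\<close>\<close>
  define om V I u n where "om = lift_coeffs omega" and "V = lift_coeffs VV" and "I = lift_coeffs iota"
    and "u = lift_coeffs u1" and "n = lift_coeffs nn"
  have V: "V = fps_X * om"
    unfolding V_def om_def by (subst VV_omega) (simp only: lifts)
  have u: "(1 + fps_X) * u = 1"
    using lift_u1 by (simp only: u_def mult.commute)
  have I: "I = ft\<^sup>2 * (1 + fps_X)\<^sup>2 + fps_X\<^sup>2 * u\<^sup>2"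
    by (simp only: I_def iota_def lifts u_def)
  have X1: "om * (I + fps_X * (V\<^sup>2 - E * V + Hc)) = C"
    using arg_cong[OF *(6), of lift_coeffs] by (simp only: lifts cst_eqs om_def V_def I_def)
  have X2: "n * (V\<^sup>2 - S * V + P) = - 2 * (ft\<^sup>2 * (1 + fps_X) ^ 3 - fps_X\<^sup>2 * u) * om"
  proof -
    have "zeta * omega = (fps_X * omega) * VV - cst s0 * (fps_X * omega) + (zeta - fps_X * VV + cst s0 * fps_X) * omega"
      by (simp add: algebra_simps)
    then have "zeta * omega = VV\<^sup>2 - cst s0 * VV + cst (- s0 * v0)"
      unfolding *(8) VV_omega[symmetric] power2_eq_square .
    from arg_cong[OF this, of lift_coeffs] have 1: "lift_coeffs zeta * om = V\<^sup>2 - S * V + P"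
      by (simp only: lifts cst_eqs om_def V_def)
    have "nn * zeta = - 2 * (vt\<^sup>2 * (1 + fps_X) ^ 3 - fps_X\<^sup>2 * u1)"
      unfolding zeta_def by (simp only: mult.left_commute[of nn] inv_nn mult_1_right)
    from arg_cong[OF this, of lift_coeffs] have 2: "n * lift_coeffs zeta = - 2 * (ft\<^sup>2 * (1 + fps_X) ^ 3 - fps_X\<^sup>2 * u)"
      by (simp only: lifts n_def u_def)
    show ?thesis
      unfolding 1[symmetric] 2[symmetric] by (simp only: mult.assoc)
  qed
  define W where "W = fps_const (inverse z) * om"
  have om: "om = fps_const z * W"
    using z by (simp add: W_def flip: mult.assoc)
  have overW: "over W"
  proof (rule over_cubic_x)
    have "fps_const z * (W * (I + fps_X * (fps_const (z\<^sup>2) * (fps_X * W)\<^sup>2 - fps_const (z\<^sup>2 * (e / z)) * (fps_X * W) + Hc)))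
      = om * (I + fps_X * (V\<^sup>2 - E * V + Hc))"
    proof -
      have ez: "fps_const (z\<^sup>2 * (e / z)) = E * fps_const z"
        using z by (simp add: E_def power2_eq_square)
      have "y * (w * (i + x * (y\<^sup>2 * (x * w)\<^sup>2 - g * y * (x * w) + k))) =
        (y * w) * (i + x * ((x * (y * w))\<^sup>2 - g * (x * (y * w)) + k))" for y w i x g k :: "'x::comm_ring_1"
        by (simp add: algebra_simps power2_eq_square)
      from this[of "fps_const z" W I fps_X E Hc] show ?thesis
        unfolding ez V om fps_const_power .
    qed
    also have "\<dots> = fps_const z * fps_const (c / z)"
      unfolding X1 using z by (simp add: C_def)
    finally show "W * (I + fps_X * (fps_const (z\<^sup>2) * (fps_X * W)\<^sup>2 - fps_const (z\<^sup>2 * (e / z)) * (fps_X * W) + fps_const h))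
      = fps_const (c / z)"
      unfolding Hc_def by (rule fps_const_cancel[OF z(1)])
    show "I $ 0 \<noteq> 0"
      by (simp add: I_def iota_0)
  qed (use over_iota hc z in \<open>auto simp: I_def\<close>)
  have W0: "W $ 0 \<noteq> 0"
  proof -
    have "om $ 0 * I $ 0 = c"
      using arg_cong[OF X1, of "\<lambda>f. f $ 0"] by (simp add: fps_mult_nth_0 C_def)
    then show ?thesis
      using nz z c_sv by (auto simp: W_def)
  qed

  \<comment> \<open>the kernel root\<close>
  obtain r :: "rat fls fps" where r: "fps_X\<^sup>2 * r\<^sup>2 + (1 + fps_X\<^sup>2 - fps_const tinv * fps_X) * r + 1 = 0"
    by (rule kernel_root)
  have overr: "over r"
  proof (rule overI)
    fix m assume m: "upto m r"
    have tv: "tinv \<in> K"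
      unfolding tinv_def using tK by (rule inverse_in)
    have "r * (1 + fps_X\<^sup>2 - fps_const tinv * fps_X) = - (1 + fps_X * (fps_X * r\<^sup>2))"
      using r by (simp add: algebra_simps power2_eq_square eq_neg_iff_add_eq_0)
    then show "r $ m \<in> K"
    proof (rule upto_quotient)
      show "upto (Suc m) (- (1 + fps_X * (fps_X * r\<^sup>2)))"
        by (intro upto_uminus upto_add upto_1 upto_X_mult upto_mult upto_X upto_power m)
    qed (use m tv in \<open>auto intro!: upto simp: fps_power_zeroth\<close>)
  qed
  have r0: "r $ 0 = -1"
    using arg_cong[OF r, of "\<lambda>f. f $ 0"] by (simp add: fps_mult_nth_0 fps_power_zeroth eq_neg_iff_add_eq_0)
  define a where "a = fps_X\<^sup>2 * r"
  have a0: "a $ 0 = 0"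
    by (simp add: a_def fps_mult_nth_0 fps_power_zeroth)
  have a_eq: "fps_X * a = ft * (a * fps_X\<^sup>2 + a + a\<^sup>2 + fps_X\<^sup>2)"
  proof -
    have ti: "ft * fps_const tinv = 1"
      by (simp add: tinv)
    have "t * (x\<^sup>2 * (x\<^sup>2 * r\<^sup>2 + (1 + x\<^sup>2 - w * x) * r + 1)) =
      t * ((x\<^sup>2 * r) * x\<^sup>2 + x\<^sup>2 * r + (x\<^sup>2 * r)\<^sup>2 + x\<^sup>2) - (t * w) * (x * (x\<^sup>2 * r))" for t x r w :: "'x::comm_ring_1"
      by (simp add: algebra_simps power2_eq_square)
    from this[of ft fps_X r "fps_const tinv"] show ?thesis
      unfolding r ti a_def by simp
  qed
  have overa: "over a"
    unfolding a_def by (intro over overr)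
  interpret comp: coeff_hom "\<lambda>F. F oo a"
    using a0 by (rule compose_hom)
  have compX: "fps_X oo a = a"
    using a0 by (rule fps_X_fps_compose_startby0)
  have compc: "fps_const k oo a = fps_const k" for k :: "rat fls"
    by simp
  note comps = comp.homs compX compc
  define omt ut nt where "omt = om oo a" and "ut = u oo a" and "nt = n oo a"
  define Vt where "Vt = a * omt"
  have Vt: "V oo a = Vt"
    unfolding V Vt_def omt_def by (simp only: comps)
  have ut: "(1 + a) * ut = 1"
    using arg_cong[OF u, of "\<lambda>F. F oo a"] by (simp only: comps ut_def)
  note wi = wedge_invariants[OF a_eq ut]
  have Y1: "omt * (ft\<^sup>2 * (1 + a)\<^sup>2 + a\<^sup>2 * ut\<^sup>2 + a * (Vt\<^sup>2 - E * Vt + Hc)) = C"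
    using arg_cong[OF X1[unfolded I], of "\<lambda>F. F oo a"] unfolding E_def Hc_def C_def
    by (simp only: comps Vt omt_def ut_def)
  have Y2: "nt * (Vt\<^sup>2 - S * Vt + P) = - 2 * (ft\<^sup>2 * (1 + a) ^ 3 - a\<^sup>2 * ut) * omt"
    using arg_cong[OF X2, of "\<lambda>F. F oo a"] unfolding S_def P_def
    by (simp only: comps Vt omt_def ut_def nt_def)
  define Wt where "Wt = W oo a"
  have omt: "omt = fps_const z * Wt"
    unfolding omt_def om Wt_def by (simp only: comps)
  have overWt: "over Wt"
    unfolding Wt_def by (rule over_compose[OF overW overa])

  \<comment> \<open>the three roots of the cubic equation in \<open>y\<close>\<close>
  define kp where "kp = lift_coeffs kappa"
  define B1 B3 where "B1 = lift_coeffs BB" and "B3 = fps_X * Vt"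
  define B2 where "B2 = E * fps_X - B1 - B3"
  have kp: "kp = 4 * ft\<^sup>2 * fps_X\<^sup>2 + ft * fps_X * (1 + fps_X\<^sup>2) - ft\<^sup>2 * (1 + fps_X\<^sup>2)\<^sup>2"
    by (simp only: kp_def kappa_def lifts)
  have cub1: "B1 ^ 3 - E * fps_X * B1\<^sup>2 + (kp + Hc * fps_X\<^sup>2) * B1 = C * fps_X ^ 3"
  proof -
    have "(kp + B1\<^sup>2 - E * fps_X * B1 + Hc * fps_X\<^sup>2) * B1 = C * fps_X ^ 3"
      using arg_cong[OF *(7), of lift_coeffs] by (simp only: lifts cst_eqs B1_def kp_def)
    moreover have "(k + b\<^sup>2 - g * b + h) * b = b ^ 3 - g * b\<^sup>2 + (k + h) * b" for k b g h :: "'x::comm_ring_1"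
      by (simp add: algebra_simps power2_eq_square power3_eq_cube)
    from this[of kp B1 "E * fps_X" "Hc * fps_X\<^sup>2"]
    have "(kp + B1\<^sup>2 - E * fps_X * B1 + Hc * fps_X\<^sup>2) * B1 = B1 ^ 3 - E * fps_X * B1\<^sup>2 + (kp + Hc * fps_X\<^sup>2) * B1" .
    ultimately show ?thesis by (simp only:)
  qed
  have cub3: "B3 ^ 3 - E * fps_X * B3\<^sup>2 + (kp + Hc * fps_X\<^sup>2) * B3 = C * fps_X ^ 3"
  proof -
    have "o' * (i + a * ((a * o')\<^sup>2 - g * (a * o') + h)) * y ^ 3 =
       (y * (a * o')) ^ 3 - g * y * (y * (a * o'))\<^sup>2 + h * y\<^sup>2 * (y * (a * o')) + y * o' * (y\<^sup>2 * i)"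
      for o' i a g h y :: "'x::comm_ring_1"
      by (simp add: algebra_simps power2_eq_square power3_eq_cube)
    from this[of omt "ft\<^sup>2 * (1 + a)\<^sup>2 + a\<^sup>2 * ut\<^sup>2" a E Hc fps_X]
    have "C * fps_X ^ 3 = B3 ^ 3 - E * fps_X * B3\<^sup>2 + Hc * fps_X\<^sup>2 * B3 + fps_X * omt * (a * kp)"
      unfolding Y1[unfolded Vt_def] wi(1) kp[symmetric] B3_def Vt_def .
    moreover have "fps_X * omt * (a * kp) = kp * B3"
      by (simp only: B3_def Vt_def mult_ac)
    moreover have "B3 ^ 3 - E * fps_X * B3\<^sup>2 + (kp + Hc * fps_X\<^sup>2) * B3 =
        B3 ^ 3 - E * fps_X * B3\<^sup>2 + Hc * fps_X\<^sup>2 * B3 + kp * B3"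
      by (simp add: distrib_right)
    ultimately show ?thesis
      by (simp only:)
  qed
  have B1_0: "B1 $ 0 = fls_X" and B3_0: "B3 $ 0 = 0"
    by (simp_all add: B1_def BB_0 B3_def)
  have "B1 \<noteq> B3"
    using B1_0 B3_0 by auto
  from third_root[OF cub1 cub3 this] have prod: "B1 * B2 * B3 = C * fps_X ^ 3"
    by (simp only: B2_def)
  have B2_0: "B2 $ 0 = - fls_X"
    by (simp add: B2_def B1_0 B3_0)
  define Pi where "Pi = B1 * B2"
  have Pi_eq: "Pi * (r * Wt) = fps_const (c / z)"
  proof -
    have "(fps_X ^ 3 * fps_const z) * (Pi * (r * Wt)) = Pi * B3"
      unfolding B3_def Vt_def omt a_def by (simp add: power2_eq_square power3_eq_cube mult_ac)
    also have "\<dots> = (fps_X ^ 3 * fps_const z) * fps_const (c / z)"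
      unfolding Pi_def prod C_def using z by (simp add: mult_ac)
    finally show ?thesis
      using z mult_left_cancel[of "fps_X ^ 3 * fps_const z"] by simp
  qed
  have overPi: "over Pi"
    using Pi_eq by (rule over_quotient) (use hc overr overWt W0 r0 a0 in \<open>auto intro!: over simp: fps_mult_nth_0 Wt_def\<close>)
  have Pi0: "Pi $ 0 = - (fls_X * fls_X)"
    by (simp add: Pi_def fps_mult_nth_0 B1_0 B2_0)
  define N where "N = fps_const (e / z) * fps_X - fps_X * (a * Wt)"
  have overN: "over N"
    unfolding N_def by (intro over hc overa overWt)
  have sum: "B1 + B2 = fps_const z * N"
    unfolding N_def B2_def B3_def Vt_def omt E_def using z by (simp add: algebra_simps)
  have sum2: "(B1 + B2)\<^sup>2 = fps_const (z\<^sup>2) * N\<^sup>2"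
    unfolding sum by (simp add: power_mult_distrib fps_const_power)
  define D where "D = B1 - B2"
  have overDf: "over D"
  proof (rule over_sqrt)
    have "D * D = (B1 + B2)\<^sup>2 - 4 * Pi"
      by (simp add: D_def Pi_def algebra_simps power2_eq_square)
    then show "D * D = fps_const (z\<^sup>2) * N\<^sup>2 - 4 * Pi"
      unfolding sum2 .
    show "over (fps_const (z\<^sup>2) * N\<^sup>2 - 4 * Pi)"
      by (intro over overN overPi z)
    show "D $ 0 \<in> K" "2 * D $ 0 \<noteq> 0"
      using tK by (simp_all add: D_def B1_0 B2_0 closed)
  qed

  \<comment> \<open>the symmetric part\<close>
  define No where "No = fps_const (- (tinv * tinv)) * (n * u)"
  define ps where "ps = (\<lambda>m. (fps_const (inverse 4) * (No * u) + fps_const (inverse 4 * No $ 0) * u) $ m)"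
  define ls where "ls = (\<lambda>m. (fps_const (inverse 2) * ((No - fps_const (inverse 2 * No $ 0)) * u)) $ m)"
  define Us where "Us = (\<lambda>k j. vanishing 1 ps ls (int j - 2 * int k) j)"
  have u_0: "u $ 0 = 1"
    using arg_cong[OF u, of "\<lambda>f. f $ 0"] by (simp add: fps_mult_nth_0)
  have ps0: "ps 0 = inverse 2 * No $ 0"
    by (simp add: ps_def fps_mult_nth_0 u_0 algebra_simps)
  have e1: "(1 :: rat fls) * 1 = 1" "1 * ps 0 = ps 0" by simp_all
  have Us_rec: "Us (Suc k) j = fls_X * (Us (Suc k) (Suc j) + Us (Suc (Suc k)) (Suc j) +
    (if j = 0 then 0 else Us (Suc k) (j - 1) + Us k (j - 1)))" for k j
    unfolding Us_def by (rule U_rec[where e = 1 and p = ps and l = ls, OF e1])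
  have Us_row: "Us (Suc k) 0 = ls k" for k
    unfolding Us_def by (rule U_row[where e = 1 and p = ps and l = ls, OF e1])
  have Us_line: "Us (Suc k) (2 * k + 1) = 0" for k
    unfolding Us_def by (rule U_line[where e = 1 and p = ps and l = ls, OF e1])
  have Us_diag: "Us 0 j = fls_X * (Us 0 (Suc j) + (if j = 0 then 0 else Us 0 (j - 1)) + 2 * Us 1 (Suc j))" for j
    using U_diagonal_rec[of ps ls j] by (simp add: Us_def)
  define HU where "HU = Abs_fps (Us 0)"
  have HU: "2 * (a\<^sup>2 - fps_X\<^sup>2) * HU = a * (No oo a)"
  proof -
    define W1 where "W1 = Abs_fps (wedge 1 ps 1)"
    have W: "2 * (ft * (fps_X\<^sup>2 * W1)) = fps_X * HU - ft * (HU - fps_const (ps 0)) - ft * (fps_X\<^sup>2 * HU)"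
    proof (rule fps_ext)
      fix m
      have w0: "wedge 1 ps 0 j = Us 0 j" for j
        unfolding Us_def by (rule wedge_0[where e = 1 and p = ps and l = ls, OF e1])
      have "wedge 1 ps 0 0 = ps 0"
        by (rule wedge_row[where e = 1 and p = ps, OF e1])
      then have u0: "Us 0 0 = ps 0"
        using w0 by simp
      have "wedge 1 ps 0 j = fls_X * (wedge 1 ps 0 (Suc j) +
         (if j = 0 then 0 else wedge 1 ps 0 (j-1) + 2 * wedge 1 ps 1 (j-1)))" for j
        using wedge_rec_0[where e = 1 and p = ps, OF e1, of j] by simp
      from this[of "m - 1"] show "(2 * (ft * (fps_X\<^sup>2 * W1))) $ m = (fps_X * HU - ft * (HU - fps_const (ps 0)) - ft * (fps_X\<^sup>2 * HU)) $ m"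
        by (cases m; cases "m - 1") (simp_all add: W1_def HU_def w0 u0 power2_eq_square mult.assoc algebra_simps)
    qed
    have wk: "a * (1 + a) * (Abs_fps ps oo a) + fps_X\<^sup>2 * HU = a * fps_X\<^sup>2 * W1"
      using wedge_kernel[where e = 1 and p = ps and l = ls, OF e1 a0 a_eq] by (simp add: HU_def W1_def Us_def)
    have "No oo a = 4 * ((1 + a) * (Abs_fps ps oo a)) - 2 * fps_const (ps 0)"
    proof -
      have p1: "Abs_fps ps = (fps_const (inverse 4) * No + fps_const (inverse 4 * No $ 0)) * u"
        by (simp add: ps_def fps_eq_iff distrib_right mult.assoc)
      have "4 * ((1 + fps_X) * Abs_fps ps) = ((1 + fps_X) * u) * (4 * (fps_const (inverse 4) * No + fps_const (inverse 4 * No $ 0)))"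
        unfolding p1 by (simp only: mult_ac)
      also have "\<dots> = No + 2 * fps_const (ps 0)"
        unfolding u ps0 by (simp add: fps_eq_iff numeral_fps_const algebra_simps)
      finally have "No = 4 * ((1 + fps_X) * Abs_fps ps) - 2 * fps_const (ps 0)"
        by simp
      from arg_cong[OF this, of "\<lambda>F. F oo a"] show ?thesis
        by (simp only: comps)
    qed
    from diagonal_relation[OF W wk this a_eq] show ?thesis
      by (rule fps_const_cancel[rotated]) simp
  qed
  define Qt where "Qt = Vt\<^sup>2 - S * Vt + P"
  have y2H: "fps_X\<^sup>2 * Qt * HU = - ((1 - fps_X\<^sup>2) * Vt)"
  proof -
    have No: "ft\<^sup>2 * (No oo a) = - (nt * ut)"
    proof -
      have "ft\<^sup>2 * No = - (n * u)"
        by (simp add: No_def fps_eq_iff power2_eq_square mult.assoc tinv tinv')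
      from arg_cong[OF this, of "\<lambda>F. F oo a"] show ?thesis
        by (simp only: comps nt_def ut_def)
    qed
    have "2 * ft\<^sup>2 * (a\<^sup>2 - fps_X\<^sup>2) * (fps_X\<^sup>2 * Qt * HU) = 2 * ft\<^sup>2 * (a\<^sup>2 - fps_X\<^sup>2) * - ((1 - fps_X\<^sup>2) * Vt)"
      by (rule diagonal_relation2[OF HU No Y2[folded Qt_def] wi(2)]) (simp add: Vt_def)
    moreover have "2 * ft\<^sup>2 * (a\<^sup>2 - fps_X\<^sup>2) \<noteq> 0"
    proof -
      have "a\<^sup>2 - fps_X\<^sup>2 = fps_X\<^sup>2 * (fps_X\<^sup>2 * r\<^sup>2 - 1)"
        by (simp add: a_def power_mult_distrib algebra_simps power2_eq_square)
      moreover have "(fps_X\<^sup>2 * r\<^sup>2 - 1) $ 0 \<noteq> 0"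
        by (simp add: fps_mult_nth_0 fps_power_zeroth)
      then have "fps_X\<^sup>2 * r\<^sup>2 - 1 \<noteq> 0"
        by (metis fps_zero_nth)
      ultimately show ?thesis by simp
    qed
    ultimately show ?thesis
      using mult_left_cancel by blast
  qed
  define Lp where "Lp = lift_coeffs pp"
  define qf where "qf = (\<lambda>b. b\<^sup>2 - (S * fps_X) * b - (S * fps_X) * (fps_const v * fps_X))"
  have qf: "qf b = b\<^sup>2 - S * fps_X * b + P * fps_X\<^sup>2" for b
    by (simp add: qf_def P_def S_def power2_eq_square algebra_simps fps_const_neg[symmetric] fps_const_mult[symmetric]
        del: fps_const_neg fps_const_mult)
  have Lp: "Lp * qf B1 = 2 * ft * (1 - fps_X\<^sup>2) * B1"
  proof -
    have "xi * BB = BB\<^sup>2 - cst s0 * fps_X * BB + cst (- s0 * v0) * fps_X\<^sup>2"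
      unfolding *(9)[symmetric] by (simp add: algebra_simps power2_eq_square)
    from arg_cong[OF this, of lift_coeffs] have 1: "lift_coeffs xi * B1 = qf B1"
      unfolding qf by (simp only: lifts cst_eqs B1_def)
    have "pp * xi = 2 * vt * (1 - fps_X\<^sup>2)"
      unfolding xi_def by (simp only: mult.left_commute[of pp] inv_pp mult_1_right)
    from arg_cong[OF this, of lift_coeffs] have 2: "Lp * lift_coeffs xi = 2 * ft * (1 - fps_X\<^sup>2)"
      by (simp only: lifts Lp_def)
    show ?thesis
      unfolding 1[symmetric] 2[symmetric] by (simp only: mult.assoc)
  qed
  define pE where "pE = Lp - ft * fps_X * HU"
  have q3: "qf B3 = fps_X\<^sup>2 * Qt"
    unfolding qf B3_def Qt_def by (simp add: algebra_simps power2_eq_square)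
  have Hq: "ft * fps_X * HU * qf B3 = - ((1 - fps_X\<^sup>2) * ft * B3)"
  proof -
    have "ft * fps_X * HU * qf B3 = ft * fps_X * (fps_X\<^sup>2 * Qt * HU)"
      unfolding q3 by (simp only: mult_ac)
    then show ?thesis
      unfolding y2H B3_def by (simp add: algebra_simps)
  qed
  have sum0: "B1 * qf B2 * qf B3 + B2 * qf B1 * qf B3 + B3 * qf B1 * qf B2 = 0"
    unfolding qf_def
  proof (rule roots_sum_zero)
    show "B1 + B2 + B3 = 2 * (S * fps_X + fps_const v * fps_X)"
      unfolding B2_def E_def S_def e_eq by (simp add: fps_eq_iff numeral_fps_const algebra_simps)
    show "B1 * B2 * B3 = 2 * (S * fps_X) * (fps_const v * fps_X)\<^sup>2"
    proof -
      have c: "C = 2 * S * (fps_const v)\<^sup>2"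
        by (simp add: C_def S_def c_sv numeral_fps_const fps_const_power)
      have "2 * g * w\<^sup>2 * x ^ 3 = 2 * (g * x) * (w * x)\<^sup>2" for g w x :: "'x::comm_ring_1"
        by (simp add: power2_eq_square power3_eq_cube mult_ac)
      then show ?thesis
        unfolding prod c .
    qed
  qed
  have pE: "pE * (qf B1 * qf B2) = (1 - fps_X\<^sup>2) * ft * (D * (P * fps_X\<^sup>2 - Pi))"
  proof -
    have "qf B3 * (pE * (qf B1 * qf B2)) = qf B3 * ((1 - fps_X\<^sup>2) * ft * (B1 * qf B2 - B2 * qf B1))"
      unfolding pE_def by (rule conjugate_difference[OF Lp Hq sum0])
    moreover have "qf B3 \<noteq> 0"
    proof -
      have "Qt $ 0 = - (s * v)"
        by (simp add: Qt_def Vt_def a0 P_def fps_mult_nth_0 fps_power_zeroth)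
      then have "Qt \<noteq> 0" using nz by auto
      then show ?thesis by (simp add: q3)
    qed
    ultimately have "pE * (qf B1 * qf B2) = (1 - fps_X\<^sup>2) * ft * (B1 * qf B2 - B2 * qf B1)"
      using mult_left_cancel by blast
    also have "B1 * qf B2 - B2 * qf B1 = D * (P * fps_X\<^sup>2 - Pi)"
      unfolding qf D_def Pi_def by (simp add: algebra_simps power2_eq_square)
    finally show ?thesis .
  qed
  have overP: "over P"
    unfolding P_def using hc by (intro over) (simp only: closed)
  have qq: "qf B1 * qf B2 = Pi\<^sup>2 - (fps_const (z\<^sup>2 * (s / z)) * N) * (fps_X * Pi) + P * fps_X\<^sup>2 * (fps_const (z\<^sup>2) * N\<^sup>2 - 2 * Pi)
     + fps_const (z\<^sup>2 * (s / z)\<^sup>2) * fps_X\<^sup>2 * Pi - (fps_const (z\<^sup>2 * (s / z)) * N) * (P * fps_X ^ 3) + P\<^sup>2 * fps_X ^ 4"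
  proof -
    have "(b\<^sup>2 - g * x * b + p * x\<^sup>2) * (d\<^sup>2 - g * x * d + p * x\<^sup>2) = (b * d)\<^sup>2 - (g * (b + d)) * (x * (b * d)) + p * x\<^sup>2 * ((b + d)\<^sup>2 - 2 * (b * d))
     + g\<^sup>2 * x\<^sup>2 * (b * d) - (g * (b + d)) * (p * x ^ 3) + p\<^sup>2 * x ^ 4" for b d g x p :: "'x::comm_ring_1"
      by (simp add: algebra_simps power2_eq_square power3_eq_cube power4_eq_xxxx)
    note id = this[of B1 S fps_X P B2, folded Pi_def]
    have "s * z = z\<^sup>2 * (s / z)"
      using z by (simp add: power2_eq_square)
    then have 1: "S * (B1 + B2) = fps_const (z\<^sup>2 * (s / z)) * N"
      unfolding sum S_def by (simp add: mult.assoc[symmetric])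
    have "s\<^sup>2 = z\<^sup>2 * (s / z)\<^sup>2"
      using z by (simp add: power_divide)
    then have 2: "S\<^sup>2 = fps_const (z\<^sup>2 * (s / z)\<^sup>2)"
      by (simp add: S_def fps_const_power)
    show ?thesis
      unfolding qf id 1 2 sum2 ..
  qed
  have overpE: "over pE"
  proof (rule over_quotient[OF pE])
    show "over ((1 - fps_X\<^sup>2) * ft * (D * (P * fps_X\<^sup>2 - Pi)))"
      by (intro over overDf overP overPi tK)
    show "over (qf B1 * qf B2)"
      unfolding qq by (intro over overP overPi overN z(2) mult_in[OF z(2) hc(1)] mult_in[OF z(2) power_in[OF hc(1)]])
    have "(qf B1 * qf B2) $ 0 = (Pi $ 0)\<^sup>2"
      by (simp add: qf Pi_def fps_mult_nth_0 fps_power_zeroth power_mult_distrib)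
    then show "(qf B1 * qf B2) $ 0 \<noteq> 0"
      by (simp add: Pi0)
  qed
  define Es where "Es = (\<lambda>k j. fl (sym_part k j) - Us k j)"
  have Es_diag: "Es 0 j \<in> K" for j
  proof -
    have "fps_const fls_X * (fps_X * Abs_fps (Es 0)) = pE - 2"
    proof -
      have "Abs_fps (Es 0) = lift_coeffs sym_diagonal - HU"
        by (simp add: fps_eq_iff Es_def HU_def sym_diagonal_def fl_def)
      moreover have "Lp = 2 + ft * (fps_X * lift_coeffs sym_diagonal)"
        by (simp only: Lp_def pp_def lifts mult.assoc)
      ultimately show ?thesis
        by (simp add: pE_def right_diff_distrib mult.assoc)
    qed
    moreover have "over (pE - 2)"
      by (intro over overpE)
    ultimately have "over (fps_const fls_X * (fps_X * Abs_fps (Es 0)))"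
      by (simp only:)
    then have "over (fps_X * Abs_fps (Es 0))"
      by (rule over_const_mult) (use tK in simp_all)
    then have "over (Abs_fps (Es 0))"
      by (rule over_X_mult)
    from overD[OF this, of j] show ?thesis by simp
  qed
  have tvK: "tinv \<in> K"
    unfolding tinv_def using tK by (rule inverse_in)
  have overu: "over u"
    unfolding u_def by (rule over_u1)
  have Es_row: "Es (Suc k) 0 \<in> K" for k
  proof -
    have 1: "2 * (1 + fps_X) * lift_coeffs sym_row = fps_const (2 * (tinv * tinv)) * u + No - fps_const (fl (sym_part 0 0))"
    proof -
      have "ft\<^sup>2 * (1 + fps_X) * lift_coeffs NN = 2 - n"
        by (simp add: n_def nn_def lifts)
      moreover have "fps_const (tinv * tinv) * ft\<^sup>2 = 1"
        by (simp add: power2_eq_square mult.assoc tinv tinv')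
      then have "lift_coeffs NN = (fps_const (tinv * tinv) * ft\<^sup>2) * ((1 + fps_X) * u) * lift_coeffs NN"
        by (simp only: u mult_1)
      then have "lift_coeffs NN = fps_const (tinv * tinv) * u * (ft\<^sup>2 * (1 + fps_X) * lift_coeffs NN)"
        by (simp only: mult_ac)
      ultimately have "lift_coeffs NN = fps_const (tinv * tinv) * u * (2 - n)"
        by (simp only:)
      also have "\<dots> = fps_const (2 * (tinv * tinv)) * u + No"
      proof -
        have "k * u * (2 - n) = 2 * k * u + - (k * (n * u))" for k u n :: "'x::comm_ring_1"
          by (simp add: algebra_simps)
        note this[of "fps_const (tinv * tinv)" u n]
        moreover have "No = - (fps_const (tinv * tinv) * (n * u))"
          by (simp add: No_def fps_eq_iff)
        moreover have "fps_const (2 * (tinv * tinv)) = 2 * fps_const (tinv * tinv)"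
          by (simp add: numeral_fps_const)
        ultimately show ?thesis by (simp only:)
      qed
      finally show ?thesis
        by (simp add: NN_def lifts fl_def algebra_simps)
    qed
    have 2: "2 * (1 + fps_X) * Abs_fps ls = No - fps_const (ps 0)"
    proof -
      have "Abs_fps ls = fps_const (inverse 2) * (No - fps_const (ps 0)) * u"
        by (simp add: ls_def ps0 fps_eq_iff mult.assoc)
      then have 1: "2 * (1 + fps_X) * Abs_fps ls = ((1 + fps_X) * u) * ((2 * fps_const (inverse 2)) * (No - fps_const (ps 0)))"
        by (simp only: mult_ac)
      have "2 * fps_const (inverse 2) = (1 :: rat fls fps)"
        by (simp add: numeral_fps_const)
      then show ?thesis
        unfolding 1 u by (simp only: mult_1)
    qed
    have Us00: "Us 0 0 = ps 0"
      using wedge_0[where e = 1 and p = ps and l = ls and j = 0, OF e1] wedge_row[where e = 1 and p = ps and k = 0, OF e1] by (simp add: Us_def)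
    have 3: "Abs_fps (\<lambda>k. Es (Suc k) 0) = lift_coeffs sym_row - Abs_fps ls"
      by (simp add: fps_eq_iff Es_def sym_row_def fl_def Us_row)
    have 4: "fps_const (Es 0 0) = fps_const (fl (sym_part 0 0)) - fps_const (ps 0)"
      by (simp add: Es_def Us00)
    have "(x - y) * (2 * (1 + q)) = 2 * (1 + q) * x - 2 * (1 + q) * y" for x y q :: "'x::comm_ring_1"
      by (simp add: algebra_simps)
    note 5 = this[of "lift_coeffs sym_row" "Abs_fps ls" fps_X, unfolded 3[symmetric] 1 2]
    have "x + n - f - (n - p) = x - (f - p)" for x n f p :: "'x::comm_ring_1"
      by simp
    then have "Abs_fps (\<lambda>k. Es (Suc k) 0) * (2 * (1 + fps_X)) = fps_const (2 * (tinv * tinv)) * u - fps_const (Es 0 0)"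
      unfolding 4 5 .
    then have "over (Abs_fps (\<lambda>k. Es (Suc k) 0))"
    proof (rule over_quotient)
      show "over (fps_const (2 * (tinv * tinv)) * u - fps_const (Es 0 0))"
        by (intro over overu Es_diag mult_in numeral_in tvK)
      show "over (2 * (1 + fps_X))"
        by (intro over)
    qed (simp add: fps_mult_nth_0)
    from overD[OF this, of k] show ?thesis by simp
  qed
  have Es_col: "Es 1 j \<in> K" for j
  proof (cases j)
    case 0
    then show ?thesis using Es_row[of 0] by simp
  next
    case (Suc m)
    have "(2 * fls_X) * Es 1 (Suc m) = Es 0 m - (if m = 0 then 2 else 0)
      - fls_X * (Es 0 (Suc m) + (if m = 0 then 0 else Es 0 (m-1)))"
      using fl_parts_rec(3)[of m] Us_diag[of m] by (simp add: Es_def algebra_simps)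
    moreover have "Es 0 m - (if m = 0 then 2 else 0)
      - fls_X * (Es 0 (Suc m) + (if m = 0 then 0 else Es 0 (m-1))) \<in> K"
      using Es_diag tK by (simp add: closed)
    ultimately have "(2 * fls_X) * Es 1 (Suc m) \<in> K"
      by (simp only:)
    then have "Es 1 (Suc m) \<in> K"
      by (rule cancel_in) (use tK in \<open>auto intro!: closed\<close>)
    then show ?thesis by (simp add: Suc)
  qed
  have "Es k j \<in> K" for k j
  proof (rule half_plane_in[of Es "\<lambda>k j. if k = 0 \<and> j = 0 then 1 else 0" fls_X])
    show "Es (Suc k) j = (if k = 0 \<and> j = 0 then 1 else 0) + fls_X * (Es (Suc k) (Suc j) + Es (Suc (Suc k)) (Suc j)
      + (if j = 0 then 0 else Es (Suc k) (j - 1) + Es k (j - 1)))" for k j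
      using fl_parts_rec(2)[of k j] Us_rec[of k j] by (simp add: Es_def algebra_simps)
    show "Es k 0 \<in> K" for k
      using Es_diag Es_row by (cases k) auto
  qed (use tK Es_diag Es_col in \<open>auto intro: closed\<close>)
  from this[of "Suc k" "2 * k + 1"] show "fl (sym_part (Suc k) (2 * k + 1)) \<in> K"
    using Us_line[of k] by (simp add: Es_def)

  \<comment> \<open>the antisymmetric part\<close>
  define pa where "pa = (\<lambda>m. (fps_const (- (inverse 2 * (tinv * tinv))) * (V * u)) $ m)"
  define la where "la = (\<lambda>m. (fps_const (tinv * tinv) * ((fps_const (e * inverse 2) - V) * u)) $ m)"
  define Ua where "Ua = (\<lambda>k j. vanishing (-1) pa la (int j - 2 * int k) j)"
  have pa0: "pa 0 = 0"
    by (simp add: pa_def V fps_mult_nth_0)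
  have e2: "(-1 :: rat fls) * -1 = 1" "-1 * pa 0 = pa 0" by (simp_all add: pa0)
  have Ua_rec: "Ua (Suc k) j = fls_X * (Ua (Suc k) (Suc j) + Ua (Suc (Suc k)) (Suc j) +
    (if j = 0 then 0 else Ua (Suc k) (j - 1) + Ua k (j - 1)))" for k j
    unfolding Ua_def by (rule U_rec[where e = "-1" and p = pa and l = la, OF e2])
  have Ua_row: "Ua (Suc k) 0 = la k" for k
    unfolding Ua_def by (rule U_row[where e = "-1" and p = pa and l = la, OF e2])
  have Ua_line: "Ua (Suc k) (2 * k + 1) = 0" for k
    unfolding Ua_def by (rule U_line[where e = "-1" and p = pa and l = la, OF e2])
  have Ua_diag: "Ua 0 j = 0" for j
    using quad_part_swap[where e = "-1" and p = pa and i = j and j = j, OF e2] U_diagonal[where e = "-1" and p = pa and l = la and j = j, OF e2]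
    by (simp add: Ua_def)
  define MU where "MU = Abs_fps (\<lambda>j. if j = 0 then 0 else Ua 1 j)"
  have MU: "MU = fps_const (- (inverse 2 * (tinv * tinv))) * Vt"
  proof -
    define W1 where "W1 = Abs_fps (wedge (-1) pa 1)"
    have "Abs_fps (Ua 0) = 0"
      by (simp add: fps_eq_iff Ua_diag)
    then have "a * (1 + a) * (Abs_fps pa oo a) = fps_const (-1) * (a * fps_X\<^sup>2 * W1)"
      using wedge_kernel[where e = "-1" and p = pa and l = la, OF e2 a0 a_eq] by (simp add: W1_def Ua_def)
    moreover have "fps_const (-1) = (-1 :: rat fls fps)"
      by simp
    ultimately have "a * ((1 + a) * (Abs_fps pa oo a)) = a * (- (fps_X\<^sup>2 * W1))"
      by (simp only: mult.assoc mult_minus1 mult_minus_right)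
    moreover have "a \<noteq> 0"
      using r0 by (auto simp: a_def)
    ultimately have 1: "(1 + a) * (Abs_fps pa oo a) = - (fps_X\<^sup>2 * W1)"
      using mult_left_cancel by blast
    have "Abs_fps pa = fps_const (- (inverse 2 * (tinv * tinv))) * (V * u)"
      by (simp add: pa_def fps_eq_iff)
    then have "(1 + fps_X) * Abs_fps pa = ((1 + fps_X) * u) * (fps_const (- (inverse 2 * (tinv * tinv))) * V)"
      by (simp only: mult_ac)
    then have "(1 + fps_X) * Abs_fps pa = fps_const (- (inverse 2 * (tinv * tinv))) * V"
      unfolding u by simp
    from arg_cong[OF this, of "\<lambda>F. F oo a"]
    have 2: "(1 + a) * (Abs_fps pa oo a) = fps_const (- (inverse 2 * (tinv * tinv))) * Vt"
      by (simp only: comps Vt)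
    note col = U_col[where e = "-1" and p = pa and l = la, OF e2]
    have "MU = - (fps_X\<^sup>2 * W1)"
    proof (rule fps_ext)
      fix m
      show "MU $ m = (- (fps_X\<^sup>2 * W1)) $ m"
        using col(1)[of "m - 2"] col(2)
        by (cases m; cases "m - 1") (simp_all add: MU_def W1_def Ua_def power2_eq_square mult.assoc)
    qed
    then show ?thesis using 1 2 by simp
  qed
  define tg where "tg = fls_X\<^sup>2 * fl gam"
  have tg: "2 * tg = e - 1"
    by (simp add: tg_def e_def ee_def fl_homs)
  define Ea where "Ea = (\<lambda>k j. fl (anti_part k j) - Ua k j)"
  have Ea_diag: "Ea 0 j = 0" for j
    by (simp add: Ea_def Ua_diag anti_part_0 fl_homs)
  have Ea_row: "Ea (Suc k) 0 \<in> K" for k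
  proof -
    have 1: "fps_const (fls_X\<^sup>2) * (1 + fps_X) * lift_coeffs anti_row = fps_X * u + fps_const tg - V"
      unfolding V_def VV_def ax_def
      by (simp add: lifts u_def tg_def fl_def fps_const_power[symmetric] fps_const_mult[symmetric] del: fps_const_mult fps_const_power)
    have 2: "fps_const (fls_X\<^sup>2) * (1 + fps_X) * Abs_fps la = fps_const (e * inverse 2) - V"
    proof -
      have "Abs_fps la = fps_const (tinv * tinv) * (fps_const (e * inverse 2) - V) * u"
        by (simp add: la_def fps_eq_iff mult.assoc)
      then have "fps_const (fls_X\<^sup>2) * (1 + fps_X) * Abs_fps la =
         (fps_const (fls_X\<^sup>2) * fps_const (tinv * tinv)) * ((1 + fps_X) * u) * (fps_const (e * inverse 2) - V)"
        by (simp only: mult_ac)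
      moreover have "fps_const (fls_X\<^sup>2) * fps_const (tinv * tinv) = 1"
        by (simp add: power2_eq_square mult.assoc tinv tinv')
      ultimately show ?thesis
        unfolding u by simp
    qed
    have h: "tg - e * inverse 2 = - inverse 2"
      using tg by (simp add: field_simps)
    have 3: "Abs_fps (\<lambda>k. Ea (Suc k) 0) = lift_coeffs anti_row - Abs_fps la"
      by (simp add: fps_eq_iff Ea_def anti_row_def fl_def Ua_row)
    have 4: "fps_const (tg - e * inverse 2) = fps_const tg - fps_const (e * inverse 2)"
      by simp
    have "(x - y) * (w * (1 + q)) = w * (1 + q) * x - w * (1 + q) * y" for x y w q :: "'x::comm_ring_1"
      by (simp add: algebra_simps)
    note 5 = this[of "lift_coeffs anti_row" "Abs_fps la" "fps_const (fls_X\<^sup>2)" fps_X, unfolded 3[symmetric] 1 2]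
    have "x + p - w - (q - w) = x + (p - q)" for x p w q :: "'x::comm_ring_1"
      by simp
    then have "Abs_fps (\<lambda>k. Ea (Suc k) 0) * (fps_const (fls_X\<^sup>2) * (1 + fps_X)) = fps_X * u + fps_const (tg - e * inverse 2)"
      unfolding 4 5 .
    then have "over (Abs_fps (\<lambda>k. Ea (Suc k) 0))"
    proof (rule over_quotient)
      show "over (fps_X * u + fps_const (tg - e * inverse 2))"
        unfolding h by (intro over overu uminus_in inverse_in numeral_in)
      show "over (fps_const (fls_X\<^sup>2) * (1 + fps_X))"
        by (intro over power_in tK)
    qed (simp add: fps_mult_nth_0)
    from overD[OF this, of k] show ?thesis by simp
  qed
  have Ea_col: "Ea 1 j \<in> K" for j
  proof (cases j)
    case 0
    then show ?thesis using Ea_row[of 0] by simp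
  next
    case (Suc m)
    define M where "M = Abs_fps (\<lambda>j. if j = 0 then 0 else Ea 1 j)"
    have "M = lift_coeffs anti_col - MU"
      by (simp add: fps_eq_iff M_def MU_def Ea_def anti_col_def fl_def)
    moreover have "fps_const (2 * fls_X\<^sup>2) * (fps_X * lift_coeffs anti_col) = 2 * B1 - 2 * ft - fps_const (2 * tg) * fps_X"
      unfolding B1_def BB_def bx_def
      by (simp add: lifts tg_def fl_def algebra_simps power2_eq_square numeral_fps_const fps_const_mult[symmetric] del: fps_const_mult)
    moreover have "fps_const (2 * fls_X\<^sup>2) * (fps_X * MU) = - B3"
    proof -
      have "2 * fls_X\<^sup>2 * (inverse 2 * (tinv * tinv)) = 1"
        by (simp add: power2_eq_square mult.assoc tinv tinv' mult.left_commute[of _ fls_X])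
      moreover have "fps_const x * fps_const (- w) = (-1 :: rat fls fps)" if "x * w = 1" for x w :: "rat fls"
        using that by simp
      ultimately have "fps_const (2 * fls_X\<^sup>2) * fps_const (- (inverse 2 * (tinv * tinv))) = -1"
        by blast
      moreover have "fps_const (2 * fls_X\<^sup>2) * (fps_X * MU) =
         (fps_const (2 * fls_X\<^sup>2) * fps_const (- (inverse 2 * (tinv * tinv)))) * (fps_X * Vt)"
        unfolding MU by (simp only: mult_ac)
      ultimately show ?thesis
        by (simp only: B3_def mult_minus1)
    qed
    ultimately have "fps_const (2 * fls_X\<^sup>2) * (fps_X * M) = 2 * B1 - 2 * ft - fps_const (2 * tg) * fps_X + B3"
      by (simp add: right_diff_distrib)
    also have "\<dots> = D - 2 * ft + fps_X"
      unfolding tg D_def B2_def E_def by (simp add: algebra_simps fps_const_sub[symmetric] del: fps_const_sub)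
    finally have "fps_const (2 * fls_X\<^sup>2) * (fps_X * M) = D - 2 * ft + fps_X" .
    moreover have "over (D - 2 * ft + fps_X)"
      by (intro over overDf tK)
    ultimately have "over (fps_const (2 * fls_X\<^sup>2) * (fps_X * M))"
      by (simp only:)
    then have "over (fps_X * M)"
      by (rule over_const_mult) (use tK in \<open>simp_all add: closed\<close>)
    then have "over M"
      by (rule over_X_mult)
    from overD[OF this, of j] show ?thesis by (simp add: M_def Suc)
  qed
  have "Ea k j \<in> K" for k j
  proof (rule half_plane_in[of Ea "\<lambda>k j. if k = 0 \<and> j = 0 then 1 else 0" fls_X])
    show "Ea (Suc k) j = (if k = 0 \<and> j = 0 then 1 else 0) + fls_X * (Ea (Suc k) (Suc j) + Ea (Suc (Suc k)) (Suc j)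
      + (if j = 0 then 0 else Ea (Suc k) (j - 1) + Ea k (j - 1)))" for k j
      using fl_parts_rec(1)[of k j] Ua_rec[of k j] by (simp add: Ea_def algebra_simps)
    show "Ea k 0 \<in> K" for k
      using Ea_diag Ea_row by (cases k) (auto intro: closed)
  qed (use tK Ea_diag Ea_col in \<open>auto intro: closed\<close>)
  from this[of "Suc k" "2 * k + 1"] show "fl (anti_part (Suc k) (2 * k + 1)) \<in> K"
    using Ua_line[of k] by (simp add: Ea_def)
qed

end

section \<open>Finite-dimensional spaces over \<open>\<rat>(t)\<close>\<close>

context subfield_set
begin

definition spn :: "('i \<Rightarrow> 'a) \<Rightarrow> 'i set \<Rightarrow> 'a set" where
  "spn e B = {\<Sum>b\<in>B. c b * e b | c. \<forall>b. c b \<in> K}"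

lemma spnI: "(\<And>b. c b \<in> K) \<Longrightarrow> (\<Sum>b\<in>B. c b * e b) \<in> spn e B"
  unfolding spn_def by blast

lemma spnE:
  assumes "x \<in> spn e B"
  obtains c where "x = (\<Sum>b\<in>B. c b * e b)" "\<And>b. c b \<in> K"
  using assms unfolding spn_def by blast

lemma spn_zero: "0 \<in> spn e B"
  using spnI[of "\<lambda>_. 0" e B] zero_in by simp

lemma spn_add: "x \<in> spn e B \<Longrightarrow> y \<in> spn e B \<Longrightarrow> x + y \<in> spn e B"
proof (elim spnE)
  fix c d assume "x = (\<Sum>b\<in>B. c b * e b)" "y = (\<Sum>b\<in>B. d b * e b)" "\<And>b. c b \<in> K" "\<And>b. d b \<in> K"
  then show "x + y \<in> spn e B"
    using spnI[of "\<lambda>b. c b + d b" e B] by (simp add: add_in sum.distrib distrib_right)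
qed

lemma spn_scale: "k \<in> K \<Longrightarrow> x \<in> spn e B \<Longrightarrow> k * x \<in> spn e B"
proof (elim spnE)
  fix c assume "k \<in> K" "x = (\<Sum>b\<in>B. c b * e b)" "\<And>b. c b \<in> K"
  then show "k * x \<in> spn e B"
    using spnI[of "\<lambda>b. k * c b" e B] by (simp add: mult_in sum_distrib_left mult.assoc)
qed

lemma spn_sum: "(\<And>i. i \<in> S \<Longrightarrow> f i \<in> spn e B) \<Longrightarrow> sum f S \<in> spn e B"
  by (induction S rule: infinite_finite_induct) (auto intro: spn_zero spn_add)

lemma spn_base: "finite B \<Longrightarrow> b \<in> B \<Longrightarrow> e b \<in> spn e B"
  using spnI[of "\<lambda>i. if i = b then 1 else 0" e B]
  by (simp add: zero_in one_in if_distrib[of "\<lambda>x. x * _"] sum.delta cong: if_cong)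

lemma spn_uminus: "x \<in> spn e B \<Longrightarrow> - x \<in> spn e B"
  using spn_scale[of "- 1" x e B] uminus_in[OF one_in] by simp

lemma spn_mult:
  assumes "finite B" "\<And>b b'. b \<in> B \<Longrightarrow> b' \<in> B \<Longrightarrow> e b * e b' \<in> spn e B" "x \<in> spn e B" "y \<in> spn e B"
  shows "x * y \<in> spn e B"
proof -
  obtain c d where x: "x = (\<Sum>b\<in>B. c b * e b)" "\<And>b. c b \<in> K" and y: "y = (\<Sum>b\<in>B. d b * e b)" "\<And>b. d b \<in> K"
    using assms(3,4) by (elim spnE) blast
  have "x * y = (\<Sum>b\<in>B. \<Sum>b'\<in>B. (c b * d b') * (e b * e b'))"
    unfolding x y by (simp add: sum_product mult_ac)
  also have "\<dots> \<in> spn e B"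
    using x y by (intro spn_sum spn_scale mult_in assms(2)) auto
  finally show ?thesis .
qed

text \<open>More vectors than generators are linearly dependent.\<close>

lemma dependent:
  assumes "finite B" "finite S" "card B < card S" "\<And>s. s \<in> S \<Longrightarrow> v s \<in> spn e B"
  shows "\<exists>d. (\<forall>s. d s \<in> K) \<and> (\<exists>s\<in>S. d s \<noteq> 0) \<and> (\<Sum>s\<in>S. d s * v s) = 0"
  using assms
proof (induction B arbitrary: S v rule: finite_induct)
  case empty
  then obtain s where "s \<in> S" by fastforce
  moreover have "v s = 0" if "s \<in> S" for s
    using empty(3)[OF that] by (auto simp: spn_def)
  ultimately show ?case
    by (intro exI[of _ "\<lambda>_. 1"]) (auto simp: one_in)
next
  case (insert b B)
  have "\<exists>a w. a \<in> K \<and> w \<in> spn e B \<and> v s = a * e b + w" if s: "s \<in> S" for s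
  proof -
    obtain c where "v s = (\<Sum>b\<in>insert b B. c b * e b)" "\<And>b. c b \<in> K"
      using insert.prems(3)[OF s] by (elim spnE) blast
    then show ?thesis
      using insert.hyps spnI[of c e B] by (intro exI[of _ "c b"] exI[of _ "\<Sum>b\<in>B. c b * e b"]) simp
  qed
  then obtain a w where aw: "\<And>s. s \<in> S \<Longrightarrow> a s \<in> K" "\<And>s. s \<in> S \<Longrightarrow> w s \<in> spn e B" "\<And>s. s \<in> S \<Longrightarrow> v s = a s * e b + w s"
    by metis
  show ?case
  proof (cases "\<forall>s\<in>S. a s = 0")
    case True
    have "card B < card S"
      using insert by simp
    then show ?thesis
      using insert.IH[of S v] insert.prems(1) aw True by simp
  next
    case False
    then obtain p where p: "p \<in> S" "a p \<noteq> 0" by blast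
    define v' where "v' = (\<lambda>s. v s - a s / a p * v p)"
    have v': "v' s \<in> spn e B" if "s \<in> S - {p}" for s
    proof -
      have s: "s \<in> S" using that by simp
      have "v' s = w s + (- (a s / a p)) * w p"
        using p unfolding v'_def aw(3)[OF s] aw(3)[OF p(1)] by (simp add: field_simps)
      then show ?thesis
        using aw s p by (simp only:) (intro spn_add spn_scale uminus_in divide_in; simp)
    qed
    have "card B < card (S - {p})"
      using insert p by simp
    then obtain d where d: "\<forall>s. d s \<in> K" "\<exists>s\<in>S - {p}. d s \<noteq> 0" "(\<Sum>s\<in>S - {p}. d s * v' s) = 0"
      using insert.IH[of "S - {p}" v'] insert.prems(1) v' by auto
    define q where "q = - (\<Sum>s\<in>S - {p}. d s * (a s / a p))"
    have "(\<Sum>s\<in>S. (d(p := q)) s * v s) = q * v p + (\<Sum>s\<in>S - {p}. d s * v s)"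
      using insert.prems(1) p by (subst sum.remove[of S p]) (auto intro!: sum.cong)
    also have "\<dots> = (\<Sum>s\<in>S - {p}. d s * v' s)"
      by (simp add: q_def v'_def right_diff_distrib sum_subtractf sum_distrib_right mult.assoc)
    finally have "(\<Sum>s\<in>S. (d(p := q)) s * v s) = 0"
      using d(3) by simp
    moreover have "q \<in> K"
      unfolding q_def using d(1) aw p by (intro uminus_in sum_in mult_in divide_in) auto
    then have "\<forall>s. (d(p := q)) s \<in> K"
      using d(1) by simp
    moreover have "\<exists>s\<in>S. (d(p := q)) s \<noteq> 0"
      using d(2) by auto
    ultimately show ?thesis by blast
  qed
qed

text \<open>The generators are indexed by pairs of numbers, because two algebraic elements \<open>f\<close>, \<open>g\<close> give the generators
  \<open>f ^ i * g ^ j\<close>.\<close>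

definition finite_ring :: "'a set \<Rightarrow> bool" where
  "finite_ring R \<longleftrightarrow> (\<exists>(e :: nat \<times> nat \<Rightarrow> 'a) B. finite B \<and> R = spn e B) \<and> 1 \<in> R \<and> (\<forall>x\<in>R. \<forall>y\<in>R. x * y \<in> R)"

lemma finite_ring_power: "finite_ring R \<Longrightarrow> x \<in> R \<Longrightarrow> x ^ n \<in> R"
  by (induction n) (auto simp: finite_ring_def)

lemma finite_ring_relation:
  assumes "finite_ring R" "x \<in> R"
  obtains n d where "\<And>k. d k \<in> K" "\<exists>k\<le>n. d k \<noteq> 0" "(\<Sum>k\<le>(n::nat). d k * x ^ k) = 0"
proof -
  obtain e :: "nat \<times> nat \<Rightarrow> 'a" and B where B: "finite B" "R = spn e B"
    using assms(1) unfolding finite_ring_def by blast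
  then have "\<exists>d. (\<forall>s. d s \<in> K) \<and> (\<exists>s\<in>{..card B}. d s \<noteq> 0) \<and> (\<Sum>s\<in>{..card B}. d s * x ^ s) = 0"
    using finite_ring_power[OF assms] by (intro dependent) auto
  then show ?thesis using that by auto
qed

lemma finite_ring_subset:
  assumes "finite_ring R" "k \<in> K"
  shows "k \<in> R"
  using assms spn_scale[of k 1] unfolding finite_ring_def by auto

text \<open>A linear relation between powers of \<open>x\<close>, divided by its lowest term, expresses \<open>inverse x\<close>.\<close>

lemma finite_ring_inverse:
  assumes R: "finite_ring R" and x: "x \<in> R"
  shows "inverse x \<in> R"
proof (cases "x = 0")
  case False
  obtain n d where d: "\<And>k. d k \<in> K" "\<exists>k\<le>n. d k \<noteq> 0" "(\<Sum>k\<le>n. d k * x ^ k) = 0"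
    by (rule finite_ring_relation[OF R x]) blast
  define m where "m = (LEAST k. d k \<noteq> 0)"
  obtain k0 where k0: "k0 \<le> n" "d k0 \<noteq> 0"
    using d(2) by blast
  have m: "d m \<noteq> 0" "\<And>k. k < m \<Longrightarrow> d k = 0"
    unfolding m_def using LeastI[of "\<lambda>k. d k \<noteq> 0", OF k0(2)] by (auto dest: not_less_Least)
  have "m \<le> k0"
    unfolding m_def using k0(2) by (rule Least_le)
  with k0(1) have mn: "m \<le> n" by simp
  have "(\<Sum>k\<le>n. d k * x ^ k) = (\<Sum>k\<in>{m..n}. d k * x ^ k)"
    by (intro sum.mono_neutral_right) (auto simp: m(2))
  also have "\<dots> = d m * x ^ m + (\<Sum>k\<in>{Suc m..n}. d k * x ^ k)"
    using mn by (simp add: sum.atLeast_Suc_atMost)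
  also have "(\<Sum>k\<in>{Suc m..n}. d k * x ^ k) = x ^ m * (x * (\<Sum>k\<in>{Suc m..n}. d k * x ^ (k - Suc m)))"
    unfolding sum_distrib_left
  proof (intro sum.cong refl)
    fix k assume "k \<in> {Suc m..n}"
    then have "k = m + Suc (k - Suc m)" by simp
    then have "x ^ k = x ^ m * (x * x ^ (k - Suc m))"
      by (metis power_Suc power_add)
    then show "d k * x ^ k = x ^ m * (x * (d k * x ^ (k - Suc m)))"
      by simp
  qed
  finally have "x ^ m * (d m + x * (\<Sum>k\<in>{Suc m..n}. d k * x ^ (k - Suc m))) = 0"
    using d(3) by (simp add: algebra_simps)
  with False have e: "d m + x * (\<Sum>k\<in>{Suc m..n}. d k * x ^ (k - Suc m)) = 0"
    by simp
  then have "inverse x = (- inverse (d m)) * (\<Sum>k\<in>{Suc m..n}. d k * x ^ (k - Suc m))"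
    using False m(1) by (simp add: field_simps eq_neg_iff_add_eq_0)
  moreover have "(\<Sum>k\<in>{Suc m..n}. d k * x ^ (k - Suc m)) \<in> R"
  proof -
    obtain e :: "nat \<times> nat \<Rightarrow> 'a" and B where B: "finite B" "R = spn e B"
      using R unfolding finite_ring_def by blast
    show ?thesis
      using finite_ring_power[OF R x] d(1) unfolding B by (intro spn_sum spn_scale) auto
  qed
  moreover have "- inverse (d m) \<in> R"
    using d(1) by (intro finite_ring_subset[OF R] uminus_in inverse_in)
  ultimately show ?thesis
    using R unfolding finite_ring_def by (simp only:)
qed (use finite_ring_subset[OF R zero_in] in simp)

definition polyK :: "'a poly \<Rightarrow> bool" where "polyK p \<longleftrightarrow> (\<forall>k. coeff p k \<in> K)"

definition algebraic_over :: "'a \<Rightarrow> bool" where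
  "algebraic_over f \<longleftrightarrow> (\<exists>p. p \<noteq> 0 \<and> polyK p \<and> poly p f = 0)"

lemma algebraic_over_finite_ring:
  assumes "finite_ring R" "x \<in> R"
  shows "algebraic_over x"
proof -
  obtain n d where d: "\<And>k. d k \<in> K" "\<exists>k\<le>n. d k \<noteq> 0" "(\<Sum>k\<le>n. d k * x ^ k) = 0"
    by (rule finite_ring_relation[OF assms]) blast
  define p where "p = (\<Sum>k\<le>n. monom (d k) k)"
  have c: "coeff p k = (if k \<le> n then d k else 0)" for k
    by (simp add: p_def coeff_sum)
  have "p \<noteq> 0"
    using d(2) c by (metis coeff_0)
  moreover have "polyK p"
    using d(1) by (simp add: polyK_def c zero_in)
  moreover have "poly p x = 0"
    using d(3) by (simp add: p_def poly_sum poly_monom)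
  ultimately show ?thesis unfolding algebraic_over_def by blast
qed

text \<open>The powers of an algebraic element below the degree of an equation span all powers.\<close>

lemma algebraic_powers:
  assumes p: "p \<noteq> 0" "polyK p" "poly p f = 0"
  shows "0 < degree p" "f ^ m \<in> spn (\<lambda>i. f ^ i) {..<degree p}"
proof -
  show deg: "0 < degree p"
  proof (rule ccontr)
    assume "\<not> 0 < degree p"
    then obtain c where "p = [:c:]" by (metis degree_eq_zeroE neq0_conv)
    then show False using p by simp
  qed
  define n where "n = degree p"
  define l where "l = lead_coeff p"
  have l: "l \<in> K" "l \<noteq> 0"
    using p by (auto simp: l_def polyK_def)
  have "(\<Sum>i<n. coeff p i * f ^ i) + l * f ^ n = 0"
    using p(3) by (simp add: poly_altdef n_def l_def lessThan_Suc_atMost[symmetric])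
  then have "l * f ^ n = - (\<Sum>i<n. coeff p i * f ^ i)"
    by (simp add: eq_neg_iff_add_eq_0 add.commute)
  then have "f ^ n = - inverse l * (\<Sum>i<n. coeff p i * f ^ i)"
    using l(2) by (simp add: field_simps)
  then have top: "f ^ n = (\<Sum>i<n. (- inverse l * coeff p i) * f ^ i)"
    unfolding sum_distrib_left mult.assoc .
  have topin: "f ^ n \<in> spn (\<lambda>i. f ^ i) {..<n}"
    unfolding top using p(2) l by (intro spnI mult_in uminus_in inverse_in) (auto simp: polyK_def)
  have step: "f * x \<in> spn (\<lambda>i. f ^ i) {..<n}" if x: "x \<in> spn (\<lambda>i. f ^ i) {..<n}" for x
  proof -
    obtain c where c: "x = (\<Sum>i<n. c i * f ^ i)" "\<And>i. c i \<in> K"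
      using x by (elim spnE) blast
    have "f * x = (\<Sum>i<n. c i * f ^ Suc i)"
      by (simp add: c sum_distrib_left mult_ac)
    moreover have "f ^ Suc i \<in> spn (\<lambda>i. f ^ i) {..<n}" if "i < n" for i
    proof (cases "Suc i = n")
      case True
      then show ?thesis using topin by simp
    next
      case False
      with that show ?thesis by (intro spn_base) auto
    qed
    ultimately show ?thesis
      using c(2) by (auto intro!: spn_sum spn_scale simp del: power_Suc)
  qed
  show "f ^ m \<in> spn (\<lambda>i. f ^ i) {..<degree p}"
  proof (induction m)
    case 0
    show ?case using deg spn_base[of "{..<degree p}" 0 "\<lambda>i. f ^ i"] by simp
  next
    case (Suc m)
    then show ?case using step by (simp add: n_def)
  qed
qed

lemma spn_reindex:
  assumes "inj_on g B"
  shows "spn (\<lambda>b. e (g b)) B = spn e (g ` B)"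
proof (intro equalityI subsetI)
  fix x assume "x \<in> spn (\<lambda>b. e (g b)) B"
  then obtain c where c: "x = (\<Sum>b\<in>B. c b * e (g b))" "\<And>b. c b \<in> K" by (elim spnE) blast
  have "x = (\<Sum>b\<in>g ` B. c (the_inv_into B g b) * e b)"
    by (simp add: c sum.reindex[OF assms] the_inv_into_f_f[OF assms])
  then show "x \<in> spn e (g ` B)"
    using spnI[of "\<lambda>b. c (the_inv_into B g b)" e "g ` B"] c(2) by simp
next
  fix x assume "x \<in> spn e (g ` B)"
  then obtain c where c: "x = (\<Sum>b\<in>g ` B. c b * e b)" "\<And>b. c b \<in> K" by (elim spnE) blast
  then show "x \<in> spn (\<lambda>b. e (g b)) B"
    using spnI[of "\<lambda>b. c (g b)" "\<lambda>b. e (g b)" B] by (simp add: sum.reindex[OF assms])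
qed

lemma finite_ring_two:
  assumes "algebraic_over f" "algebraic_over g"
  obtains R where "finite_ring R" "f \<in> R" "g \<in> R"
proof -
  obtain p q where p: "p \<noteq> 0" "polyK p" "poly p f = 0" and q: "q \<noteq> 0" "polyK q" "poly q g = 0"
    using assms unfolding algebraic_over_def by blast
  define e :: "nat \<times> nat \<Rightarrow> 'a" where "e = (\<lambda>(i, j). f ^ i * g ^ j)"
  define B where "B = {..<degree p} \<times> {..<degree q}"
  define R where "R = spn e B"
  have finB: "finite B" by (simp add: B_def)
  have fg: "f ^ i * g ^ j \<in> R" for i j
  proof -
    obtain c d where c: "f ^ i = (\<Sum>k<degree p. c k * f ^ k)" "\<And>k. c k \<in> K"
      and d: "g ^ j = (\<Sum>k<degree q. d k * g ^ k)" "\<And>k. d k \<in> K"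
      using algebraic_powers(2)[OF p, of i] algebraic_powers(2)[OF q, of j] by (elim spnE) blast
    have "f ^ i * g ^ j = (\<Sum>k<degree p. \<Sum>l<degree q. (c k * d l) * e (k, l))"
      unfolding c(1) d(1) sum_product by (simp add: e_def mult_ac)
    also have "\<dots> \<in> R"
      unfolding R_def using c d finB by (intro spn_sum spn_scale mult_in spn_base) (auto simp: B_def)
    finally show ?thesis .
  qed
  have "finite_ring R"
    unfolding finite_ring_def
  proof (intro conjI ballI)
    show "\<exists>(e :: nat \<times> nat \<Rightarrow> 'a) B. finite B \<and> R = spn e B"
      using finB R_def by blast
    show "1 \<in> R"
      using fg[of 0 0] by simp
    fix x y assume "x \<in> R" "y \<in> R"
    then show "x * y \<in> R"
      unfolding R_def
    proof (rule spn_mult[OF finB, rotated])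
      fix b b' assume "b \<in> B" "b' \<in> B"
      have "e b * e b' = f ^ (fst b + fst b') * g ^ (snd b + snd b')"
        by (simp add: e_def split_def power_add mult_ac)
      then show "e b * e b' \<in> spn e B"
        using fg unfolding R_def by simp
    qed
  qed
  moreover have "f \<in> R" "g \<in> R"
    using fg[of 1 0] fg[of 0 1] by simp_all
  ultimately show ?thesis by (rule that)
qed

end

subsection \<open>Differential equations\<close>

abbreviation Qt :: "rat fls set" where "Qt \<equiv> rational_in fls_X"

lemma algebraic_series_iff: "algebraic_series f \<longleftrightarrow> rational_in.algebraic_over fls_X f"
  by (simp add: algebraic_series_def rational_in.algebraic_over_def rational_in.polyK_def)

lemma deriv_evalp: "fls_deriv (evalp p fls_X) = evalp (pderiv p) fls_X"
proof (induction p)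
  case (pCons a p)
  have "fls_deriv (fls_const a + fls_X * evalp p fls_X) = evalp p fls_X + fls_X * evalp (pderiv p) fls_X"
    using pCons by (simp add: fls_deriv_mult)
  then show ?case
    by (simp add: map_poly_fls_const_pCons pderiv_pCons evalp_add)
qed simp

lemma deriv_Qt: "r \<in> Qt \<Longrightarrow> fls_deriv r \<in> Qt"
proof (elim rational_inE)
  fix p q assume r: "r = evalp p fls_X / evalp q fls_X" and q: "evalp q fls_X \<noteq> 0"
  have in_Qt: "evalp p fls_X \<in> Qt" for p
    using rational_inI[of 1 fls_X p] by simp
  have rq: "r * evalp q fls_X = evalp p fls_X"
    using r q by simp
  have "fls_deriv r * evalp q fls_X = evalp (pderiv p) fls_X - r * evalp (pderiv q) fls_X"
    using arg_cong[OF rq, of fls_deriv] by (simp add: fls_deriv_mult deriv_evalp algebra_simps)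
  then have "fls_deriv r = (evalp (pderiv p) fls_X - r * evalp (pderiv q) fls_X) / evalp q fls_X"
    using q by (simp add: field_simps)
  then show "fls_deriv r \<in> Qt"
    using in_Qt r by (simp add: rational_in.closed)
qed

abbreviation "tspan \<equiv> rational_in.spn fls_X"

lemma deriv_tspan:
  assumes "finite B" "\<And>b. b \<in> B \<Longrightarrow> fls_deriv (e b) \<in> tspan e B" "x \<in> tspan e B"
  shows "fls_deriv x \<in> tspan e B"
proof -
  obtain c where c: "x = (\<Sum>b\<in>B. c b * e b)" "\<And>b. c b \<in> Qt"
    using assms(3) by (rule rational_in.spnE) blast
  have d: "fls_deriv (\<Sum>b\<in>S. g b) = (\<Sum>b\<in>S. fls_deriv (g b))" for g :: "_ \<Rightarrow> rat fls" and S
    by (induction S rule: infinite_finite_induct) auto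
  have "fls_deriv x = (\<Sum>b\<in>B. c b * fls_deriv (e b) + fls_deriv (c b) * e b)"
    unfolding c(1) d by (simp add: fls_deriv_mult)
  also have "\<dots> \<in> tspan e B"
    using assms(1,2) c(2) deriv_Qt
    by (intro rational_in.spn_sum rational_in.spn_add rational_in.spn_scale rational_in.spn_base) auto
  finally show ?thesis .
qed

text \<open>All derivatives stay in one finite-dimensional space, so finitely many of them are dependent.\<close>

lemma D_finite_if_closed:
  assumes "finite B" "\<And>b. b \<in> B \<Longrightarrow> fls_deriv (e b) \<in> tspan e B" "x \<in> tspan e B"
  shows "D_finite x"
proof -
  have "(fls_deriv ^^ k) x \<in> tspan e B" for k
    by (induction k) (auto intro: assms deriv_tspan)
  then have "\<exists>d. (\<forall>s. d s \<in> Qt) \<and> (\<exists>s\<in>{..card B}. d s \<noteq> 0) \<and> (\<Sum>s\<in>{..card B}. d s * (fls_deriv ^^ s) x) = 0"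
    using assms(1) by (intro rational_in.dependent) auto
  then show ?thesis
    unfolding D_finite_def by auto
qed

lemma D_finite_add:
  assumes "finite B" "\<And>b. b \<in> B \<Longrightarrow> fls_deriv (e b) \<in> tspan e B" "x \<in> tspan e B"
    and "finite B'" "\<And>b. b \<in> B' \<Longrightarrow> fls_deriv (e' b) \<in> tspan e' B'" "x' \<in> tspan e' B'"
  shows "D_finite (x + x')"
proof (rule D_finite_if_closed)
  define f where "f = case_sum e e'"
  have l: "y \<in> tspan f (B <+> B')" if "y \<in> tspan e B" for y
  proof -
    obtain c where c: "y = (\<Sum>b\<in>B. c b * e b)" "\<And>b. c b \<in> Qt"
      using \<open>y \<in> tspan e B\<close> by (rule rational_in.spnE) blast
    then show ?thesis
      using assms(1,4) rational_in.spn_base[of "B <+> B'" "Inl _" f]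
      by (auto simp: f_def intro!: rational_in.spn_sum rational_in.spn_scale)
  qed
  have r: "y \<in> tspan f (B <+> B')" if "y \<in> tspan e' B'" for y
  proof -
    obtain c where c: "y = (\<Sum>b\<in>B'. c b * e' b)" "\<And>b. c b \<in> Qt"
      using \<open>y \<in> tspan e' B'\<close> by (rule rational_in.spnE) blast
    then show ?thesis
      using assms(1,4) rational_in.spn_base[of "B <+> B'" "Inr _" f]
      by (auto simp: f_def intro!: rational_in.spn_sum rational_in.spn_scale)
  qed
  show "finite (B <+> B')"
    using assms by simp
  show "fls_deriv (f b) \<in> tspan f (B <+> B')" if "b \<in> B <+> B'" for b
    using that assms l r by (auto simp: f_def)
  show "x + x' \<in> tspan f (B <+> B')"
    using assms l r by (intro rational_in.spn_add) auto
qed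

lemma fls_deriv_poly:
  "fls_deriv (poly p f) = poly (map_poly fls_deriv p) f + poly (pderiv p) f * fls_deriv (f :: rat fls)"
  by (induction p) (simp_all add: map_poly_pCons pderiv_pCons fls_deriv_mult algebra_simps)

text \<open>An algebraic series generates a finite-dimensional ring which is closed under differentiation:
  the derivative of its minimal polynomial does not vanish at the series.\<close>

lemma algebraic_derivative_ring:
  assumes "algebraic_series f"
  obtains n where "rational_in.finite_ring fls_X (tspan (\<lambda>i. f ^ i) {..<n})" "f \<in> tspan (\<lambda>i. f ^ i) {..<n}"
    "\<And>x. x \<in> tspan (\<lambda>i. f ^ i) {..<n} \<Longrightarrow> fls_deriv x \<in> tspan (\<lambda>i. f ^ i) {..<n}"
proof -
  define good where "good = (\<lambda>p. p \<noteq> 0 \<and> rational_in.polyK fls_X p \<and> poly p f = 0)"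
  obtain p0 where "good p0"
    using assms unfolding algebraic_series_iff rational_in.algebraic_over_def good_def by blast
  define p where "p = arg_min degree good"
  have p: "good p" "\<And>q. good q \<Longrightarrow> degree p \<le> degree q"
    unfolding p_def using arg_min_nat_lemma[of good p0 degree, OF \<open>good p0\<close>] by auto
  then have p': "p \<noteq> 0" "rational_in.polyK fls_X p" "poly p f = 0"
    by (auto simp: good_def)
  define R where "R = tspan (\<lambda>i. f ^ i) {..<degree p}"
  note pw = rational_in.algebraic_powers[OF p', folded R_def]
  have fR: "f \<in> R"
    using pw(2)[of 1] by simp
  have ring: "rational_in.finite_ring fls_X R"
    unfolding rational_in.finite_ring_def
  proof (intro conjI ballI)
    have "R = tspan (\<lambda>b. (\<lambda>(i, j). f ^ i) ((\<lambda>i. (i, 0 :: nat)) b)) {..<degree p}"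
      by (simp add: R_def)
    also have "\<dots> = tspan (\<lambda>(i, j). f ^ i) ((\<lambda>i. (i, 0 :: nat)) ` {..<degree p})"
      by (rule rational_in.spn_reindex[where g = "\<lambda>i. (i, 0 :: nat)" and e = "\<lambda>(i, j). f ^ i"]) (simp add: inj_on_def)
    finally show "\<exists>(e :: nat \<times> nat \<Rightarrow> rat fls) B. finite B \<and> R = tspan e B"
      by blast
    show "1 \<in> R"
      using pw(2)[of 0] by simp
    fix x y assume "x \<in> R" "y \<in> R"
    then show "x * y \<in> R"
      unfolding R_def by (rule rational_in.spn_mult[rotated 2])
        (use pw(2) in \<open>auto simp: R_def simp flip: power_add\<close>)
  qed
  have polyR: "poly q f \<in> R" if "rational_in.polyK fls_X q" for q
    using that pw(2) unfolding poly_altdef R_def rational_in.polyK_def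
    by (intro rational_in.spn_sum rational_in.spn_scale) auto
  have "poly (pderiv p) f \<noteq> 0"
  proof
    assume z: "poly (pderiv p) f = 0"
    have "pderiv p \<noteq> 0"
      using pw(1) by (auto simp: pderiv_eq_0_iff)
    moreover have "rational_in.polyK fls_X (pderiv p)"
      using p'(2) by (simp add: rational_in.polyK_def coeff_pderiv) 
        (metis rational_in.mult_in rational_in.numeral_in of_nat_Suc const_rational_in fls_of_nat)
    ultimately have "degree p \<le> degree (pderiv p)"
      using z by (intro p(2)) (simp add: good_def)
    then show False
      using pw(1) by (simp add: degree_pderiv)
  qed
  moreover have "poly (map_poly fls_deriv p) f + poly (pderiv p) f * fls_deriv f = 0"
    using fls_deriv_poly[of p f] p'(3) by simp
  ultimately have f': "fls_deriv f = - poly (map_poly fls_deriv p) f * inverse (poly (pderiv p) f)"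
    by (simp add: field_simps eq_neg_iff_add_eq_0 add.commute)
  have mR: "x * y \<in> R" if "x \<in> R" "y \<in> R" for x y
    using ring that unfolding rational_in.finite_ring_def by blast
  have "rational_in.polyK fls_X (pderiv p)"
    using p'(2) by (simp add: rational_in.polyK_def coeff_pderiv)
      (metis rational_in.mult_in of_nat_Suc const_rational_in fls_of_nat)
  moreover have "rational_in.polyK fls_X (map_poly fls_deriv p)"
    using p'(2) deriv_Qt by (simp add: rational_in.polyK_def coeff_map_poly)
  ultimately have "- poly (map_poly fls_deriv p) f \<in> R" "inverse (poly (pderiv p) f) \<in> R"
    using rational_in.spn_uminus polyR rational_in.finite_ring_inverse[OF ring] unfolding R_def by blast+
  then have f'R: "fls_deriv f \<in> R"
    unfolding f' by (rule mR)
  have "fls_deriv x \<in> R" if "x \<in> R" for x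
    unfolding R_def
  proof (rule deriv_tspan)
    show "x \<in> tspan (\<lambda>i. f ^ i) {..<degree p}"
      using that by (simp add: R_def)
    fix i
    have "fls_deriv (f ^ i) \<in> R" for i
    proof (induction i)
      case 0
      then show ?case using rational_in.spn_zero by (simp add: R_def)
    next
      case (Suc i)
      then show ?case
        using mR[OF fR Suc] mR[OF f'R pw(2)[of i]] unfolding R_def
        by (simp add: fls_deriv_mult rational_in.spn_add)
    qed
    then show "fls_deriv (f ^ i) \<in> tspan (\<lambda>i. f ^ i) {..<degree p}"
      by (simp add: R_def)
  qed simp
  then show ?thesis
    using that[of "degree p"] ring fR unfolding R_def by blast
qed

subsection \<open>Algebraicity of \<open>\<rat>(t, Z)\<close>\<close>

lemma (in subfield_set) polyK_pCons: "a \<in> K \<Longrightarrow> polyK p \<Longrightarrow> polyK (pCons a p)"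
  unfolding polyK_def by (auto simp: coeff_pCons split: nat.splits)

lemma (in subfield_set) polyK_0: "polyK 0"
  by (simp add: polyK_def zero_in)

lemma algebraic_Z: "algebraic_series (fps_to_fls Z)"
proof -
  let ?z = "fps_to_fls Z"
  define p :: "rat fls poly" where "p = [:-27, 0, 0, 0, 18, 0, 8 - 256 * fls_X\<^sup>2, 0, 1:]"
  have "(T - 1) * (T + 3) ^ 3 = 256 * fps_X\<^sup>2 * T ^ 3"
    by (rule T_eq)
  from arg_cong[OF this[folded Z_square], of fps_to_fls]
  have e: "(?z\<^sup>2 - 1) * (?z\<^sup>2 + 3) ^ 3 = 256 * fls_X\<^sup>2 * (?z\<^sup>2) ^ 3"
    by (simp add: fls_times_fps_to_fls fps_to_fls_power)
  have "poly p ?z = (?z\<^sup>2 - 1) * (?z\<^sup>2 + 3) ^ 3 - 256 * fls_X\<^sup>2 * (?z\<^sup>2) ^ 3"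
    by (simp add: p_def algebra_simps power2_eq_square power3_eq_cube)
  then have "poly p ?z = 0"
    using e by simp
  moreover have "poly p 0 = -27"
    by (simp add: p_def)
  then have "p \<noteq> 0" by auto
  moreover have "rational_in.polyK fls_X p"
    unfolding p_def by (intro rational_in.polyK_pCons rational_in.polyK_0 rational_in.closed self_rational_in)
  ultimately show ?thesis
    unfolding algebraic_series_iff rational_in.algebraic_over_def by blast
qed

text \<open>Hence every rational function of \<open>t\<close> and of an algebraic series is found in a ring on which linear algebra applies.\<close>

lemma finite_ring_contains:
  assumes R: "rational_in.finite_ring fls_X R" and f: "f \<in> R"
  shows "rational_in f \<subseteq> R" "adjoin (rational_in f) fls_X \<subseteq> R"
proof -
  have mR: "x * y \<in> R" if "x \<in> R" "y \<in> R" for x y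
    using R that unfolding rational_in.finite_ring_def by blast
  have aR: "x + y \<in> R" if "x \<in> R" "y \<in> R" for x y
    using R that rational_in.spn_add unfolding rational_in.finite_ring_def by blast
  have cR: "fls_const c \<in> R" for c
    by (rule rational_in.finite_ring_subset[OF R const_rational_in])
  have e: "evalp p f \<in> R" for p
  proof (induction p)
    case 0
    then show ?case using cR[of 0] by simp
  next
    case (pCons a p)
    then show ?case
      unfolding map_poly_fls_const_pCons by (intro aR mR cR f)
  qed
  show 1: "rational_in f \<subseteq> R"
    using e by (auto elim!: rational_inE simp: divide_inverse intro!: mR rational_in.finite_ring_inverse[OF R])
  have "fls_X \<in> R"
    by (rule rational_in.finite_ring_subset[OF R self_rational_in])
  then show "adjoin (rational_in f) fls_X \<subseteq> R"
    using 1 unfolding adjoin_def by (auto intro!: aR mR)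
qed

subsection \<open>Logarithmic singularities are transcendental\<close>

definition conv_at :: "real \<Rightarrow> rat fps \<Rightarrow> bool" where
  "conv_at x f \<longleftrightarrow> summable (\<lambda>n. \<bar>of_rat (fps_nth f n) * x ^ n\<bar>)"

definition value_at :: "real \<Rightarrow> rat fps \<Rightarrow> real" where
  "value_at x f = (\<Sum>n. of_rat (fps_nth f n) * x ^ n)"

lemma conv_at_mult:
  assumes "conv_at x f" "conv_at x g"
  shows "conv_at x (f * g)" "value_at x (f * g) = value_at x f * value_at x g"
proof -
  define a b where "a = (\<lambda>n. of_rat (fps_nth f n) * x ^ n)" and "b = (\<lambda>n. of_rat (fps_nth g n) * x ^ n)"
  have ab: "summable (\<lambda>n. norm (a n))" "summable (\<lambda>n. norm (b n))"
    using assms by (simp_all add: conv_at_def a_def b_def)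
  have c: "of_rat (fps_nth (f * g) n) * x ^ n = (\<Sum>i\<le>n. a i * b (n - i))" for n
  proof -
    have "of_rat (fps_nth (f * g) n) * x ^ n = (\<Sum>i\<le>n. of_rat (fps_nth f i) * of_rat (fps_nth g (n - i)) * x ^ n)"
      by (simp add: fps_mult_nth of_rat_sum of_rat_mult sum_distrib_right atLeast0AtMost)
    also have "\<dots> = (\<Sum>i\<le>n. a i * b (n - i))"
      by (intro sum.cong) (auto simp: a_def b_def simp flip: power_add)
    finally show ?thesis .
  qed
  have "summable (\<lambda>n. \<Sum>i\<le>n. \<bar>a i\<bar> * \<bar>b (n - i)\<bar>)"
    using ab by (intro summable_Cauchy_product) auto
  then show "conv_at x (f * g)"
    unfolding conv_at_def c
    by (rule summable_comparison_test[rotated]) (auto intro!: exI[of _ 0] order.trans[OF sum_abs] simp: abs_mult)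
  show "value_at x (f * g) = value_at x f * value_at x g"
    unfolding value_at_def c using Cauchy_product[OF ab] by (simp add: a_def b_def)
qed

lemma conv_at_add:
  assumes "conv_at x f" "conv_at x g"
  shows "conv_at x (f + g)" "value_at x (f + g) = value_at x f + value_at x g"
proof -
  have s: "summable (\<lambda>n. \<bar>of_rat (fps_nth f n) * x ^ n\<bar>)" "summable (\<lambda>n. \<bar>of_rat (fps_nth g n) * x ^ n\<bar>)"
    using assms by (simp_all add: conv_at_def)
  show "conv_at x (f + g)"
    unfolding conv_at_def
    by (rule summable_comparison_test[OF _ summable_add[OF s]])
      (auto intro!: exI[of _ 0] simp: of_rat_add distrib_right)
  show "value_at x (f + g) = value_at x f + value_at x g"
    unfolding value_at_def using s[THEN summable_rabs_cancel]
    by (simp add: of_rat_add distrib_right suminf_add)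
qed

lemma conv_at_0: "conv_at x 0" "value_at x 0 = 0"
  by (simp_all add: conv_at_def value_at_def)

lemma conv_at_sum:
  assumes "\<And>i. i \<in> S \<Longrightarrow> conv_at x (f i)"
  shows "conv_at x (\<Sum>i\<in>S. f i) \<and> value_at x (\<Sum>i\<in>S. f i) = (\<Sum>i\<in>S. value_at x (f i))"
  using assms by (induction S rule: infinite_finite_induct) (auto simp: conv_at_0 conv_at_add)

lemma conv_at_poly:
  "conv_at x (fps_of_poly p)" "value_at x (fps_of_poly p) = poly (map_poly of_rat p) x"
proof -
  have z: "of_rat (fps_nth (fps_of_poly p) n) * x ^ n = 0" if "n \<notin> {..degree p}" for n
    using that by (simp add: coeff_eq_0)
  show "conv_at x (fps_of_poly p)"
    unfolding conv_at_def using z by (intro summable_finite[of "{..degree p}"]) auto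
  have "value_at x (fps_of_poly p) = (\<Sum>n\<le>degree p. of_rat (coeff p n) * x ^ n)"
    unfolding value_at_def using z by (subst suminf_finite[of "{..degree p}"]) auto
  also have "\<dots> = poly (map_poly of_rat p) x"
    by (simp add: poly_altdef coeff_map_poly degree_map_poly)
  finally show "value_at x (fps_of_poly p) = poly (map_poly of_rat p) x" .
qed

lemma conv_at_power:
  assumes "conv_at x f"
  shows "conv_at x (f ^ n) \<and> value_at x (f ^ n) = value_at x f ^ n"
proof (induction n)
  case 0
  have "fps_of_poly 1 = (1 :: rat fps)" by simp
  then show ?case using conv_at_poly[of x 1] by simp
next
  case (Suc n)
  then show ?case using conv_at_mult[OF assms] by simp
qed

text \<open>Evaluation at \<open>t = (1 - exp (- y)) / 4\<close> turns the logarithmic growth at \<open>t = 1 / 4\<close> into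
  linear growth in \<open>y\<close>, so that one factor \<open>4 t - 1\<close> beats every power of the series.\<close>

lemma log_singularity_no_relation:
  fixes f :: "rat fps" and R :: "nat \<Rightarrow> rat poly"
  assumes nonneg: "\<And>n. 0 \<le> fps_nth f n"
    and bound: "\<And>n. of_rat (fps_nth f n) / 4 ^ n \<le> (c :: real) / (of_nat n + 1)"
    and diverges: "\<not> summable (\<lambda>n. of_rat (fps_nth f n) / 4 ^ n :: real)"
    and relation: "(\<Sum>j\<le>d. fps_of_poly (R j) * f ^ j) = 0"
    and J: "J \<le> d" "poly (R J) (1 / 4) \<noteq> 0"
  shows False
proof -
  define b where "b = (\<lambda>n. of_rat (fps_nth f n) / 4 ^ n :: real)"
  define t where "t = (\<lambda>y. (1 - exp (- y)) / 4 :: real)"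
  define G where "G = (\<lambda>y. value_at (t y) f)"
  have b0: "0 \<le> b n" for n
    using nonneg by (simp add: b_def)
  have bc: "b n \<le> c / (of_nat n + 1)" for n
    using bound by (simp add: b_def)
  have c0: "0 \<le> c"
    using order.trans[OF b0[of 0] bc[of 0]] by simp
  have trm: "of_rat (fps_nth f n) * t y ^ n = b n * (1 - exp (- y)) ^ n" for n y
    by (simp add: b_def t_def power_divide)
  have x: "0 \<le> 1 - exp (- y)" "1 - exp (- y) < 1" if "0 \<le> y" for y :: real
    using that by simp_all
  have bs: "summable (\<lambda>n. b n * (1 - exp (- y)) ^ n)" if "0 \<le> y" for y
  proof (rule summable_comparison_test)
    show "\<exists>N. \<forall>n\<ge>N. norm (b n * (1 - exp (- y)) ^ n) \<le> c * (1 - exp (- y)) ^ n"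
    proof (intro exI[of _ 0] allI impI)
      fix n
      have "b n \<le> c"
        by (rule order.trans[OF bc[of n]]) (use c0 in \<open>simp add: divide_le_eq mult_le_cancel_left1\<close>)
      then show "norm (b n * (1 - exp (- y)) ^ n) \<le> c * (1 - exp (- y)) ^ n"
        using b0[of n] x[OF that] by (simp add: abs_mult mult_right_mono)
    qed
    show "summable (\<lambda>n. c * (1 - exp (- y)) ^ n)"
      using x[OF that] by (intro summable_mult summable_geometric) simp
  qed
  have conv: "conv_at (t y) f" if "0 \<le> y" for y
    unfolding conv_at_def trm using bs[OF that] x[OF that] b0 by (simp add: abs_mult)
  have G: "G y = (\<Sum>n. b n * (1 - exp (- y)) ^ n)" for y
    by (simp add: G_def value_at_def trm)
  have upper: "G y \<le> 2 * c * y" if y: "ln 2 \<le> y" for y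
  proof -
    have y0: "0 < y" using y ln_gt_zero[of 2] by linarith
    define x where "x = 1 - exp (- y)"
    have "exp (- y) \<le> exp (- ln 2)" using y by simp
    also have "exp (- ln 2) = (1 / 2 :: real)" by (simp add: exp_minus inverse_eq_divide)
    finally have x2: "1 / 2 \<le> x" "x < 1" by (simp_all add: x_def)
    have "ln (exp (- y)) = (\<Sum>n. (- 1) ^ n * (1 / real (n + 1)) * (exp (- y) - 1) ^ Suc n)"
      using y0 by (intro ln_series) (auto intro: order.strict_trans[of _ 1])
    also have "(\<lambda>n. (- 1) ^ n * (1 / real (n + 1)) * (exp (- y) - 1) ^ Suc n) = (\<lambda>n. - (x ^ Suc n / (real n + 1)))"
    proof
      fix n
      have "exp (- y) - 1 = - x" by (simp add: x_def)
      then show "(- 1) ^ n * (1 / real (n + 1)) * (exp (- y) - 1) ^ Suc n = - (x ^ Suc n / (real n + 1))"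
        by (simp only: power_minus[of x]) (simp add: add_ac)
    qed
    finally have l: "- y = (\<Sum>n. - (x ^ Suc n / (real n + 1)))" by simp
    have s: "summable (\<lambda>n. x ^ Suc n / (real n + 1))"
    proof (rule summable_comparison_test)
      show "summable (\<lambda>n. x ^ n)" using x2 by (intro summable_geometric) simp
      have "x ^ Suc n / (real n + 1) \<le> x ^ n" for n
        using x2 by (simp add: divide_le_eq mult_right_le_one_le)
      then show "\<exists>N. \<forall>n\<ge>N. norm (x ^ Suc n / (real n + 1)) \<le> x ^ n"
        using x2 by (intro exI[of _ 0]) simp
    qed
    have l': "y = (\<Sum>n. x ^ Suc n / (real n + 1))"
      using l suminf_minus[OF s] by simp
    have "x * G y = (\<Sum>n. x * (b n * x ^ n))"
      using bs[of y] y0 by (simp add: G x_def[symmetric] suminf_mult)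
    also have "\<dots> \<le> (\<Sum>n. c * (x ^ Suc n / (real n + 1)))"
    proof (rule suminf_le)
      show "x * (b n * x ^ n) \<le> c * (x ^ Suc n / (real n + 1))" for n
      proof -
        have "b n * x ^ Suc n \<le> c / (real n + 1) * x ^ Suc n"
          using bc[of n] x2 by (intro mult_right_mono) auto
        then show ?thesis by (simp add: mult_ac)
      qed
      show "summable (\<lambda>n. x * (b n * x ^ n))"
        using bs[of y] y0 by (intro summable_mult) (simp add: x_def)
      show "summable (\<lambda>n. c * (x ^ Suc n / (real n + 1)))"
        by (rule summable_mult[OF s])
    qed
    also have "\<dots> = c * y"
      using suminf_mult[OF s, of c] l' by simp
    finally have "x * G y \<le> c * y" .
    moreover have "0 \<le> G y"
      unfolding G using bs[of y] y0 b0 x[of y] by (intro suminf_nonneg) auto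
    then have "1 / 2 * G y \<le> x * G y"
      using x2 by (intro mult_right_mono) auto
    ultimately show ?thesis by simp
  qed
  have Gtop: "filterlim G at_top at_top"
    unfolding filterlim_at_top
  proof
    fix M
    have "\<exists>N. M < (\<Sum>n<N. b n)"
    proof (rule ccontr)
      assume "\<not> (\<exists>N. M < (\<Sum>n<N. b n))"
      then have "sum b {..<Suc n} \<le> M" for n
        by (meson not_less)
      then have "summable b"
        using b0 by (intro bounded_imp_summable[of b M]) (simp_all only: lessThan_Suc_atMost)
      then show False using diverges by (simp add: b_def[symmetric])
    qed
    then obtain N where N: "M < (\<Sum>n<N. b n)" by blast
    have "((\<lambda>y. exp (- y)) \<longlongrightarrow> (0::real)) at_top"
      by (intro filterlim_compose[OF exp_at_bot] filterlim_uminus_at_bot_at_top)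
    then have "((\<lambda>y. \<Sum>n<N. b n * (1 - exp (- y)) ^ n) \<longlongrightarrow> (\<Sum>n<N. b n * (1 - 0) ^ n)) at_top"
      by (intro tendsto_intros)
    then have "\<forall>\<^sub>F y in at_top. M < (\<Sum>n<N. b n * (1 - exp (- y)) ^ n)"
      using N by (intro order_tendstoD(1)) auto
    with eventually_ge_at_top[of 0] show "\<forall>\<^sub>F y in at_top. M \<le> G y"
    proof eventually_elim
      case (elim y)
      have "(\<Sum>n<N. b n * (1 - exp (- y)) ^ n) \<le> G y"
        unfolding G using bs[of y] elim b0 x[of y] by (intro sum_le_suminf) auto
      then show ?case using elim by simp
    qed
  qed
  have etend: "((\<lambda>y. exp (- y)) \<longlongrightarrow> (0::real)) at_top"
    by (intro filterlim_compose[OF exp_at_bot] filterlim_uminus_at_bot_at_top)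
  have ttend: "(t \<longlongrightarrow> 1 / 4) at_top"
    unfolding t_def by (rule tendsto_eq_intros etend | simp)+
  define P where "P = (\<lambda>j. map_poly (of_rat :: rat \<Rightarrow> real) (R j))"
  have P_val: "poly (P j) (1 / 4) = of_rat (poly (R j) (1 / 4))" for j
  proof -
    have "poly (map_poly of_rat p) (of_rat z) = (of_rat (poly p z) :: real)" for p z
      by (induction p) (simp_all add: map_poly_pCons of_rat_add of_rat_mult)
    from this[of "R j" "1 / 4"] show ?thesis by (simp add: P_def of_rat_divide)
  qed
  have rel: "(\<Sum>j\<le>d. poly (P j) (t y) * G y ^ j) = 0" if "0 \<le> y" for y
  proof -
    have "(\<Sum>j\<le>d. poly (P j) (t y) * G y ^ j) = (\<Sum>j\<le>d. value_at (t y) (fps_of_poly (R j) * f ^ j))"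
      using conv_at_power[OF conv[OF that]] by (simp add: conv_at_mult conv_at_poly P_def G_def)
    also have "\<dots> = value_at (t y) (\<Sum>j\<le>d. fps_of_poly (R j) * f ^ j)"
      using conv_at_power[OF conv[OF that]] by (subst conv_at_sum[THEN conjunct2]) (auto intro: conv_at_mult conv_at_poly)
    also have "\<dots> = 0"
      unfolding relation by (rule conv_at_0)
    finally show ?thesis .
  qed
  define L where "L = Max {j. j \<le> d \<and> poly (R j) (1 / 4) \<noteq> 0}"
  have fin: "finite {j. j \<le> d \<and> poly (R j) (1 / 4) \<noteq> 0}" by simp
  have L: "L \<le> d" "poly (R L) (1 / 4) \<noteq> 0"
    using Max_in[OF fin] J unfolding L_def by blast+
  have above: "poly (R j) (1 / 4) = 0" if "j \<le> d" "L < j" for j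
    using Max_ge[OF fin, of j] that unfolding L_def by fastforce
  have Gpos: "\<forall>\<^sub>F y in at_top. 0 < G y"
    using Gtop by (simp add: filterlim_at_top_dense)
  have trm_lim: "((\<lambda>y. poly (P j) (t y) * G y ^ j / G y ^ L) \<longlongrightarrow> (if j = L then poly (P L) (1 / 4) else 0)) at_top"
    if "j \<le> d" for j
  proof -
    have pt: "((\<lambda>y. poly (P k) (t y)) \<longlongrightarrow> poly (P k) (1 / 4)) at_top" for k
      by (rule tendsto_poly[OF ttend])
    consider "j < L" | "j = L" | "L < j" by linarith
    then show ?thesis
    proof cases
      case 1
      have "((\<lambda>y. inverse (G y)) \<longlongrightarrow> 0) at_top"
        by (rule tendsto_inverse_0_at_top[OF Gtop])
      then have "((\<lambda>y. poly (P j) (t y) * inverse (G y) ^ (L - j)) \<longlongrightarrow> poly (P j) (1 / 4) * 0 ^ (L - j)) at_top"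
        by (intro tendsto_intros pt)
      then have "((\<lambda>y. poly (P j) (t y) * inverse (G y) ^ (L - j)) \<longlongrightarrow> 0) at_top"
        using 1 by (simp add: zero_power)
      moreover have "\<forall>\<^sub>F y in at_top. poly (P j) (t y) * inverse (G y) ^ (L - j) = poly (P j) (t y) * G y ^ j / G y ^ L"
        using Gpos by eventually_elim (use 1 in \<open>simp add: power_diff field_simps\<close>)
      ultimately show ?thesis
        using 1 by (subst (asm) tendsto_cong) auto
    next
      case 2
      have "\<forall>\<^sub>F y in at_top. poly (P L) (t y) = poly (P j) (t y) * G y ^ j / G y ^ L"
        using Gpos by eventually_elim (simp add: 2)
      then show ?thesis
        using pt[of L] 2 by (subst (asm) tendsto_cong) auto
    next
      case 3
      have "poly (P j) (1 / 4) = 0"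
        using above[OF that 3] by (simp add: P_val)
      then obtain S where S: "P j = [:- (1 / 4), 1:] * S"
        unfolding poly_eq_0_iff_dvd by (elim dvdE)
      define m where "m = j - L"
      have lim: "((\<lambda>y. (2 * c) ^ m * (y ^ m / exp y)) \<longlongrightarrow> (2 * c) ^ m * 0) at_top"
        by (intro tendsto_intros tendsto_power_div_exp_0)
      have lower: "\<forall>\<^sub>F y in at_top. 0 \<le> exp (- y) * G y ^ m"
        using Gpos by eventually_elim simp
      have "\<forall>\<^sub>F y in at_top. exp (- y) * G y ^ m \<le> (2 * c) ^ m * (y ^ m / exp y)"
        using Gpos eventually_ge_at_top[of "ln 2"]
      proof eventually_elim
        case (elim y)
        have "G y ^ m \<le> (2 * c * y) ^ m"
          using elim upper[of y] by (intro power_mono) auto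
        then show ?case
          using elim by (simp add: exp_minus field_simps)
      qed
      from tendsto_sandwich[OF lower this _ lim[unfolded mult_zero_right]]
      have "((\<lambda>y. exp (- y) * G y ^ m) \<longlongrightarrow> 0) at_top"
        by (simp only: tendsto_const)
      then have "((\<lambda>y. - (1 / 4) * poly S (t y) * (exp (- y) * G y ^ m)) \<longlongrightarrow> - (1 / 4) * poly S (1 / 4) * 0) at_top"
        by (intro tendsto_mult tendsto_const tendsto_poly ttend)
      moreover have "\<forall>\<^sub>F y in at_top. - (1 / 4) * poly S (t y) * (exp (- y) * G y ^ m) = poly (P j) (t y) * G y ^ j / G y ^ L"
        using Gpos
      proof eventually_elim
        case (elim y)
        have "G y ^ j = G y ^ L * G y ^ m"
          using 3 by (simp add: m_def flip: power_add)
        then show ?case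
          using elim by (simp add: S) (simp add: t_def field_simps)
      qed
      ultimately show ?thesis
        using 3 by (subst (asm) tendsto_cong) auto
    qed
  qed
  have "((\<lambda>y. \<Sum>j\<le>d. poly (P j) (t y) * G y ^ j / G y ^ L) \<longlongrightarrow> (\<Sum>j\<le>d. if j = L then poly (P L) (1 / 4) else 0)) at_top"
    by (intro tendsto_sum trm_lim) auto
  moreover have "\<forall>\<^sub>F y in at_top. (\<Sum>j\<le>d. poly (P j) (t y) * G y ^ j / G y ^ L) = 0"
    using eventually_ge_at_top[of 0] by eventually_elim (simp add: rel sum_divide_distrib[symmetric])
  ultimately have "((\<lambda>y :: real. 0) \<longlongrightarrow> poly (P L) (1 / 4)) at_top"
    using L by (subst (asm) tendsto_cong) auto
  then have "poly (P L) (1 / 4) = 0"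
    by (simp add: tendsto_const_iff)
  then show False
    using L(2) by (simp add: P_val)
qed

lemma harmonic_diverges: "\<not> summable (\<lambda>n. 1 / (real n + 1))"
proof
  assume s: "summable (\<lambda>n. 1 / (real n + 1))"
  define S where "S = (\<Sum>n. 1 / (real n + 1))"
  have "ln (real N + 1) \<le> (\<Sum>n<N. 1 / (real n + 1))" for N
  proof (induction N)
    case (Suc N)
    have "ln (real (Suc N) + 1) - ln (real N + 1) = ln ((real (Suc N) + 1) / (real N + 1))"
      by (simp add: ln_div)
    also have "\<dots> \<le> (real (Suc N) + 1) / (real N + 1) - 1"
      by (intro ln_le_minus_one) simp
    also have "\<dots> = 1 / (real N + 1)"
      by (simp add: field_simps)
    finally show ?case using Suc by simp
  qed simp
  also have "(\<Sum>n<N. 1 / (real n + 1)) \<le> S" for N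
    unfolding S_def using s by (intro sum_le_suminf) auto
  finally have le: "ln (real N + 1) \<le> S" for N .
  obtain N where "exp S < real N" using reals_Archimedean2 by blast
  then have "S < ln (real N)"
    using exp_gt_zero[of S] by (metis exp_less_cancel_iff exp_ln order.strict_trans)
  also have "ln (real N) \<le> ln (real N + 1)"
    using \<open>exp S < real N\<close> exp_gt_zero[of S] by (intro ln_mono) (linarith+)
  finally show False using le[of N] by simp
qed

section \<open>Quadrant walks\<close>

subsection \<open>The differential equation\<close>

lemma ballot_0: "ballot 0 i = (if i = 0 then 1 else 0)"
  and ballot_Suc_0: "ballot (Suc n) 0 = ballot n 1"
  and ballot_Suc_Suc: "ballot (Suc n) (Suc i) = ballot n i + ballot n (Suc (Suc i))"
  by simp_all

declare ballot.simps [simp del]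

lemma ballot_eq_0: "n < i \<or> odd (n + i) \<Longrightarrow> ballot n i = 0"
proof (induction n arbitrary: i)
  case 0
  then show ?case by (cases "i = 0") (simp_all add: ballot_0)
next
  case (Suc n)
  show ?case
  proof (cases i)
    case 0
    then have "n < 1 \<or> odd (n + 1)"
      using Suc.prems by simp
    from Suc.IH[OF this] show ?thesis
      by (simp only: 0 ballot_Suc_0)
  next
    case i: (Suc i')
    then have "n < i' \<or> odd (n + i')" "n < Suc (Suc i') \<or> odd (n + Suc (Suc i'))"
      using Suc.prems by auto
    then show ?thesis
      using Suc.IH by (simp only: i ballot_Suc_Suc)
  qed
qed

lemma ballot_nonneg: "0 \<le> ballot n i"
proof (induction n arbitrary: i)
  case 0
  show ?case by (simp add: ballot_0)
next
  case (Suc n)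
  then show ?case
    by (cases i) (simp_all only: ballot_Suc_0 ballot_Suc_Suc add_nonneg_nonneg)
qed

lemma ballot_initial: "n < 2 \<Longrightarrow> (of_nat n - of_nat i) * ballot n i = 0"
  by (cases n; cases i) (auto simp: ballot_0 ballot_Suc_0 ballot_Suc_Suc)

lemma ballot_closed:
  "n = i + 2 * m \<Longrightarrow> ballot n i * (fact m * fact (i + m + 1)) = (of_nat i + 1) * fact n"
proof (induction n arbitrary: i m)
  case 0
  then show ?case by (simp add: ballot_0)
next
  case (Suc n)
  show ?case
  proof (cases i)
    case 0
    then obtain m' where m: "m = Suc m'" using Suc.prems by (cases m) auto
    have n: "n = 1 + 2 * m'" using Suc.prems 0 m by simp
    define F where "F = (fact (1 + m' + 1) :: rat)"
    have IH: "ballot n 1 * (fact m' * F) = (of_nat 1 + 1) * fact n"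
      unfolding F_def by (rule Suc.IH[OF n])
    have sn: "of_nat (Suc n) = (of_nat m' + 1) * (of_nat 1 + 1 :: rat)"
      using n by simp
    have "ballot (Suc n) i * (fact m * fact (i + m + 1)) = ballot n 1 * ((of_nat (Suc m') * fact m') * F)"
      unfolding 0 m F_def ballot_Suc_0 fact_Suc[of m'] by (simp only: add_0 Suc_eq_plus1 add_ac)
    also have "\<dots> = of_nat (Suc m') * (ballot n 1 * (fact m' * F))"
      by (simp only: mult_ac)
    also have "\<dots> = fact (Suc n)"
      unfolding IH fact_Suc[of n] sn by (simp add: add.commute mult_ac)
    finally show ?thesis
      by (simp only: 0 of_nat_0 add_0 mult_1)
  next
    case i: (Suc i')
    show ?thesis
    proof (cases m)
      case 0
      then have n: "n = i' + 2 * 0" using Suc.prems i by simp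
      then have b: "ballot n (Suc i) = 0" using i by (intro ballot_eq_0) simp
      define F where "F = (fact (i' + 0 + 1) :: rat)"
      have IH: "ballot n i' * (fact 0 * F) = (of_nat i' + 1) * fact n"
        unfolding F_def by (rule Suc.IH[OF n])
      have "i + m + 1 = Suc (i' + 0 + 1)" using 0 i by simp
      then have F: "fact (i + m + 1) = (of_nat i + 1) * F"
        unfolding F_def by (simp only: fact_Suc) (simp add: i)
      have sn: "fact (Suc n) = (of_nat i' + 1) * fact n"
        unfolding fact_Suc using n by (simp add: add.commute)
      have "ballot (Suc n) i * (fact m * fact (i + m + 1)) = (of_nat i + 1) * (ballot n i' * (fact 0 * F))"
        unfolding F using b by (simp add: 0 i ballot_Suc_Suc)
      then show ?thesis
        unfolding IH sn .
    next
      case m: (Suc m')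
      define A B where "A = ballot n i'" and "B = ballot n (i' + 2)"
      have "n = i' + 2 * Suc m'" "n = (i' + 2) + 2 * m'"
        using Suc.prems i m by simp_all
      note IH = this[THEN Suc.IH, folded A_def B_def]
      define f g h x y where "f = (fact m' :: rat)" and "g = (fact (i' + m' + 2) :: rat)" and "h = (fact n :: rat)"
        and "x = (of_nat i' :: rat)" and "y = (of_nat m' :: rat)"
      have idx: "i' + Suc m' + 1 = i' + m' + 2" "i' + 2 + m' + 1 = Suc (i' + m' + 2)" "i + m + 1 = Suc (i' + m' + 2)"
        using i m by simp_all
      have num: "of_nat (Suc (i' + m' + 2)) = x + y + 3" "of_nat (Suc m') = y + 1" "of_nat (Suc n) = x + 2 * y + 3"
        "of_nat i = x + 1" "of_nat (i' + 2) = x + 2"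
        using Suc.prems i m by (simp_all add: x_def y_def)
      have 1: "A * (((y + 1) * f) * g) = (x + 1) * h"
        using IH(1) unfolding idx fact_Suc num f_def[symmetric] g_def[symmetric] h_def[symmetric] x_def[symmetric] .
      have 2: "B * (f * ((x + y + 3) * g)) = (x + 2 + 1) * h"
        using IH(2) unfolding idx fact_Suc num f_def[symmetric] g_def[symmetric] h_def[symmetric] .
      have ring: "(a + b) * (((v + 1) * k) * ((u + v + 3) * l)) = (u + 1 + 1) * ((u + 2 * v + 3) * w)"
        if "a * (((v + 1) * k) * l) = (u + 1) * w" "b * (k * ((u + v + 3) * l)) = (u + 2 + 1) * w"
        for a b u v k l w :: rat
      proof -
        have "(a + b) * (((v + 1) * k) * ((u + v + 3) * l)) =
            (u + v + 3) * (a * (((v + 1) * k) * l)) + (v + 1) * (b * (k * ((u + v + 3) * l)))"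
          by (simp add: algebra_simps)
        also have "\<dots> = (u + 1 + 1) * ((u + 2 * v + 3) * w)"
          unfolding that by (simp add: algebra_simps)
        finally show ?thesis .
      qed
      have AB: "ballot (Suc n) i = A + B"
        by (simp add: i ballot_Suc_Suc A_def B_def)
      show ?thesis
        unfolding AB idx(3) unfolding m fact_Suc num f_def[symmetric] g_def[symmetric] h_def[symmetric]
        by (rule ring[OF 1 2])
    qed
  qed
qed

lemma ballot_pos: "0 < ballot (i + 2 * m) i"
proof -
  have "0 < (of_nat i + 1 :: rat) * fact (i + 2 * m)"
    by (simp add: add_nonneg_pos)
  also have "\<dots> = ballot (i + 2 * m) i * (fact m * fact (i + m + 1))"
    by (rule ballot_closed[OF refl, symmetric])
  finally have "ballot (i + 2 * m) i \<noteq> 0"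
    by auto
  then show ?thesis
    using ballot_nonneg[of "i + 2 * m" i] by simp
qed

text \<open>The form in which the differential equation uses the closed expression for the ballot numbers; it also
  holds where they vanish.\<close>

lemma ballot_recurrence:
  "(of_nat n + 2 - of_nat i) * (of_nat n + 4 + of_nat i) * ballot (n + 2) i = 4 * (of_nat n + 1) * (of_nat n + 2) * ballot n i"
proof -
  consider "n + 2 < i \<or> odd (n + i)" | "n + 2 = i" | m where "n = i + 2 * m"
  proof -
    assume a: "n + 2 < i \<or> odd (n + i) \<Longrightarrow> thesis" "n + 2 = i \<Longrightarrow> thesis" "\<And>m. n = i + 2 * m \<Longrightarrow> thesis"
    show thesis
    proof (cases "i \<le> n \<and> even (n + i)")
      case True
      then have "n = i + 2 * ((n - i) div 2)" by presburger
      then show thesis by (rule a(3))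
    next
      case False
      then have "n + 2 < i \<or> odd (n + i) \<or> n + 2 = i"
        by presburger
      then show thesis using a by blast
    qed
  qed
  then show ?thesis
  proof cases
    case 1
    have "ballot (n + 2) i = 0" "ballot n i = 0"
      by (rule ballot_eq_0; use 1 in auto)+
    then show ?thesis by simp
  next
    case 2
    have "ballot n i = 0" by (rule ballot_eq_0) (use 2 in auto)
    then show ?thesis using 2 by auto
  next
    case (3 m)
    define f where "f = (fact m * fact (i + m + 1) :: rat)"
    have f0: "f \<noteq> 0" by (simp add: f_def)
    have 1: "ballot n i * f = (of_nat i + 1) * fact n"
      unfolding f_def by (rule ballot_closed[OF 3])
    have "n + 2 = i + 2 * Suc m" using 3 by simp
    note b = ballot_closed[OF this]
    have idx: "i + Suc m + 1 = Suc (i + m + 1)" "fact (n + 2) = (fact (Suc (Suc n)) :: rat)"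
      by simp_all
    have num: "of_nat (Suc m) = of_nat m + (1 :: rat)" "of_nat (Suc (i + m + 1)) = of_nat i + of_nat m + (2 :: rat)"
      "of_nat (Suc (Suc n)) = of_nat n + (2 :: rat)" "of_nat (Suc n) = of_nat n + (1 :: rat)"
      by simp_all
    have 2: "ballot (n + 2) i * (((of_nat m + 1) * fact m) * ((of_nat i + of_nat m + 2) * fact (i + m + 1))) =
        (of_nat i + 1) * ((of_nat n + 2) * ((of_nat n + 1) * fact n))"
      using b unfolding idx fact_Suc num .
    define x y where "x = (of_nat i :: rat)" and "y = (of_nat m :: rat)"
    have n: "of_nat n = x + 2 * y"
      unfolding 3 by (simp add: x_def y_def)
    have ring: "((u + 2 * v + 2 - u) * (u + 2 * v + 4 + u) * b') * (k * l) = (4 * (u + 2 * v + 1) * (u + 2 * v + 2) * b) * (k * l)"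
      if "b' * (((v + 1) * k) * ((u + v + 2) * l)) = (u + 1) * ((u + 2 * v + 2) * ((u + 2 * v + 1) * w))"
        "b * (k * l) = (u + 1) * w" for b' b u v k l w :: rat
    proof -
      have "((u + 2 * v + 2 - u) * (u + 2 * v + 4 + u) * b') * (k * l) = 4 * (b' * (((v + 1) * k) * ((u + v + 2) * l)))"
        by (simp add: algebra_simps)
      also have "\<dots> = 4 * (u + 2 * v + 1) * (u + 2 * v + 2) * ((u + 1) * w)"
        unfolding that(1) by (simp only: mult_ac)
      also have "\<dots> = (4 * (u + 2 * v + 1) * (u + 2 * v + 2) * b) * (k * l)"
        unfolding that(2)[symmetric] by (simp only: mult_ac)
      finally show ?thesis .
    qed
    have "((of_nat n + 2 - of_nat i) * (of_nat n + 4 + of_nat i) * ballot (n + 2) i) * f =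
        (4 * (of_nat n + 1) * (of_nat n + 2) * ballot n i) * f"
      using ring[OF 2[unfolded n, folded x_def y_def] 1[unfolded f_def, folded x_def]]
      unfolding n f_def x_def[symmetric] .
    then show ?thesis
      using f0 by simp
  qed
qed

text \<open>The operator \<open>t d/dt\<close> multiplies the coefficient of \<open>t ^ n\<close> by \<open>n\<close>, so it translates recurrences into
  differential equations.\<close>

definition theta :: "'a :: comm_ring_1 fps \<Rightarrow> 'a fps" where
  "theta f = fps_X * fps_deriv f"

lemma theta_nth: "fps_nth (theta f) n = of_nat n * fps_nth f n"
  by (cases n) (simp_all add: theta_def)

definition quadrant_fps :: "nat \<Rightarrow> nat \<Rightarrow> rat fps" where
  "quadrant_fps i j = Abs_fps (\<lambda>n. ballot n i * ballot n j)"

lemma Q_quadrant_fps: "Q (int i) (int j) = fps_to_fls (quadrant_fps i j)"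
  unfolding Q_eq by (rule arg_cong[where f = fps_to_fls], rule fps_ext)
    (simp add: quadrant_fps_def walk_series_quadrant_nth)

lemma theta_power_nth: "fps_nth ((theta ^^ k) f) n = of_nat n ^ k * fps_nth f n"
  by (induction k) (simp_all add: theta_nth)

text \<open>The coefficient of \<open>t ^ n\<close> is the product of the ballot recurrences for \<open>i\<close> and \<open>j\<close>; on the left, the fourth
  degree polynomial in \<open>theta\<close> is \<open>(theta\<^sup>2 + 2 theta - i (i + 2)) (theta\<^sup>2 + 2 theta - j (j + 2))\<close>.\<close>

lemma quadrant_differential_equation:
  fixes i j :: nat
  defines "\<alpha> \<equiv> of_nat (i * (i + 2)) :: rat" and "\<beta> \<equiv> of_nat (j * (j + 2)) :: rat" and "q \<equiv> \<lambda>k. (theta ^^ k) (quadrant_fps i j)"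
  shows "q 4 + 4 * q 3 + fps_const (4 - \<alpha> - \<beta>) * q 2 - fps_const (2 * (\<alpha> + \<beta>)) * q 1 + fps_const (\<alpha> * \<beta>) * q 0 =
    16 * fps_X\<^sup>2 * (q 4 + 6 * q 3 + 13 * q 2 + 12 * q 1 + 4 * q 0)"
    (is "?l = ?r")
proof (rule fps_ext)
  fix n
  define a where "a = (\<lambda>n. ballot n i * ballot n j)"
  have qn: "fps_nth (q k) n = of_nat n ^ k * a n" for k n
    by (simp add: q_def theta_power_nth a_def quadrant_fps_def)
  have num: "fps_nth (numeral m * f) n = numeral m * fps_nth f n" for m n and f :: "rat fps"
    by (simp add: fps_numeral_fps_const)
  have "fps_nth ?l n = ((of_nat n - of_nat i) * (of_nat n + 2 + of_nat i)) * ((of_nat n - of_nat j) * (of_nat n + 2 + of_nat j)) * a n"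
    unfolding fps_add_nth fps_sub_nth num fps_mult_left_const_nth qn \<alpha>_def \<beta>_def of_nat_mult of_nat_add
    by (simp add: algebra_simps power4_eq_xxxx power3_eq_cube power2_eq_square)
  also have "\<dots> = fps_nth ?r n"
  proof (cases "n < 2")
    case True
    have "((of_nat n - of_nat i) * (of_nat n + 2 + of_nat i)) * ((of_nat n - of_nat j) * (of_nat n + 2 + of_nat j)) * a n =
        ((of_nat n - of_nat i) * ballot n i) * ((of_nat n + 2 + of_nat i) * ((of_nat n - of_nat j) * (of_nat n + 2 + of_nat j)) * ballot n j)"
      by (simp only: a_def mult_ac)
    also have "\<dots> = 0"
      unfolding ballot_initial[OF True] by simp
    finally show ?thesis
      using True by (simp add: num mult.assoc fps_X_power_mult_nth)
  next
    case False
    then obtain m where m: "n = m + 2"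
      by (metis add.commute le_Suc_ex not_less)
    have "((of_nat n - of_nat i) * (of_nat n + 2 + of_nat i)) * ((of_nat n - of_nat j) * (of_nat n + 2 + of_nat j)) * a n =
        ((of_nat m + 2 - of_nat i) * (of_nat m + 4 + of_nat i) * ballot (m + 2) i) *
        ((of_nat m + 2 - of_nat j) * (of_nat m + 4 + of_nat j) * ballot (m + 2) j)"
      unfolding m a_def by (simp add: algebra_simps)
    also have "\<dots> = (4 * (of_nat m + 1) * (of_nat m + 2) * ballot m i) * (4 * (of_nat m + 1) * (of_nat m + 2) * ballot m j)"
      unfolding ballot_recurrence ..
    also have "\<dots> = 16 * (of_nat m ^ 4 * a m + 6 * (of_nat m ^ 3 * a m) + 13 * (of_nat m ^ 2 * a m) + 12 * (of_nat m ^ 1 * a m) + 4 * (of_nat m ^ 0 * a m))"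
      unfolding a_def by (simp add: algebra_simps power4_eq_xxxx power3_eq_cube power2_eq_square)
    also have "\<dots> = fps_nth ?r n"
      unfolding m mult.assoc[of 16] num fps_X_power_mult_nth fps_add_nth qn by simp
    finally show ?thesis .
  qed
  finally show "fps_nth ?l n = fps_nth ?r n" .
qed

lemma fl_const: "fl (fps_const c) = fls_const c"
  by (simp add: fl_def)

lemma const_numeral_Qt: "fls_const c \<in> Qt" "numeral k \<in> Qt" "fls_X \<in> Qt" "inverse fls_X \<in> Qt"
  using const_rational_in[of c fls_X] const_rational_in[of "numeral k" fls_X] self_rational_in[of fls_X]
  by (simp_all add: rational_in.inverse_in)

lemma quadrant_span_deriv:
  fixes i j :: nat
  assumes "k \<in> {..<4}"
  defines "e \<equiv> \<lambda>k. fps_to_fls ((theta ^^ k) (quadrant_fps i j))"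
  shows "fls_deriv (e k) \<in> tspan e {..<4::nat}"
proof -
  have "e (Suc k) = fls_X * fls_deriv (e k)" for k
    by (simp add: e_def theta_def fls_times_fps_to_fls fls_deriv_fps_to_fls)
  then have d: "fls_deriv (e k) = inverse fls_X * e (Suc k)" for k
    using left_inverse[of "fls_X :: rat fls"] by (simp only: mult.assoc[symmetric]) (simp del: fls_inverse_X)
  have base: "e k \<in> tspan e {..<4}" if "k < 4" for k
    using that by (intro rational_in.spn_base) auto
  define \<alpha> \<beta> where "\<alpha> = (of_nat (i * (i + 2)) :: rat)" and "\<beta> = (of_nat (j * (j + 2)) :: rat)"
  have solve: "(1 - 16 * x) * e4 = (96 * x - 4) * e3 + (208 * x - c2) * e2 + (192 * x + c1) * e1 + (64 * x - c0) * e0"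
    if "e4 + 4 * e3 + c2 * e2 - c1 * e1 + c0 * e0 = 16 * x * (e4 + 6 * e3 + 13 * e2 + 12 * e1 + 4 * e0)"
    for x c2 c1 c0 e4 e3 e2 e1 e0 :: "rat fls"
    using that by algebra
  have "e 4 + 4 * e 3 + fls_const (4 - \<alpha> - \<beta>) * e 2 - fls_const (2 * (\<alpha> + \<beta>)) * e 1 + fls_const (\<alpha> * \<beta>) * e 0 =
    16 * fls_X\<^sup>2 * (e 4 + 6 * e 3 + 13 * e 2 + 12 * e 1 + 4 * e 0)"
    using arg_cong[OF quadrant_differential_equation[of i j, folded \<alpha>_def \<beta>_def], of fps_to_fls]
    unfolding e_def fl_def[symmetric] fl_homs fl_const .
  then have eq: "(1 - 16 * fls_X\<^sup>2) * e 4 = (96 * fls_X\<^sup>2 - 4) * e 3 + (208 * fls_X\<^sup>2 - fls_const (4 - \<alpha> - \<beta>)) * e 2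
      + (192 * fls_X\<^sup>2 + fls_const (2 * (\<alpha> + \<beta>))) * e 1 + (64 * fls_X\<^sup>2 - fls_const (\<alpha> * \<beta>)) * e 0" (is "?c * _ = ?r")
    by (rule solve)
  have r: "?r \<in> tspan e {..<4}"
    by (intro rational_in.spn_add rational_in.spn_scale base rational_in.closed const_numeral_Qt) auto
  have "?c \<noteq> 0"
  proof
    assume "?c = 0"
    then have "fl (1 - 16 * fps_X\<^sup>2) = fl 0"
      by (simp only: fl_homs)
    then have "fps_nth (1 - 16 * fps_X\<^sup>2 :: rat fps) 0 = 0"
      by (simp only: fl_homs(10)) simp
    then show False
      by (simp add: fps_mult_nth_0)
  qed
  then have e4: "e 4 = inverse ?c * ?r"
    using eq by (simp add: field_simps)
  have "e 4 \<in> tspan e {..<4}"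
    unfolding e4 by (intro rational_in.spn_scale r rational_in.closed const_numeral_Qt)
  then have "e (Suc k) \<in> tspan e {..<4}"
    using assms(1) base by (cases "Suc k = 4") auto
  then show ?thesis
    unfolding d by (intro rational_in.spn_scale const_numeral_Qt)
qed

subsection \<open>The coefficients of quadrant walks\<close>

lemma ballot_le_0: "ballot n i \<le> ballot (n + i) 0"
proof (induction i arbitrary: n)
  case (Suc i)
  have "ballot n (Suc i) \<le> ballot (Suc n) i"
    by (cases i) (simp_all add: ballot_Suc_0 ballot_Suc_Suc ballot_nonneg)
  also have "\<dots> \<le> ballot (Suc n + i) 0"
    by (rule Suc.IH)
  finally show ?case by simp
qed simp

text \<open>The recurrence multiplies the ballot number by \<open>4 (n + 1) / (n + 4)\<close>, and
  \<open>(n + 1)\<^sup>2 (n + 4) \<le> (n + 2)\<^sup>3\<close>.\<close>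

lemma ballot_0_bound: "(ballot n 0)\<^sup>2 * (of_nat n + 2) ^ 3 \<le> 8 * 4 ^ n"
proof (induction n rule: nat_induct2)
  case 0
  show ?case by (simp add: ballot_0)
next
  case 1
  have "ballot 1 0 = 0"
    by (rule ballot_eq_0) simp
  then show ?case by simp
next
  case (step n)
  define x b b' where "x = (of_nat n :: rat)" and "b = ballot n 0" and "b' = ballot (n + 2) 0"
  have x: "0 \<le> x" by (simp add: x_def)
  have "(x + 2) * ((x + 4) * b') = (x + 2) * (4 * (x + 1) * b)"
    using ballot_recurrence[of n 0] by (simp add: x_def b_def b'_def mult_ac)
  then have r: "(x + 4) * b' = 4 * (x + 1) * b"
    using x by simp
  have "b'\<^sup>2 * (x + 4) ^ 3 = ((x + 4) * b')\<^sup>2 * (x + 4)"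
    by (simp add: power2_eq_square power3_eq_cube)
  also have "\<dots> = 16 * b\<^sup>2 * ((x + 1)\<^sup>2 * (x + 4))"
    unfolding r by (simp add: power2_eq_square algebra_simps)
  also have "(x + 1)\<^sup>2 * (x + 4) \<le> (x + 2) ^ 3"
    using x by (simp add: power2_eq_square power3_eq_cube algebra_simps)
  then have "16 * b\<^sup>2 * ((x + 1)\<^sup>2 * (x + 4)) \<le> 16 * b\<^sup>2 * (x + 2) ^ 3"
    by (intro mult_left_mono) auto
  also have "\<dots> \<le> 16 * (8 * 4 ^ n)"
    using step by (simp add: b_def x_def)
  finally show ?case
    by (simp add: b'_def x_def add_ac)
qed

text \<open>The coefficients of the series are at most of order \<open>4 ^ n / n\<^sup>3\<close>. Bounding the product of two
  ballot numbers by their squares avoids square roots.\<close>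

lemma quadrant_upper_bound:
  "(of_nat n)\<^sup>2 * (ballot n i * ballot n j) / 4 ^ n \<le> 4 * (4 ^ i + 4 ^ j) / (of_nat n + 1)"
proof -
  define x where "x = (of_nat n :: rat)"
  have x: "0 \<le> x" by (simp add: x_def)
  have sq: "(ballot n k)\<^sup>2 * (x + 2) ^ 3 \<le> 8 * 4 ^ n * 4 ^ k" for k
  proof -
    have "(ballot n k)\<^sup>2 \<le> (ballot (n + k) 0)\<^sup>2"
      by (intro power_mono ballot_le_0 ballot_nonneg)
    moreover have "(x + 2) ^ 3 \<le> (of_nat (n + k) + 2) ^ 3"
      using x by (intro power_mono) (auto simp: x_def)
    ultimately have "(ballot n k)\<^sup>2 * (x + 2) ^ 3 \<le> (ballot (n + k) 0)\<^sup>2 * (of_nat (n + k) + 2) ^ 3"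
      using x by (intro mult_mono) auto
    also have "\<dots> \<le> 8 * 4 ^ (n + k)"
      by (rule ballot_0_bound)
    finally show ?thesis by (simp add: power_add)
  qed
  have amgm: "2 * (ballot n i * ballot n j) \<le> (ballot n i)\<^sup>2 + (ballot n j)\<^sup>2"
    using zero_le_power2[of "ballot n i - ballot n j"] by (simp add: power2_diff)
  have "x\<^sup>2 * (x + 1) \<le> (x + 2) ^ 3"
    using x by (simp add: power2_eq_square power3_eq_cube algebra_simps)
  then have "2 * (ballot n i * ballot n j) * (x\<^sup>2 * (x + 1)) \<le> ((ballot n i)\<^sup>2 + (ballot n j)\<^sup>2) * (x + 2) ^ 3"
    using x amgm by (intro mult_mono) (auto intro: ballot_nonneg)
  also have "\<dots> \<le> 8 * 4 ^ n * (4 ^ i + 4 ^ j)"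
    using sq[of i] sq[of j] by (simp add: distrib_right distrib_left)
  finally have "x\<^sup>2 * (ballot n i * ballot n j) * (x + 1) \<le> 4 * (4 ^ i + 4 ^ j) * 4 ^ n"
    by (simp add: algebra_simps)
  then show ?thesis
    using x by (simp add: x_def[symmetric] divide_le_eq le_divide_eq)
qed

text \<open>They are not smaller than this order either, because \<open>(n + 2 - i) (n + 4 + i) \<le> (n + 3)\<^sup>2\<close>.\<close>

lemma quadrant_lower_bound:
  fixes i j n :: nat
  defines "a \<equiv> \<lambda>n. ballot n i * ballot n j"
  assumes "i \<le> n" "j \<le> n"
  shows "(of_nat n) ^ 3 * a n / 4 ^ n \<le> (of_nat (n + 2)) ^ 3 * a (n + 2) / 4 ^ (n + 2)"
proof -
  define x u v where "x = (of_nat n :: rat)" and "u = (of_nat i :: rat)" and "v = (of_nat j :: rat)"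
  have xuv: "0 \<le> u" "u \<le> x" "0 \<le> v" "v \<le> x" using assms(2,3) by (simp_all add: x_def u_def v_def)
  have x: "0 \<le> x" by (simp add: x_def)
  have a0: "0 \<le> a k" for k by (simp add: a_def ballot_nonneg)
  have f: "0 \<le> (x + 2 - w) * (x + 4 + w)" "(x + 2 - w) * (x + 4 + w) \<le> (x + 3)\<^sup>2" if "0 \<le> w" "w \<le> x" for w
  proof -
    show "0 \<le> (x + 2 - w) * (x + 4 + w)" using that by simp
    have "(x + 3)\<^sup>2 - (x + 2 - w) * (x + 4 + w) = (w + 1)\<^sup>2"
      by (simp add: power2_eq_square algebra_simps)
    then show "(x + 2 - w) * (x + 4 + w) \<le> (x + 3)\<^sup>2"
      using zero_le_power2[of "w + 1"] by linarith
  qed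
  have "((x + 2 - u) * (x + 4 + u)) * ((x + 2 - v) * (x + 4 + v)) * a (n + 2) =
      ((x + 2 - u) * (x + 4 + u) * ballot (n + 2) i) * ((x + 2 - v) * (x + 4 + v) * ballot (n + 2) j)"
    by (simp only: a_def mult_ac)
  also have "\<dots> = (4 * (x + 1) * (x + 2) * ballot n i) * (4 * (x + 1) * (x + 2) * ballot n j)"
    unfolding x_def u_def v_def ballot_recurrence ..
  also have "\<dots> = (4 * 4) * ((x + 1)\<^sup>2 * (x + 2)\<^sup>2 * a n)"
    by (simp only: a_def power2_eq_square mult_ac)
  also have "\<dots> = 16 * (x + 1)\<^sup>2 * (x + 2)\<^sup>2 * a n"
    by (simp only: mult.assoc)
  finally have r: "((x + 2 - u) * (x + 4 + u)) * ((x + 2 - v) * (x + 4 + v)) * a (n + 2) = 16 * (x + 1)\<^sup>2 * (x + 2)\<^sup>2 * a n" .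
  have "((x + 2 - u) * (x + 4 + u)) * ((x + 2 - v) * (x + 4 + v)) * a (n + 2) \<le> ((x + 3)\<^sup>2 * (x + 3)\<^sup>2) * a (n + 2)"
    using f xuv a0 by (intro mult_right_mono mult_mono) auto
  then have 1: "16 * (x + 1)\<^sup>2 * (x + 2)\<^sup>2 * a n \<le> (x + 3) ^ 4 * a (n + 2)"
    unfolding r by (simp add: power2_eq_square power4_eq_xxxx mult_ac)
  have p5: "(x + 2) ^ 5 = (x + 2)\<^sup>2 * (x + 2) ^ 3"
    by (simp flip: power_add)
  have "x ^ 3 * (x + 3) ^ 4 = (x * (x + 3))\<^sup>2 * (x * (x + 3)\<^sup>2)"
    by (simp only: power2_eq_square power3_eq_cube power4_eq_xxxx mult_ac)
  also have "\<dots> \<le> ((x + 1) * (x + 2))\<^sup>2 * (x + 2) ^ 3"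
  proof (rule mult_mono)
    have "x * (x + 3) \<le> (x + 1) * (x + 2)"
      by (simp add: algebra_simps)
    then show "(x * (x + 3))\<^sup>2 \<le> ((x + 1) * (x + 2))\<^sup>2"
      by (rule power_mono) (use x in simp)
    show "x * (x + 3)\<^sup>2 \<le> (x + 2) ^ 3"
      using x by (simp add: power2_eq_square power3_eq_cube algebra_simps)
  qed (use x in simp_all)
  also have "\<dots> = (x + 1)\<^sup>2 * (x + 2) ^ 5"
    unfolding p5 by (simp only: power_mult_distrib mult.assoc)
  finally have "x ^ 3 * (x + 3) ^ 4 \<le> (x + 1)\<^sup>2 * (x + 2) ^ 5" .
  then have "16 * a n * (x ^ 3 * (x + 3) ^ 4) \<le> 16 * a n * ((x + 1)\<^sup>2 * (x + 2) ^ 5)"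
    using a0 by (intro mult_left_mono) auto
  also have "\<dots> = (16 * (x + 1)\<^sup>2 * (x + 2)\<^sup>2 * a n) * (x + 2) ^ 3"
    unfolding p5 by (simp only: mult_ac)
  also have "\<dots> \<le> ((x + 3) ^ 4 * a (n + 2)) * (x + 2) ^ 3"
    using x by (intro mult_right_mono 1) auto
  finally have "(x + 3) ^ 4 * (16 * (x ^ 3 * a n)) \<le> (x + 3) ^ 4 * ((x + 2) ^ 3 * a (n + 2))"
    by (simp add: mult_ac)
  moreover have "0 < (x + 3) ^ 4"
    by (rule zero_less_power) (use x in linarith)
  ultimately have le: "16 * (x ^ 3 * a n) \<le> (x + 2) ^ 3 * a (n + 2)"
    by (simp only: mult_le_cancel_left_pos)
  have e: "of_nat (n + 2) = x + 2" "(4 :: rat) ^ (n + 2) = 16 * 4 ^ n"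
    by (simp_all add: x_def power_add)
  have "x ^ 3 * a n / 4 ^ n = 16 * (x ^ 3 * a n) / (16 * 4 ^ n)"
    by simp
  also have "\<dots> \<le> (x + 2) ^ 3 * a (n + 2) / (16 * 4 ^ n)"
    using le by (rule divide_right_mono) simp
  finally show ?thesis
    unfolding e x_def[symmetric] .
qed

lemma quadrant_diverges:
  fixes i j :: nat
  assumes ij: "even i = even j"
  shows "\<not> summable (\<lambda>n. of_rat ((of_nat n)\<^sup>2 * (ballot n i * ballot n j)) / 4 ^ n :: real)" (is "\<not> summable ?b")
proof
  assume s: "summable ?b"
  define a where "a = (\<lambda>n. ballot n i * ballot n j)"
  define n0 where "n0 = i + 2 * j + 2"
  define \<kappa> where "\<kappa> = (of_nat n0) ^ 3 * a n0 / 4 ^ n0"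
  have e: "n0 = i + 2 * (j + 1)" "n0 = j + 2 * ((i + j + 2) div 2)"
    using ij unfolding n0_def by presburger+
  have "0 < ballot n0 i" by (subst e(1)) (rule ballot_pos)
  moreover have "0 < ballot n0 j" by (subst e(2)) (rule ballot_pos)
  ultimately have "0 < a n0"
    by (simp add: a_def)
  moreover have n0: "0 < n0" by (simp add: n0_def)
  ultimately have \<kappa>: "0 < \<kappa>" by (simp add: \<kappa>_def)
  have grow: "\<kappa> \<le> (of_nat (n0 + 2 * m)) ^ 3 * a (n0 + 2 * m) / 4 ^ (n0 + 2 * m)" for m
  proof (induction m)
    case 0
    show ?case by (simp add: \<kappa>_def)
  next
    case (Suc m)
    have "i \<le> n0 + 2 * m" "j \<le> n0 + 2 * m" by (simp_all add: n0_def)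
    from quadrant_lower_bound[OF this]
    have "(of_nat (n0 + 2 * m)) ^ 3 * a (n0 + 2 * m) / 4 ^ (n0 + 2 * m) \<le>
        (of_nat (n0 + 2 * m + 2)) ^ 3 * a (n0 + 2 * m + 2) / 4 ^ (n0 + 2 * m + 2)"
      unfolding a_def .
    moreover have "n0 + 2 * Suc m = n0 + 2 * m + 2" by simp
    ultimately show ?case using Suc by (simp only:)
  qed
  have le: "\<kappa> / of_nat (n0 + 2) * (1 / (of_nat m + 1)) \<le> (of_nat (n0 + 2 * m))\<^sup>2 * a (n0 + 2 * m) / 4 ^ (n0 + 2 * m)" for m
  proof -
    define N where "N = n0 + 2 * m"
    have N: "0 < (of_nat N :: rat)" using n0 by (simp add: N_def)
    have "of_nat N \<le> (of_nat ((n0 + 2) * (m + 1)) :: rat)"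
      unfolding of_nat_le_iff by (simp add: N_def)
    then have "\<kappa> / of_nat ((n0 + 2) * (m + 1)) \<le> \<kappa> / of_nat N"
      using \<kappa> N by (intro divide_left_mono) auto
    also have "\<dots> \<le> ((of_nat N) ^ 3 * a N / 4 ^ N) / of_nat N"
      using grow[of m] N unfolding N_def by (intro divide_right_mono) auto
    also have "\<dots> = (of_nat N)\<^sup>2 * a N / 4 ^ N"
      using N by (simp add: power3_eq_cube power2_eq_square)
    finally show ?thesis
      unfolding N_def of_nat_mult of_nat_add[of m] of_nat_1 by (simp only: times_divide_times_eq mult_1_right)
  qed
  have sub: "summable (?b \<circ> (\<lambda>m. n0 + 2 * m))"
    using s by (rule summable_reindex) (auto simp: inj_on_def ballot_nonneg)
  have bd: "norm (of_rat \<kappa> / real (n0 + 2) * (1 / (real m + 1))) \<le> (?b \<circ> (\<lambda>m. n0 + 2 * m)) m" for m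
  proof -
    define l where "l = \<kappa> / of_nat (n0 + 2) * (1 / (of_nat m + 1))"
    have l: "of_rat \<kappa> / real (n0 + 2) * (1 / (real m + 1)) = of_rat l"
      by (simp only: l_def of_rat_mult of_rat_divide of_rat_of_nat_eq of_rat_add of_rat_1)
    have r: "(?b \<circ> (\<lambda>m. n0 + 2 * m)) m = of_rat ((of_nat (n0 + 2 * m))\<^sup>2 * a (n0 + 2 * m) / 4 ^ (n0 + 2 * m))"
      by (simp only: o_apply a_def of_rat_divide of_rat_power of_rat_numeral_eq)
    have "0 \<le> l"
      using \<kappa> by (simp add: l_def)
    then have "norm (of_rat l :: real) = of_rat l"
      by simp
    then show ?thesis
      unfolding l r using le[of m, folded l_def] by (simp only: of_rat_less_eq)
  qed
  have "summable (\<lambda>m. of_rat \<kappa> / real (n0 + 2) * (1 / (real m + 1)))"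
    by (rule summable_comparison_test[OF _ sub]) (intro exI[of _ 0] allI impI bd)
  then have "summable (\<lambda>m. 1 / (real m + 1))"
    using \<kappa> by (subst (asm) summable_cmult_iff) auto
  then show False
    using harmonic_diverges by blast
qed

subsection \<open>Transcendence\<close>

text \<open>Clearing denominators, and cancelling the largest possible power of \<open>4 t - 1\<close>.\<close>

lemma algebraic_polynomial_relation:
  assumes "algebraic_series (fl f)"
  obtains d R J where "(\<Sum>j\<le>d. fps_of_poly (R j) * f ^ j) = 0" "J \<le> d" "poly (R J) (1 / 4) \<noteq> 0"
proof -
  have ev: "evalp p fls_X = fl (fps_of_poly p)" for p
  proof (induction p)
    case (pCons a p)
    then show ?case
      by (simp only: map_poly_fls_const_pCons fps_of_poly_pCons fl_homs fl_const) (simp add: mult.commute)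
  qed (simp add: fl_homs)
  have ev0: "evalp p fls_X = 0 \<longleftrightarrow> p = 0" for p
    unfolding ev fl_homs(1)[symmetric] fl_homs(10) by simp
  obtain p where p: "p \<noteq> 0" "\<And>k. coeff p k \<in> Qt" "poly p (fl f) = 0"
    using assms unfolding algebraic_series_def by blast
  define d where "d = degree p"
  have "\<exists>u v. coeff p k = evalp u fls_X / evalp v fls_X \<and> v \<noteq> 0" for k
    using p(2)[of k] by (elim rational_inE) (auto simp: ev0)
  then obtain u v where uv: "\<And>k. coeff p k = evalp (u k) fls_X / evalp (v k) fls_X" "\<And>k. v k \<noteq> 0"
    by metis
  define D where "D = (\<lambda>k. \<Prod>l\<in>{..d} - {k}. v l)"
  define P where "P = (\<lambda>k. u k * D k)"
  have prod: "evalp (v k) fls_X * evalp (D k) fls_X = evalp (\<Prod>l\<le>d. v l) fls_X" if "k \<le> d" for k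
    using that by (simp add: D_def prod.remove[of _ k] evalp_mult)
  have coeff_P: "coeff p k * evalp (\<Prod>l\<le>d. v l) fls_X = evalp (P k) fls_X" if "k \<le> d" for k
    using uv(2)[of k] ev0 unfolding prod[OF that, symmetric] uv(1)[of k] P_def evalp_mult by simp
  have "(\<Sum>k\<le>d. coeff p k * fl f ^ k) = 0"
    using p(3) by (simp add: poly_altdef d_def)
  then have "(\<Sum>k\<le>d. coeff p k * fl f ^ k) * evalp (\<Prod>l\<le>d. v l) fls_X = 0"
    by simp
  moreover have "(\<Sum>k\<le>d. coeff p k * fl f ^ k) * evalp (\<Prod>l\<le>d. v l) fls_X = (\<Sum>k\<le>d. evalp (P k) fls_X * fl f ^ k)"
    unfolding sum_distrib_right
  proof (intro sum.cong refl)
    fix k assume "k \<in> {..d}"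
    then have "k \<le> d" by simp
    show "coeff p k * fl f ^ k * evalp (\<Prod>l\<le>d. v l) fls_X = evalp (P k) fls_X * fl f ^ k"
      unfolding coeff_P[OF \<open>k \<le> d\<close>, symmetric] by (simp only: mult_ac)
  qed
  ultimately have rel: "(\<Sum>k\<le>d. evalp (P k) fls_X * fl f ^ k) = 0"
    by (simp only:)
  have "D d \<noteq> 0"
    using uv(2) by (simp add: D_def)
  moreover have "u d \<noteq> 0"
    using p(1) uv(1)[of d] by (auto simp: d_def)
  ultimately have Pd: "P d \<noteq> 0"
    by (simp add: P_def)
  let ?q = "[:- (1 / 4), 1:] :: rat poly"
  define S where "S = {k. k \<le> d \<and> P k \<noteq> 0}"
  define N where "N = Min ((\<lambda>k. order (1 / 4) (P k)) ` S)"
  have fin: "finite ((\<lambda>k. order (1 / 4) (P k)) ` S)" "(\<lambda>k. order (1 / 4) (P k)) ` S \<noteq> {}"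
    using Pd by (auto simp: S_def)
  obtain J where J: "J \<in> S" "N = order (1 / 4) (P J)"
    using Min_in[OF fin] unfolding N_def by auto
  have "?q ^ N dvd P k" if "k \<le> d" for k
  proof (cases "P k = 0")
    case False
    then have "N \<le> order (1 / 4) (P k)"
      using that unfolding N_def by (intro Min_le fin) (auto simp: S_def)
    then show ?thesis
      by (simp add: order_divides)
  qed simp
  then have "\<forall>k. \<exists>r. k \<le> d \<longrightarrow> P k = ?q ^ N * r"
    by (auto simp: dvd_def)
  then obtain R where R: "\<And>k. k \<le> d \<Longrightarrow> P k = ?q ^ N * R k"
    by metis
  have Jd: "J \<le> d" "P J \<noteq> 0" using J by (auto simp: S_def)
  have "poly (R J) (1 / 4) \<noteq> 0"
  proof
    assume "poly (R J) (1 / 4) = 0"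
    then have "?q ^ Suc N dvd P J"
      unfolding R[OF Jd(1)] power_Suc2 by (intro mult_dvd_mono) (auto simp: poly_eq_0_iff_dvd)
    then show False
      using Jd J(2) by (simp add: order_divides del: power_Suc)
  qed
  moreover have factor: "(\<Sum>k\<le>d. evalp (P k) fls_X * fl f ^ k) = evalp (?q ^ N) fls_X * (\<Sum>k\<le>d. evalp (R k) fls_X * fl f ^ k)"
    unfolding sum_distrib_left by (intro sum.cong) (simp_all only: atMost_iff R evalp_mult mult_ac)
  then have "(\<Sum>k\<le>d. evalp (R k) fls_X * fl f ^ k) = 0"
  proof -
    have cancel: "b = 0" if "a \<noteq> 0" "a * b = 0" for a b :: "rat fls"
      using that by simp
    have "?q ^ N \<noteq> 0" by simp
    then have nz: "evalp (?q ^ N) fls_X \<noteq> 0"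
      using ev0 by blast
    have "evalp (?q ^ N) fls_X * (\<Sum>k\<le>d. evalp (R k) fls_X * fl f ^ k) = 0"
      unfolding factor[symmetric] by (rule rel)
    with nz show ?thesis
      by (rule cancel)
  qed
  moreover have flsum: "fl (sum g A) = (\<Sum>k\<in>A. fl (g k))" for g and A :: "nat set"
    by (induction A rule: infinite_finite_induct) (simp_all add: fl_homs)
  have "fl (\<Sum>k\<le>d. fps_of_poly (R k) * f ^ k) = (\<Sum>k\<le>d. evalp (R k) fls_X * fl f ^ k)"
    by (simp only: flsum fl_homs(6,7) ev)
  ultimately have "fl (\<Sum>k\<le>d. fps_of_poly (R k) * f ^ k) = fl 0"
    by (simp only: fl_homs(1))
  then have "(\<Sum>k\<le>d. fps_of_poly (R k) * f ^ k) = 0"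
    by (simp only: fl_homs(10))
  then show ?thesis
    using that \<open>poly (R J) (1 / 4) \<noteq> 0\<close> Jd(1) by blast
qed

text \<open>The factor \<open>n\<^sup>2\<close> produced by applying \<open>theta\<close> twice raises the coefficients to the order \<open>4 ^ n / n\<close>, that is, to a
  logarithmic singularity at \<open>t = 1 / 4\<close>. The derived series would be algebraic along with the given one.\<close>

theorem quadrant_transcendental:
  assumes "even i = even j"
  shows "transcendental_series (Q (int i) (int j))"
proof
  assume "algebraic_series (Q (int i) (int j))"
  then have "algebraic_series (fl (quadrant_fps i j))"
    by (simp add: Q_quadrant_fps fl_def)
  then obtain n where n: "rational_in.finite_ring fls_X (tspan (\<lambda>k. fl (quadrant_fps i j) ^ k) {..<n})"
    "fl (quadrant_fps i j) \<in> tspan (\<lambda>k. fl (quadrant_fps i j) ^ k) {..<n}"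
    "\<And>x. x \<in> tspan (\<lambda>k. fl (quadrant_fps i j) ^ k) {..<n} \<Longrightarrow> fls_deriv x \<in> tspan (\<lambda>k. fl (quadrant_fps i j) ^ k) {..<n}"
    by (rule algebraic_derivative_ring) blast
  have th: "fl (theta f) \<in> tspan (\<lambda>k. fl (quadrant_fps i j) ^ k) {..<n}"
    if "fl f \<in> tspan (\<lambda>k. fl (quadrant_fps i j) ^ k) {..<n}" for f
  proof -
    have "fl (theta f) = fls_X * fls_deriv (fl f)"
      by (simp only: theta_def fl_homs(6,9)) (simp only: fl_def fls_deriv_fps_to_fls)
    then show ?thesis
      by (simp only: rational_in.spn_scale[OF const_numeral_Qt(3) n(3)[OF that]])
  qed
  define g where "g = theta (theta (quadrant_fps i j))"
  have "fl g \<in> tspan (\<lambda>k. fl (quadrant_fps i j) ^ k) {..<n}"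
    unfolding g_def by (intro th n(2))
  then have "algebraic_series (fl g)"
    unfolding algebraic_series_iff by (rule rational_in.algebraic_over_finite_ring[OF n(1)])
  then obtain d R J where rel: "(\<Sum>j\<le>d. fps_of_poly (R j) * g ^ j) = 0" "J \<le> d" "poly (R J) (1 / 4) \<noteq> 0"
    by (rule algebraic_polynomial_relation)
  have gn: "fps_nth g n = (of_nat n)\<^sup>2 * (ballot n i * ballot n j)" for n
    by (simp add: g_def theta_nth quadrant_fps_def power2_eq_square)
  show False
  proof (rule log_singularity_no_relation[OF _ _ _ rel])
    show "0 \<le> fps_nth g n" for n
      by (simp add: gn ballot_nonneg)
    show "\<not> summable (\<lambda>n. of_rat (fps_nth g n) / 4 ^ n :: real)"
      unfolding gn by (rule quadrant_diverges[OF assms])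
    show "of_rat (fps_nth g n) / 4 ^ n \<le> (4 * (4 ^ i + 4 ^ j)) / (real n + 1)" for n
    proof -
      have l: "of_rat (fps_nth g n) / 4 ^ n = (of_rat (fps_nth g n / 4 ^ n) :: real)"
        by (simp only: of_rat_divide of_rat_power of_rat_numeral_eq)
      have r: "(4 * (4 ^ i + 4 ^ j)) / (real n + 1) = of_rat (4 * (4 ^ i + 4 ^ j) / (of_nat n + 1))"
        by (simp only: of_rat_divide of_rat_mult of_rat_add of_rat_power of_rat_numeral_eq of_rat_of_nat_eq of_rat_1)
      show ?thesis
        unfolding l r of_rat_less_eq unfolding gn by (rule quadrant_upper_bound)
    qed
  qed
qed

section \<open>Parity\<close>

definition flip :: "rat fps \<Rightarrow> rat fps" where
  "flip f = Abs_fps (\<lambda>n. (- 1) ^ n * fps_nth f n)"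

lemma flip_nth: "fps_nth (flip f) n = (- 1) ^ n * fps_nth f n"
  by (simp add: flip_def)

lemma flip_add: "flip (f + g) = flip f + flip g"
  and flip_diff: "flip (f - g) = flip f - flip g"
  and flip_const: "flip (fps_const c) = fps_const c"
  by (auto intro!: fps_ext simp: flip_nth algebra_simps)

lemma flip_mult: "flip (f * g) = flip f * flip g"
proof (rule fps_ext)
  fix n
  have "(- 1) ^ n * (fps_nth f i * fps_nth g (n - i)) = ((- 1) ^ i * fps_nth f i) * ((- 1) ^ (n - i) * fps_nth g (n - i))"
    if "i \<le> n" for i
  proof -
    have "(- 1 :: rat) ^ n = (- 1) ^ i * (- 1) ^ (n - i)"
      using that by (simp flip: power_add)
    then show ?thesis by (simp only: mult_ac)
  qed
  then show "fps_nth (flip (f * g)) n = fps_nth (flip f * flip g) n"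
    unfolding flip_nth fps_mult_nth sum_distrib_left by (intro sum.cong) auto
qed

lemma flip_X: "flip fps_X = - fps_X"
  by (rule fps_ext) (simp add: flip_nth fps_X_def)

lemma flip_numeral: "flip (numeral k) = numeral k" "flip 1 = 1"
  using flip_const[of "numeral k"] flip_const[of 1] by (simp_all add: fps_numeral_fps_const)

lemma flip_power: "flip (f ^ n) = flip f ^ n"
  by (induction n) (simp_all add: flip_numeral flip_mult)

text \<open>The equation for \<open>T\<close> involves \<open>t\<close> only through \<open>t\<^sup>2\<close>, and determines \<open>T\<close>.\<close>

lemma flip_T: "flip T = T"
proof -
  define S where "S = flip T"
  have "flip ((T - 1) * (T + 3) ^ 3) = flip (256 * fps_X\<^sup>2 * T ^ 3)"
    by (simp only: T_eq)
  then have S: "(S - 1) * (S + 3) ^ 3 = 256 * fps_X\<^sup>2 * S ^ 3"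
    by (simp only: flip_mult flip_power flip_diff flip_add flip_numeral flip_X S_def power2_minus)
  define U where "U = S ^ 3 + S\<^sup>2 * T + S * T\<^sup>2 + T ^ 3 + 8 * (S\<^sup>2 + S * T + T\<^sup>2) + 18 * (S + T)
      - 256 * fps_X\<^sup>2 * (S\<^sup>2 + S * T + T\<^sup>2)"
  have "(s - u) * (s ^ 3 + s\<^sup>2 * u + s * u\<^sup>2 + u ^ 3 + 8 * (s\<^sup>2 + s * u + u\<^sup>2) + 18 * (s + u)
      - 256 * x * (s\<^sup>2 + s * u + u\<^sup>2)) =
      ((s - 1) * (s + 3) ^ 3 - 256 * x * s ^ 3) - ((u - 1) * (u + 3) ^ 3 - 256 * x * u ^ 3)" for s u x :: "rat fps"
    by (simp add: power2_eq_square power3_eq_cube algebra_simps)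
  from this[of S T "fps_X\<^sup>2"] have "(S - T) * U = 0"
    by (simp only: U_def S T_eq) simp
  moreover have "fps_nth S 0 = 1"
    using T_0 by (simp add: S_def flip_nth)
  then have "fps_nth U 0 = 64"
    using T_0 by (simp add: U_def fps_power_zeroth fps_mult_nth_0 fps_numeral_nth)
  then have "U \<noteq> 0" by auto
  ultimately show ?thesis by (simp add: S_def)
qed

text \<open>The other square root \<open>- Z\<close> has the wrong constant coefficient.\<close>

lemma flip_Z: "flip Z = Z"
proof -
  have "(flip Z)\<^sup>2 = Z\<^sup>2"
    by (simp only: flip_power[symmetric] Z_square flip_T)
  then have "flip Z = Z \<or> flip Z = - Z"
    by (simp add: power2_eq_iff)
  moreover have "flip Z \<noteq> - Z"
    using Z_0 by (auto dest!: arg_cong[where f = "\<lambda>f. fps_nth f 0"] simp: flip_nth)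
  ultimately show ?thesis by blast
qed

lemma evalp_even:
  assumes "flip f = f"
  shows "\<exists>h. evalp p (fl f) = fl h \<and> flip h = h"
proof (induction p)
  case 0
  have "flip 0 = 0" using flip_const[of 0] by simp
  then show ?case by (intro exI[of _ 0]) (simp add: fl_homs)
next
  case (pCons a p)
  then obtain h where h: "evalp p (fl f) = fl h" "flip h = h" by blast
  have "evalp (pCons a p) (fl f) = fl (fps_const a + f * h)"
    unfolding map_poly_fls_const_pCons h(1) fl_homs fl_const ..
  moreover have "flip (fps_const a + f * h) = fps_const a + f * h"
    by (simp only: flip_add flip_mult flip_const h(2) assms)
  ultimately show ?case by blast
qed

text \<open>Over a field generated by an even series, the two parts of \<open>a + t b\<close> are its even and odd parts.\<close>

lemma parity_part:
  assumes f: "flip f = f" and A: "fl A \<in> adjoin (rational_in (fl f)) fls_X"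
  shows "flip A = A \<Longrightarrow> fl A \<in> rational_in (fl f)"
    and "flip A = - A \<Longrightarrow> \<exists>r\<in>rational_in (fl f). fl A = fls_X * r"
proof -
  obtain a b where ab: "fl A = a + fls_X * b" "a \<in> rational_in (fl f)" "b \<in> rational_in (fl f)"
    using A unfolding adjoin_def by blast
  have rep: "\<exists>p q. c = fl p / fl q \<and> flip p = p \<and> flip q = q \<and> fl q \<noteq> 0" if "c \<in> rational_in (fl f)" for c
    using that by (elim rational_inE) (metis evalp_even[OF f])
  obtain p1 q1 where 1: "a = fl p1 / fl q1" "flip p1 = p1" "flip q1 = q1" "fl q1 \<noteq> 0"
    using rep[OF ab(2)] by blast
  obtain p2 q2 where 2: "b = fl p2 / fl q2" "flip p2 = p2" "flip q2 = q2" "fl q2 \<noteq> 0"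
    using rep[OF ab(3)] by blast
  have "fl A * (fl q1 * fl q2) = fl p1 * fl q2 + fls_X * (fl p2 * fl q1)"
    unfolding ab(1) 1(1) 2(1) using 1(4) 2(4) by (simp add: field_simps)
  then have "fl (A * (q1 * q2)) = fl (p1 * q2 + fps_X * (p2 * q1))"
    by (simp only: fl_homs)
  then have e: "A * (q1 * q2) = p1 * q2 + fps_X * (p2 * q1)"
    by (simp only: fl_homs(10))
  from arg_cong[OF this, of flip] have e': "flip A * (q1 * q2) = p1 * q2 - fps_X * (p2 * q1)"
    by (simp only: flip_add flip_mult flip_X 1 2) simp
  have q: "q1 \<noteq> 0" "q2 \<noteq> 0"
    using 1(4) 2(4) by (auto simp: fl_homs)
  show "fl A \<in> rational_in (fl f)" if "flip A = A"
  proof -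
    have "2 * (fps_X * (p2 * q1)) = 0"
      using e e' that by (simp add: algebra_simps)
    then have "p2 = 0" using q two_cancel[of "fps_X * (p2 * q1)" 0] by simp
    then show ?thesis using ab 2 by (simp add: fl_homs)
  qed
  show "\<exists>r\<in>rational_in (fl f). fl A = fls_X * r" if "flip A = - A"
  proof -
    have "2 * (p1 * q2) = 0"
      using e e' that by (simp add: algebra_simps)
    then have "p1 = 0" using q two_cancel[of "p1 * q2" 0] by simp
    then show ?thesis using ab 1 by (auto simp: fl_homs)
  qed
qed

lemma flip_if_supported:
  assumes "\<And>n. fps_nth A n \<noteq> 0 \<Longrightarrow> even (int n) = even (i :: int)"
  shows "even i \<Longrightarrow> flip A = A" "odd i \<Longrightarrow> flip A = - A"
  using assms by (auto intro!: fps_ext simp: flip_nth) (metis minus_one_power_iff mult_minus1 mult_1 mult_zero_right)+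

lemma residue_part_support:
  assumes "fps_nth (residue_part i j) n \<noteq> 0"
  shows "even (int n) = even i"
proof -
  have "fps_nth (residue_part i j) n = 3 * fps_nth (three i j) n -
      (fps_nth (quarter (-i-2) j) n + fps_nth (quarter i (-j-2)) n - fps_nth (quarter i j) n)"
    by (simp add: residue_part_def reflected_def fps_numeral_fps_const)
  with assms have "fps_nth (three i j) n \<noteq> 0 \<or> fps_nth (quarter (-i-2) j) n \<noteq> 0 \<or>
      fps_nth (quarter i (-j-2)) n \<noteq> 0 \<or> fps_nth (quarter i j) n \<noteq> 0"
    by auto
  then show ?thesis
    by (elim disjE) (auto dest: walk_series_parity)
qed

section \<open>Decomposition of the series\<close>

lemma (in subfield_set) quotient_in: "a \<in> K \<Longrightarrow> b \<in> K \<Longrightarrow> a \<noteq> 0 \<Longrightarrow> \<exists>r\<in>K. b = a * r"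
  by (intro bexI[of _ "b / a"]) (auto intro: divide_in)

lemma half_combination:
  assumes "subfield_set K" "fl u \<in> K" "fl v \<in> K" "2 * A = u + 3 * v \<or> 2 * A = u - 3 * v"
  shows "fl A \<in> K"
proof -
  interpret subfield_set K by fact
  have "fl (2 * A) \<in> K"
    using assms(4)
  proof
    assume e: "2 * A = u + 3 * v"
    show ?thesis unfolding e fl_homs by (intro closed assms(2,3))
  next
    assume e: "2 * A = u - 3 * v"
    show ?thesis unfolding e fl_homs by (intro closed assms(2,3))
  qed
  then have "2 * fl A \<in> K"
    by (simp only: fl_homs)
  then show ?thesis
    by (rule cancel_in) (auto intro!: closed)
qed

lemma residue_part_in_FZ:
  assumes "0 \<le> i \<or> 0 \<le> j" "even (i - j)"
  shows "fl (residue_part i j) \<in> FZ"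
proof -
  have FZ: "subfield_set FZ" ..
  consider "i \<le> j" | "j \<le> i" by linarith
  then show ?thesis
  proof cases
    case 1
    obtain k l where "j = int l" "i = int l - 2 * int k"
    proof
      show "j = int (nat j)" "i = int (nat j) - 2 * int (nat ((j - i) div 2))"
        using 1 assms by auto
    qed
    then show ?thesis
      using half_combination[OF FZ parts_in_FZ(2,1)] residue_part_left(1) by blast
  next
    case 2
    obtain k l where "i = int l" "j = int l - 2 * int k"
    proof
      show "i = int (nat i)" "j = int (nat i) - 2 * int (nat ((i - j) div 2))"
        using 2 assms by auto
    qed
    then show ?thesis
      using half_combination[OF FZ parts_in_FZ(2,1)] residue_part_left(2) by blast
  qed
qed

lemma X_even_power_in_QZ: "even m \<Longrightarrow> fls_X ^ m \<in> QZ"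
proof (elim evenE)
  fix n assume "m = 2 * n"
  moreover have "fls_X * fls_X \<in> QZ"
    by (rule X_square_in[OF _ T_in_QZ]) (rule rational_in.subfield_set_axioms)
  ultimately show "fls_X ^ m \<in> QZ"
    by (simp add: power_mult power2_eq_square rational_in.power_in)
qed

lemma C_decomposition: "C i j = fls_const (1/3) * fl (reflected i j) + fls_const (1/3) * fl (residue_part i j)"
proof -
  have "3 * C i j = fl (reflected i j) + fl (residue_part i j)"
    by (simp add: residue_part_def fl_homs C_eq fl_def[symmetric])
  then have "fls_const (1/3) * (3 * C i j) = fls_const (1/3) * fl (reflected i j) + fls_const (1/3) * fl (residue_part i j)"
    by (simp add: distrib_left)
  moreover have "fls_const (1/3) * 3 = (1 :: rat fls)"
    by (metis fls_const_mult_const fls_const_numeral fls_const_1 nonzero_eq_divide_eq zero_neq_numeral)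
  ultimately show ?thesis
    by (simp add: mult.assoc[symmetric])
qed

text \<open>All coefficients of the residue part belong to exponents of the parity of \<open>i\<close>, so it is even or odd in
  \<open>t\<close>. Any power of \<open>t\<close> of the same parity may be split off, as \<open>t\<^sup>2\<close> is rational in \<open>Z\<close>.\<close>

lemma C_form:
  assumes "0 \<le> i \<or> 0 \<le> j" "even (i - j)" "even (int m) = even i"
  shows "\<exists>r\<in>QZ. C i j = fls_const (1/3) * fl (reflected i j) + fls_X ^ m * r"
proof -
  have A: "fl (residue_part i j) \<in> adjoin (rational_in (fl Z)) fls_X"
    using residue_part_in_FZ[OF assms(1,2)] by (simp add: FZ_def fl_def)
  note parity = parity_part[OF flip_Z A] flip_if_supported[of "residue_part i j" i, OF residue_part_support]
  have "\<exists>r\<in>QZ. fl (residue_part i j) = fls_X ^ m * r"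
  proof (cases "even i")
    case True
    then have "fl (residue_part i j) \<in> QZ"
      using parity by (simp add: fl_def)
    moreover have "fls_X ^ m \<in> QZ"
      using True assms(3) by (intro X_even_power_in_QZ) simp
    ultimately show ?thesis
      by (intro rational_in.quotient_in) auto
  next
    case False
    then obtain r where r: "r \<in> QZ" "fl (residue_part i j) = fls_X * r"
      using parity by (auto simp: fl_def)
    obtain n where n: "m = Suc n" "even n"
      using False assms(3) by (cases m) auto
    have "fls_X ^ n \<in> QZ"
      using n by (intro X_even_power_in_QZ) simp
    then obtain r' where "r' \<in> QZ" "r = fls_X ^ n * r'"
      using rational_in.quotient_in[of "fls_X ^ n" "fps_to_fls Z" r] r(1) by auto
    then show ?thesis
      using r(2) n(1) by (intro bexI[of _ r']) (simp_all add: mult.assoc)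
  qed
  then obtain r where r: "r \<in> QZ" "fl (residue_part i j) = fls_X ^ m * r" by blast
  have "C i j = fls_const (1/3) * fl (reflected i j) + fls_X ^ m * (fls_const (1/3) * r)"
    unfolding C_decomposition r(2) by (simp only: mult_ac)
  moreover have "fls_const (1/3) * r \<in> QZ"
    using r(1) by (intro rational_in.mult_in const_rational_in)
  ultimately show ?thesis by blast
qed

lemma reflected_left:
  assumes "1 \<le> i" "0 \<le> j"
  shows "fl (reflected (- i) j) = Q (i - 2) j" "fl (reflected j (- i)) = Q (i - 2) j"
proof -
  have "reflected (- i) j = quarter (i - 2) j"
    using assms quarter_outside[of "- i"] by (simp add: reflected_def)
  then show "fl (reflected (- i) j) = Q (i - 2) j"
    by (simp add: Q_eq fl_def)
  then show "fl (reflected j (- i)) = Q (i - 2) j"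
    by (simp add: reflected_commute[of j])
qed

lemma reflected_quadrant:
  assumes "0 \<le> i" "0 \<le> j"
  shows "fl (reflected i j) = - Q i j"
  using assms quarter_outside[of "- i - 2" j] quarter_outside[of i "- j - 2"]
  by (simp add: reflected_def fl_homs) (simp add: Q_eq fl_def)

text \<open>On the line \<open>i = -1\<close> the reflected quadrant walks vanish. For even \<open>j\<close> there are no walks at all; for
  odd \<open>j\<close> the lengths are odd.\<close>

lemma C_on_axis:
  "\<exists>r\<in>QT. C (-1) (int j) = fls_X * r" "\<exists>r\<in>QT. C (int j) (-1) = fls_X * r"
proof -
  have main: "\<exists>r\<in>QT. C i l = fls_X * r" if il: "i = -1 \<and> l = int j \<or> i = int j \<and> l = -1" for i l
  proof (cases "even j")
    case True
    then have "walk_series three_quadrants (-2, 0) i l = 0"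
      using il by (intro fps_ext) (auto dest!: walk_series_parity[rotated 0] intro: ccontr)
    then show ?thesis
      using rational_in.zero_in by (intro bexI[of _ 0]) (auto simp: C_eq)
  next
    case False
    then obtain k where k: "j = 2 * k + 1" by (elim oddE)
    interpret FT: subfield_with_t FT
    proof
      show "fls_X \<in> FT"
        unfolding FT_def by (rule X_adjoin) (rule rational_in.subfield_set_axioms)
      show "fps_to_fls T \<in> FT"
        unfolding FT_def using sub_adjoin[OF rational_in.subfield_set_axioms] self_rational_in by blast
    qed
    have refl: "reflected i l = 0"
      using il quarter_outside by (auto simp: reflected_def)
    have "2 * residue_part i l = sym_part (Suc k) (2 * k + 1) + 3 * anti_part (Suc k) (2 * k + 1) \<or>
        2 * residue_part i l = sym_part (Suc k) (2 * k + 1) - 3 * anti_part (Suc k) (2 * k + 1)"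
      using il residue_part_left[of "2 * k + 1" "Suc k"] k by auto
    then have "fl (residue_part i l) \<in> FT"
      by (rule half_combination[OF FT.subfield_set_axioms FT.parts_on_line_in(2,1)])
    then have A: "fl (residue_part i l) \<in> adjoin (rational_in (fl T)) fls_X"
      by (simp add: FT_def fl_def)
    have "odd i" using il k by auto
    then have "flip (residue_part i l) = - residue_part i l"
      by (intro flip_if_supported(2)[of "residue_part i l" i, OF residue_part_support])
    then obtain r where r: "r \<in> QT" "fl (residue_part i l) = fls_X * r"
      using parity_part(2)[OF flip_T A] by (auto simp: fl_def)
    have "C i l = fls_X * (fls_const (1/3) * r)"
      unfolding C_decomposition r(2) refl by (simp add: fl_homs mult_ac)
    then show ?thesis
      using r(1) by (intro bexI[of _ "fls_const (1/3) * r"]) (auto intro: rational_in.mult_in const_rational_in)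
  qed
  show "\<exists>r\<in>QT. C (-1) (int j) = fls_X * r" "\<exists>r\<in>QT. C (int j) (-1) = fls_X * r"
    by (rule main, simp)+
qed

lemma finite_ring_closed:
  assumes "rational_in.finite_ring fls_X R"
  shows "x \<in> R \<Longrightarrow> y \<in> R \<Longrightarrow> x + y \<in> R" "x \<in> R \<Longrightarrow> y \<in> R \<Longrightarrow> x * y \<in> R" "fls_const c \<in> R"
  using assms rational_in.spn_add rational_in.finite_ring_subset[OF assms const_rational_in]
  unfolding rational_in.finite_ring_def by blast+

lemma axis_algebraic:
  assumes "r \<in> QT"
  shows "algebraic_series (fls_X * r)"
proof -
  obtain R where R: "rational_in.finite_ring fls_X R" "fps_to_fls Z \<in> R"
    using rational_in.finite_ring_two[OF algebraic_Z[unfolded algebraic_series_iff] algebraic_Z[unfolded algebraic_series_iff]]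
    by blast
  have "fps_to_fls T = fps_to_fls Z * fps_to_fls Z"
    using arg_cong[OF Z_square, of fl] by (simp add: fl_homs fl_def[symmetric] power2_eq_square)
  then have "fps_to_fls T \<in> R"
    using R by (simp add: finite_ring_closed)
  from finite_ring_contains(1)[OF R(1) this] assms have "r \<in> R" by blast
  then have "fls_X * r \<in> R"
    using rational_in.finite_ring_subset[OF R(1) self_rational_in] R(1) by (simp add: finite_ring_closed)
  then show ?thesis
    unfolding algebraic_series_iff by (rule rational_in.algebraic_over_finite_ring[OF R(1)])
qed

lemma X_power_QZ_in_FZ: "r \<in> QZ \<Longrightarrow> fls_X ^ m * r \<in> FZ"
  using X_adjoin[of QZ fls_X] sub_adjoin[of QZ fls_X] rational_in.subfield_set_axioms
  by (auto simp: FZ_def[symmetric] intro!: FZ.mult_in FZ.power_in)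

lemma D_finite_form:
  assumes "y \<in> FZ"
  shows "D_finite (fls_const c * Q (int i) (int j) + y)"
proof -
  obtain n where n: "rational_in.finite_ring fls_X (tspan (\<lambda>k. fps_to_fls Z ^ k) {..<n})"
    "fps_to_fls Z \<in> tspan (\<lambda>k. fps_to_fls Z ^ k) {..<n}"
    "\<And>x. x \<in> tspan (\<lambda>k. fps_to_fls Z ^ k) {..<n} \<Longrightarrow> fls_deriv x \<in> tspan (\<lambda>k. fps_to_fls Z ^ k) {..<n}"
    using algebraic_Z by (rule algebraic_derivative_ring) blast
  let ?e = "\<lambda>k. fps_to_fls ((theta ^^ k) (quadrant_fps i j))"
  show ?thesis
  proof (rule D_finite_add[where B = "{..<4}" and e = ?e and B' = "{..<n}" and e' = "\<lambda>k. fps_to_fls Z ^ k"])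
    have "?e 0 \<in> tspan ?e {..<4}"
      by (rule rational_in.spn_base) auto
    then show "fls_const c * Q (int i) (int j) \<in> tspan ?e {..<4}"
      by (intro rational_in.spn_scale const_rational_in) (simp add: Q_quadrant_fps)
    show "y \<in> tspan (\<lambda>k. fps_to_fls Z ^ k) {..<n}"
      using assms finite_ring_contains(2)[OF n(1,2)] unfolding FZ_def by blast
    show "fls_deriv (fps_to_fls Z ^ b) \<in> tspan (\<lambda>k. fps_to_fls Z ^ k) {..<n}" if "b \<in> {..<n}" for b
      using that by (intro n(3) rational_in.spn_base) auto
  qed (use quadrant_span_deriv in auto)
qed

text \<open>Otherwise \<open>Q\<close> would lie in the finite-dimensional ring generated by \<open>Z\<close> and the given series.\<close>

lemma transcendental_form:
  assumes "y \<in> FZ" "c \<noteq> 0" "even i = even j"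
  shows "transcendental_series (fls_const c * Q (int i) (int j) + y)"
proof
  let ?x = "fls_const c * Q (int i) (int j) + y"
  assume "algebraic_series ?x"
  then obtain R where R: "rational_in.finite_ring fls_X R" "?x \<in> R" "fps_to_fls Z \<in> R"
    using rational_in.finite_ring_two[OF _ algebraic_Z[unfolded algebraic_series_iff], of ?x]
    unfolding algebraic_series_iff by blast
  have "y \<in> R"
    using assms finite_ring_contains(2)[OF R(1,3)] unfolding FZ_def by blast
  note closed = finite_ring_closed[OF R(1)]
  from closed(2)[OF closed(3) \<open>y \<in> R\<close>] have "fls_const (- 1) * y \<in> R" .
  from closed(2)[OF closed(3) closed(1)[OF R(2) this]]
  have "fls_const (1 / c) * (?x + fls_const (- 1) * y) \<in> R" .
  also have "?x + fls_const (- 1) * y = fls_const c * Q (int i) (int j)"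
    by simp
  also have "fls_const (1 / c) * \<dots> = Q (int i) (int j)"
    using assms(2) by (simp add: mult.assoc[symmetric] fls_const_mult_const)
  finally have "algebraic_series (Q (int i) (int j))"
    unfolding algebraic_series_iff by (rule rational_in.algebraic_over_finite_ring[OF R(1)])
  then show False
    using quadrant_transcendental[OF assms(3)] by blast
qed

lemma left_series:
  assumes "1 \<le> i" "even i = even j" and p: "p = (- int i, int j) \<or> p = (int j, - int i)"
  shows "D_finite (C (fst p) (snd p))"
    and "\<exists>r\<in>QZ. C (fst p) (snd p) = fls_const (1/3) * Q (int i - 2) (int j) + fls_X ^ min i j * r"
    and "2 \<le> i \<Longrightarrow> transcendental_series (C (fst p) (snd p))"
proof -
  have "fl (reflected (fst p) (snd p)) = Q (int i - 2) (int j)"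
    using p assms(1) reflected_left[of "int i" "int j"] by auto
  moreover have "\<exists>r\<in>QZ. C (fst p) (snd p) = fls_const (1/3) * fl (reflected (fst p) (snd p)) + fls_X ^ min i j * r"
    by (rule C_form) (use p assms(2) in \<open>auto simp: min_def\<close>)
  ultimately obtain r where r: "r \<in> QZ" "C (fst p) (snd p) = fls_const (1/3) * Q (int i - 2) (int j) + fls_X ^ min i j * r"
    by auto
  then show "\<exists>r\<in>QZ. C (fst p) (snd p) = fls_const (1/3) * Q (int i - 2) (int j) + fls_X ^ min i j * r"
    by blast
  have y: "fls_X ^ min i j * r \<in> FZ"
    by (rule X_power_QZ_in_FZ[OF r(1)])
  have i2: "int i - 2 = int (i - 2)" if "2 \<le> i"
    using that by simp
  show "transcendental_series (C (fst p) (snd p))" if "2 \<le> i"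
    unfolding r(2) i2[OF that] by (rule transcendental_form[OF y]) (use that assms(2) in auto)
  show "D_finite (C (fst p) (snd p))"
  proof (cases "2 \<le> i")
    case True
    show ?thesis
      unfolding r(2) i2[OF True] by (rule D_finite_form[OF y])
  next
    case False
    then have "Q (int i - 2) (int j) = 0"
      using quarter_outside[of "int i - 2"] by (simp add: Q_eq)
    then have "C (fst p) (snd p) = fls_const 0 * Q (int 0) (int 0) + fls_X ^ min i j * r"
      unfolding r(2) by simp
    then show ?thesis
      using D_finite_form[OF y] by (simp only:)
  qed
qed

lemma quadrant_series:
  fixes i j :: nat
  assumes "even i = even j"
  shows "D_finite (C (int i) (int j))"
    and "\<exists>r\<in>QZ. C (int i) (int j) = fls_const (- 1/3) * Q (int i) (int j) + fls_X ^ min i j * r"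
    and "transcendental_series (C (int i) (int j))"
proof -
  have "\<exists>r\<in>QZ. C (int i) (int j) = fls_const (1/3) * fl (reflected (int i) (int j)) + fls_X ^ min i j * r"
    by (rule C_form) (use assms in \<open>auto simp: min_def\<close>)
  moreover have "fls_const (1/3) * fl (reflected (int i) (int j)) = fls_const (- 1/3) * Q (int i) (int j)"
  proof -
    have "fls_const (- 1/3) = - fls_const (1/3 :: rat)"
      by (rule fls_eqI) (simp add: fls_const_nth)
    then show ?thesis
      by (simp only: reflected_quadrant[of "int i" "int j", simplified]) simp
  qed
  ultimately obtain r where r: "r \<in> QZ" "C (int i) (int j) = fls_const (- 1/3) * Q (int i) (int j) + fls_X ^ min i j * r"
    by auto
  then show "\<exists>r\<in>QZ. C (int i) (int j) = fls_const (- 1/3) * Q (int i) (int j) + fls_X ^ min i j * r"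
    by blast
  have y: "fls_X ^ min i j * r \<in> FZ"
    by (rule X_power_QZ_in_FZ[OF r(1)])
  show "D_finite (C (int i) (int j))"
    unfolding r(2) by (rule D_finite_form[OF y])
  show "transcendental_series (C (int i) (int j))"
    unfolding r(2) by (rule transcendental_form[OF y]) (use assms in auto)
qed

theorem corollary9:
  shows
    "(\<forall>j::nat.
        (\<exists>r \<in> rational_in (fps_to_fls T). C (-1) (int j) = fls_X * r) \<and>
        (\<exists>r \<in> rational_in (fps_to_fls T). C (int j) (-1) = fls_X * r) \<and>
        algebraic_series (C (-1) (int j)) \<and>
        algebraic_series (C (int j) (-1))) \<and>
     (\<forall>i j :: nat. 1 \<le> i \<longrightarrow> even i = even j \<longrightarrow>
        D_finite (C (- int i) (int j)) \<and>
        D_finite (C (int j) (- int i)) \<and>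
        (\<exists>r \<in> rational_in (fps_to_fls Z).
           C (- int i) (int j) = fls_const (1/3) * Q (int i - 2) (int j) + fls_X ^ min i j * r) \<and>
        (\<exists>r \<in> rational_in (fps_to_fls Z).
           C (int j) (- int i) = fls_const (1/3) * Q (int i - 2) (int j) + fls_X ^ min i j * r) \<and>
        (2 \<le> i \<longrightarrow>
           transcendental_series (C (- int i) (int j)) \<and>
           transcendental_series (C (int j) (- int i)))) \<and>
     (\<forall>i j :: nat. even i = even j \<longrightarrow>
        (\<exists>r \<in> rational_in (fps_to_fls Z).
           C (int i) (int j) = fls_const (- 1/3) * Q (int i) (int j) + fls_X ^ min i j * r) \<and>
        D_finite (C (int i) (int j)) \<and>
        transcendental_series (C (int i) (int j)))"
proof (intro conjI allI impI)
  fix j :: nat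
  show 1: "\<exists>r\<in>QT. C (-1) (int j) = fls_X * r" "\<exists>r\<in>QT. C (int j) (-1) = fls_X * r"
    by (rule C_on_axis)+
  show "algebraic_series (C (-1) (int j))" "algebraic_series (C (int j) (-1))"
    using 1 axis_algebraic by auto
next
  fix i j :: nat
  assume a: "1 \<le> i" "even i = even j"
  note left = left_series[OF a, of "(- int i, int j)", simplified fst_conv snd_conv]
    and below = left_series[OF a, of "(int j, - int i)", simplified fst_conv snd_conv]
  show "D_finite (C (- int i) (int j))" "D_finite (C (int j) (- int i))"
    using left(1) below(1) by blast+
  show "\<exists>r\<in>QZ. C (- int i) (int j) = fls_const (1/3) * Q (int i - 2) (int j) + fls_X ^ min i j * r"
    "\<exists>r\<in>QZ. C (int j) (- int i) = fls_const (1/3) * Q (int i - 2) (int j) + fls_X ^ min i j * r"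
    using left(2) below(2) by blast+
  show "transcendental_series (C (- int i) (int j))" "transcendental_series (C (int j) (- int i))" if "2 \<le> i"
    using left(3) below(3) that by blast+
next
  fix i j :: nat
  assume a: "even i = even j"
  show "\<exists>r\<in>QZ. C (int i) (int j) = fls_const (- 1/3) * Q (int i) (int j) + fls_X ^ min i j * r"
    "D_finite (C (int i) (int j))" "transcendental_series (C (int i) (int j))"
    using quadrant_series[OF a] by blast+
qed

end
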